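(* Let $\overline{\Sigma}_\gamma$ be a compact Riemann surface of genus $\gamma$ and let $\psi:\Sigma=\overline{\Sigma}_\gamma\setminus\{p_1,\dots,p_n\}\to\mathbb{R}^3$ be a complete affine maxface. Then $\psi$ is an improper affine front if and only if it is the elliptic paraboloid. Moreover, any complete affine maxface with constant affine Gauss map is the elliptic paraboloid.
   Context: Notation: $[\cdot,\cdot,\cdot]$ is the determinant of three vectors and $\times$ the cross product in $\mathbb{R}^3$, both extended complex-multilinearly to $\mathbb{C}^3$. Affine maximal map: let $\Sigma$ be a Riemann surface with universal cover $\tilde\Sigma$. A map $\psi:\Sigma\to\mathbb{R}^3$ is an affine maximal map if there is a holomorphic map $\Phi:\tilde\Sigma\to\mathbb{C}^3$, with $N:=\Phi+\overline{\Phi}$ single-valued on $\Sigma$, such that $[\Phi+\overline{\Phi},d\Phi,\overline{d\Phi}]\not\equiv0$ and $\psi=2\,\mathrm{Re}\left(i\int(\Phi+\overline{\Phi})\times d\Phi\right)$ (single-valued on $\Sigma$). $N$ is the conormal map, and $h=-2i[\Phi+\overline{\Phi},d\Phi,\overline{d\Phi}]$ (locally $-2i[\Phi+\overline\Phi,\Phi_z,\overline{\Phi_z}]\,|dz|^2$) the affine metric. Affine maxface: an affine maximal map whose conormal map $N:\Sigma\to\mathbb{R}^3$ is a Euclidean conformal minimal immersion. Its affine Gauss map is the Euclidean unit normal $\nu:\Sigma\to S^2$ of $N$, identified via stereographic projection with a meromorphic function $g$. Complete: $\psi$ is complete if there is a symmetric $(0,2)$-tensor $T$ with compact support such that $|h|+T$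 is a complete Riemannian metric on $\Sigma$ (locally $|h|=|a|\,|dz|^2$ if $h=a|dz|^2$). It is known that for every complete affine maximal map $\Sigma$ is biholomorphic to a compact Riemann surface minus finitely many points $p_1,\dots,p_n$ with $n\ge1$. Improper affine front: an affine maximal map whose conormal map has image contained in a plane of $\mathbb{R}^3$ (equivalently, here, the affine normal $\xi=\dfrac{d\Phi\times\overline{d\Phi}}{[\Phi+\overline{\Phi},d\Phi,\overline{d\Phi}]}$ is constant where defined; up to an equiaffine transformation $\xi\equiv(0,0,1)$ and $N$ takes values in $\{x^3=1\}$). The elliptic paraboloid: the graph $x^3=\tfrac12\left((x^1)^2+(x^2)^2\right)$ over the whole plane, up to equiaffine (volume-preserving affine) transformations of $\mathbb{R}^3$; "$\psi$ is the elliptic paraboloid" means that $\psi$ is a diffeomorphism of $\Sigma$ onto such a surface. *)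

theory Defs
  imports "HOL-Analysis.Analysis" "HOL-Homology.Homology"
begin

unbundle cross3_syntax

section \<open>Riemann surfaces\<close>

text \<open>A Riemann surface is a connected subset of a Hausdorff space with an atlas of complex
  charts. A chart consists of its domain and of a coordinate function, whose values off the domain
  are irrelevant.\<close>

type_synonym 'a chart = "'a set \<times> ('a \<Rightarrow> complex)"

definition chart_inv :: "'a chart \<Rightarrow> complex \<Rightarrow> 'a" where
  "chart_inv c = inv_into (fst c) (snd c)"

definition riemann_surface :: "'a::t2_space set \<Rightarrow> 'a chart set \<Rightarrow> bool" where
  "riemann_surface S A \<longleftrightarrow>
     connected S \<and> S \<noteq> {} \<and> (\<Union>c\<in>A. fst c) = S \<and>
     (\<forall>(U, \<phi>)\<in>A. openin (top_of_set S) U \<and> open (\<phi> ` U) \<and>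
        homeomorphism U (\<phi> ` U) \<phi> (chart_inv (U, \<phi>))) \<and>
     (\<forall>(U, \<phi>)\<in>A. \<forall>(V, \<eta>)\<in>A. (\<eta> \<circ> chart_inv (U, \<phi>)) holomorphic_on \<phi> ` (U \<inter> V))"

definition remove_points :: "'a chart set \<Rightarrow> 'a set \<Rightarrow> 'a chart set" where
  "remove_points A P = (\<lambda>(U, \<phi>). (U - P, \<phi>)) ` A"

text \<open>A compact connected oriented surface has genus \<open>\<gamma>\<close> iff its first integral homology group is
  free of rank \<open>2 * \<gamma>\<close>.\<close>

definition has_genus :: "'a::t2_space set \<Rightarrow> nat \<Rightarrow> bool" where
  "has_genus X \<gamma> \<longleftrightarrow> homology_group 1 (top_of_set X) \<cong> free_Abelian_group {..<2 * \<gamma>}"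

definition universal_cover :: "'b::t2_space set \<Rightarrow> ('b \<Rightarrow> 'a::t2_space) \<Rightarrow> 'a set \<Rightarrow> bool" where
  "universal_cover St pr S \<longleftrightarrow> covering_space St pr S \<and> simply_connected St"

text \<open>The universal cover carries the pulled-back complex structure. Its charts are the \<open>\<phi> \<circ> pr\<close>
  on open sets \<open>W\<close> which \<open>pr\<close> maps injectively into the domain of \<open>\<phi>\<close>; thus every local
  coordinate of the base is also one of the cover.\<close>

definition is_lift ::
    "'b::t2_space set \<Rightarrow> ('b \<Rightarrow> 'a::t2_space) \<Rightarrow> 'a chart \<Rightarrow> 'b set \<Rightarrow> bool" where
  "is_lift St pr c W \<longleftrightarrow> openin (top_of_set St) W \<and> inj_on pr W \<and> pr ` W \<subseteq> fst c"

definition cover_atlas ::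
    "'b::t2_space set \<Rightarrow> ('b \<Rightarrow> 'a::t2_space) \<Rightarrow> 'a chart set \<Rightarrow> 'b chart set" where
  "cover_atlas St pr A = {(W, snd c \<circ> pr) | W c. c \<in> A \<and> is_lift St pr c W}"

definition holomorphic_map3 :: "'b chart set \<Rightarrow> ('b \<Rightarrow> complex^3) \<Rightarrow> bool" where
  "holomorphic_map3 B F \<longleftrightarrow>
     (\<forall>c\<in>B. \<forall>i. (\<lambda>z. F (chart_inv c z) $ i) holomorphic_on snd c ` fst c)"

text \<open>The derivative \<open>F\<^sub>z\<close> of a holomorphic map with respect to the coordinate \<open>z\<close> of a chart.\<close>

definition dz :: "'b chart \<Rightarrow> ('b \<Rightarrow> complex^3) \<Rightarrow> 'b \<Rightarrow> complex^3" where
  "dz c F q = (\<chi> i. deriv (\<lambda>z. F (chart_inv c z) $ i) (snd c q))"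


section \<open>Complex vectors\<close>

definition of_real3 :: "real^3 \<Rightarrow> complex^3" where
  "of_real3 x = (\<chi> i. complex_of_real (x $ i))"

definition cnj3 :: "complex^3 \<Rightarrow> complex^3" where
  "cnj3 x = (\<chi> i. cnj (x $ i))"

definition Re3 :: "complex^3 \<Rightarrow> real^3" where
  "Re3 x = (\<chi> i. Re (x $ i))"

definition cross_c :: "complex^3 \<Rightarrow> complex^3 \<Rightarrow> complex^3" where
  "cross_c a b = vector [a $ 2 * b $ 3 - a $ 3 * b $ 2,
                         a $ 3 * b $ 1 - a $ 1 * b $ 3,
                         a $ 1 * b $ 2 - a $ 2 * b $ 1]"

definition triple_c :: "complex^3 \<Rightarrow> complex^3 \<Rightarrow> complex^3 \<Rightarrow> complex" where
  "triple_c a b c = det (vector [a, b, c] :: complex^3^3)"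


section \<open>Affine maximal maps\<close>

text \<open>\<open>affine_maximal_data S A St pr \<psi> \<Phi> N\<close>: the map \<open>\<psi>\<close> on the Riemann surface \<open>(S, A)\<close> with
  universal cover \<open>pr : St \<rightarrow> S\<close> is the affine maximal map given by \<open>\<Phi>\<close>, and \<open>N\<close> is its conormal
  map. That \<open>\<Phi> + cnj \<Phi>\<close> and \<open>\<psi>\<close> are single-valued means that they come from maps on \<open>S\<close>.
  Only the real part of the form under the integral is closed; the indefinite integral is a
  primitive of this real part on the universal cover, determined up to an additive constant.\<close>

definition affine_maximal_data ::
    "'a::t2_space set \<Rightarrow> 'a chart set \<Rightarrow> 'b::t2_space set \<Rightarrow> ('b \<Rightarrow> 'a) \<Rightarrow>
     ('a \<Rightarrow> real^3) \<Rightarrow> ('b \<Rightarrow> complex^3) \<Rightarrow> ('a \<Rightarrow> real^3) \<Rightarrow> bool" where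
  "affine_maximal_data S A St pr \<psi> \<Phi> N \<longleftrightarrow>
     holomorphic_map3 (cover_atlas St pr A) \<Phi> \<and>
     (\<forall>q\<in>St. of_real3 (N (pr q)) = \<Phi> q + cnj3 (\<Phi> q)) \<and>
     (\<exists>c\<in>cover_atlas St pr A. \<exists>q\<in>fst c.
        triple_c (\<Phi> q + cnj3 (\<Phi> q)) (dz c \<Phi> q) (cnj3 (dz c \<Phi> q)) \<noteq> 0) \<and>
     (\<forall>c\<in>cover_atlas St pr A. \<forall>q\<in>fst c.
        ((\<lambda>z. \<psi> (pr (chart_inv c z))) has_derivative
         (\<lambda>v. 2 *\<^sub>R Re3 (\<i> *s cross_c (\<Phi> q + cnj3 (\<Phi> q)) (v *s dz c \<Phi> q)))) (at (snd c q)))"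

text \<open>The data \<open>\<Phi>\<close>, \<open>N\<close> are existentially quantified in the notions below. This is harmless:
  \<open>\<psi>\<close> determines \<open>N\<close> and \<open>d\<Phi>\<close> up to a common sign, and all of these notions are invariant under
  a change of that sign.\<close>

definition affine_maximal_map ::
    "'a::t2_space set \<Rightarrow> 'a chart set \<Rightarrow> 'b::t2_space set \<Rightarrow> ('b \<Rightarrow> 'a) \<Rightarrow>
     ('a \<Rightarrow> real^3) \<Rightarrow> bool" where
  "affine_maximal_map S A St pr \<psi> \<longleftrightarrow> (\<exists>\<Phi> N. affine_maximal_data S A St pr \<psi> \<Phi> N)"

text \<open>The coefficient \<open>a\<close> of the affine metric \<open>h = a |dz|\<^sup>2\<close> in a chart of the universal cover.\<close>

definition affine_metric_coeff :: "'b chart \<Rightarrow> ('b \<Rightarrow> complex^3) \<Rightarrow> 'b \<Rightarrow> complex" where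
  "affine_metric_coeff c \<Phi> q =
     - 2 * \<i> * triple_c (\<Phi> q + cnj3 (\<Phi> q)) (dz c \<Phi> q) (cnj3 (dz c \<Phi> q))"


section \<open>Conformal minimal immersions and affine maxfaces\<close>

definition pd1 :: "(complex \<Rightarrow> 'v::real_normed_vector) \<Rightarrow> complex \<Rightarrow> 'v" where
  "pd1 F z = vector_derivative (\<lambda>t. F (z + of_real t)) (at 0)"

definition pd2 :: "(complex \<Rightarrow> 'v::real_normed_vector) \<Rightarrow> complex \<Rightarrow> 'v" where
  "pd2 F z = vector_derivative (\<lambda>t. F (z + of_real t * \<i>)) (at 0)"

definition unit_normal :: "(complex \<Rightarrow> real^3) \<Rightarrow> complex \<Rightarrow> real^3" where
  "unit_normal F z = (pd1 F z \<times> pd2 F z) /\<^sub>R norm (pd1 F z \<times> pd2 F z)"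

definition mean_curvature :: "(complex \<Rightarrow> real^3) \<Rightarrow> complex \<Rightarrow> real" where
  "mean_curvature F z =
     (let E1 = pd1 F z \<bullet> pd1 F z; F1 = pd1 F z \<bullet> pd2 F z; G1 = pd2 F z \<bullet> pd2 F z;
          n = unit_normal F z;
          L2 = pd1 (pd1 F) z \<bullet> n; M2 = pd1 (pd2 F) z \<bullet> n; N2 = pd2 (pd2 F) z \<bullet> n
      in (E1 * N2 - 2 * F1 * M2 + G1 * L2) / (2 * (E1 * G1 - F1\<^sup>2)))"

definition smooth_on :: "complex set \<Rightarrow> (complex \<Rightarrow> 'v::real_normed_vector) \<Rightarrow> bool" where
  "smooth_on W F \<longleftrightarrow>
     (\<forall>ds. set ds \<subseteq> {pd1, pd2} \<longrightarrow> foldr (\<lambda>d. d) ds F differentiable_on W)"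

definition conformal_minimal_immersion :: "'a chart set \<Rightarrow> ('a \<Rightarrow> real^3) \<Rightarrow> bool" where
  "conformal_minimal_immersion A N \<longleftrightarrow>
     (\<forall>c\<in>A. smooth_on (snd c ` fst c) (N \<circ> chart_inv c) \<and>
        (\<forall>z\<in>snd c ` fst c.
           (\<exists>D r. ((N \<circ> chart_inv c) has_derivative D) (at z) \<and> r > 0 \<and>
              (\<forall>v w. D v \<bullet> D w = r * (v \<bullet> w))) \<and>
           mean_curvature (N \<circ> chart_inv c) z = 0))"

definition affine_maxface ::
    "'a::t2_space set \<Rightarrow> 'a chart set \<Rightarrow> 'b::t2_space set \<Rightarrow> ('b \<Rightarrow> 'a) \<Rightarrow>
     ('a \<Rightarrow> real^3) \<Rightarrow> bool" where
  "affine_maxface S A St pr \<psi> \<longleftrightarrow>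
     (\<exists>\<Phi> N. affine_maximal_data S A St pr \<psi> \<Phi> N \<and> conformal_minimal_immersion A N)"

text \<open>The affine Gauss map is taken with values in the sphere. Stereographic projection, which
  turns it into a meromorphic function, is a bijection and does not affect constancy.\<close>

definition is_affine_gauss_map ::
    "'a::t2_space set \<Rightarrow> 'a chart set \<Rightarrow> 'b::t2_space set \<Rightarrow> ('b \<Rightarrow> 'a) \<Rightarrow>
     ('a \<Rightarrow> real^3) \<Rightarrow> ('a \<Rightarrow> real^3) \<Rightarrow> bool" where
  "is_affine_gauss_map S A St pr \<psi> \<nu> \<longleftrightarrow>
     (\<exists>\<Phi> N. affine_maximal_data S A St pr \<psi> \<Phi> N \<and> conformal_minimal_immersion A N \<and>
        (\<forall>c\<in>A. \<forall>p\<in>fst c. \<nu> p = unit_normal (N \<circ> chart_inv c) (snd c p)))"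

definition improper_affine_front ::
    "'a::t2_space set \<Rightarrow> 'a chart set \<Rightarrow> 'b::t2_space set \<Rightarrow> ('b \<Rightarrow> 'a) \<Rightarrow>
     ('a \<Rightarrow> real^3) \<Rightarrow> bool" where
  "improper_affine_front S A St pr \<psi> \<longleftrightarrow>
     (\<exists>\<Phi> N. affine_maximal_data S A St pr \<psi> \<Phi> N \<and>
        (\<exists>a b. a \<noteq> 0 \<and> (\<forall>p\<in>S. a \<bullet> N p = b)))"


section \<open>Completeness\<close>

text \<open>A \<open>(0,2)\<close>-tensor is given by its bilinear form in each chart, at each point of the domain;
  tangent vectors at a point are complex numbers with respect to a chart.\<close>

type_synonym 'a tensor2 = "'a chart \<Rightarrow> 'a \<Rightarrow> complex \<Rightarrow> complex \<Rightarrow> real"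

definition symmetric_tensor :: "'a chart set \<Rightarrow> 'a tensor2 \<Rightarrow> bool" where
  "symmetric_tensor A T \<longleftrightarrow>
     (\<forall>c\<in>A. \<forall>p\<in>fst c. bilinear (T c p) \<and> (\<forall>v w. T c p v w = T c p w v)) \<and>
     (\<forall>c\<in>A. \<forall>e\<in>A. \<forall>p\<in>fst c \<inter> fst e. \<forall>v w.
        (let k = deriv (snd e \<circ> chart_inv c) (snd c p)
         in T c p v w = T e p (k * v) (k * w)))"

definition compact_support :: "'a::t2_space set \<Rightarrow> 'a chart set \<Rightarrow> 'a tensor2 \<Rightarrow> bool" where
  "compact_support S A T \<longleftrightarrow>
     (\<exists>K. compact K \<and> K \<subseteq> S \<and> (\<forall>c\<in>A. \<forall>p\<in>fst c - K. \<forall>v w. T c p v w = 0))"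

text \<open>Riemannian metrics are only required to be continuous, since \<open>|h|\<close> need not be smooth where
  \<open>h\<close> vanishes. For the notion of completeness below this is immaterial: it can hold only if the
  zeros of \<open>h\<close> lie in a compact set, over which \<open>T\<close> may be changed freely.\<close>

definition riemannian_metric :: "'a::t2_space chart set \<Rightarrow> 'a tensor2 \<Rightarrow> bool" where
  "riemannian_metric A g \<longleftrightarrow>
     symmetric_tensor A g \<and>
     (\<forall>c\<in>A. \<forall>p\<in>fst c. \<forall>v. v \<noteq> 0 \<longrightarrow> g c p v v > 0) \<and>
     (\<forall>c\<in>A. \<forall>v w. continuous_on (fst c) (\<lambda>p. g c p v w))"

text \<open>The speed does not depend on the chart chosen, except at the finitely many times where the
  curve is not differentiable.\<close>

definition speed :: "'a chart set \<Rightarrow> 'a tensor2 \<Rightarrow> (real \<Rightarrow> 'a) \<Rightarrow> real \<Rightarrow> real" where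
  "speed A g \<gamma> t =
     (let c = (SOME c. c \<in> A \<and> \<gamma> t \<in> fst c); v = vector_derivative (snd c \<circ> \<gamma>) (at t)
      in sqrt (g c (\<gamma> t) v v))"

text \<open>Integrability of the speed has to be demanded because \<^const>\<open>piecewise_C1_differentiable_on\<close>
  allows unbounded derivatives near the break points.\<close>

definition curves ::
    "'a::t2_space set \<Rightarrow> 'a chart set \<Rightarrow> 'a tensor2 \<Rightarrow> 'a \<Rightarrow> 'a \<Rightarrow> (real \<Rightarrow> 'a) set" where
  "curves S A g x y =
     {\<gamma>. path \<gamma> \<and> path_image \<gamma> \<subseteq> S \<and> pathstart \<gamma> = x \<and> pathfinish \<gamma> = y \<and>
         (\<forall>c\<in>A. \<forall>a b. 0 \<le> a \<and> a \<le> b \<and> b \<le> 1 \<and> \<gamma> ` {a..b} \<subseteq> fst c \<longrightarrow>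
            (snd c \<circ> \<gamma>) piecewise_C1_differentiable_on {a..b}) \<and>
         speed A g \<gamma> integrable_on {0..1}}"

definition riemannian_dist ::
    "'a::t2_space set \<Rightarrow> 'a chart set \<Rightarrow> 'a tensor2 \<Rightarrow> 'a \<Rightarrow> 'a \<Rightarrow> real" where
  "riemannian_dist S A g x y =
     (if x \<in> S \<and> y \<in> S then INF \<gamma>\<in>curves S A g x y. integral {0..1} (speed A g \<gamma>) else 0)"

definition complete_riemannian_metric ::
    "'a::t2_space set \<Rightarrow> 'a chart set \<Rightarrow> 'a tensor2 \<Rightarrow> bool" where
  "complete_riemannian_metric S A g \<longleftrightarrow>
     riemannian_metric A g \<and>
     Metric_space S (riemannian_dist S A g) \<and>
     Metric_space.mcomplete S (riemannian_dist S A g)"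

definition complete_map ::
    "'a::t2_space set \<Rightarrow> 'a chart set \<Rightarrow> 'b::t2_space set \<Rightarrow> ('b \<Rightarrow> 'a) \<Rightarrow>
     ('a \<Rightarrow> real^3) \<Rightarrow> bool" where
  "complete_map S A St pr \<psi> \<longleftrightarrow>
     (\<exists>\<Phi> N T g. affine_maximal_data S A St pr \<psi> \<Phi> N \<and>
        symmetric_tensor A T \<and> compact_support S A T \<and>
        (\<forall>c\<in>A. \<forall>W. is_lift St pr c W \<longrightarrow> (\<forall>q\<in>W. \<forall>v w.
           g c (pr q) v w =
             norm (affine_metric_coeff (W, snd c \<circ> pr) \<Phi> q) * (v \<bullet> w) + T c (pr q) v w)) \<and>
        complete_riemannian_metric S A g)"

definition complete_affine_maxface ::
    "'a::t2_space set \<Rightarrow> 'a chart set \<Rightarrow> 'b::t2_space set \<Rightarrow> ('b \<Rightarrow> 'a) \<Rightarrow>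
     ('a \<Rightarrow> real^3) \<Rightarrow> bool" where
  "complete_affine_maxface S A St pr \<psi> \<longleftrightarrow>
     affine_maxface S A St pr \<psi> \<and> complete_map S A St pr \<psi>"


section \<open>The elliptic paraboloid\<close>

definition paraboloid_graph :: "complex \<Rightarrow> real^3" where
  "paraboloid_graph x = vector [Re x, Im x, ((Re x)\<^sup>2 + (Im x)\<^sup>2) / 2]"

text \<open>Diffeomorphisms onto a surface in space that is the image of the plane under a global
  parametrization \<open>\<sigma>\<close>, whose inverse serves as the coordinate on the surface.\<close>

definition diffeomorphism_onto ::
    "'a::t2_space set \<Rightarrow> 'a chart set \<Rightarrow> ('a \<Rightarrow> real^3) \<Rightarrow> (complex \<Rightarrow> real^3) \<Rightarrow> bool" where
  "diffeomorphism_onto S A \<psi> \<sigma> \<longleftrightarrow>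
     homeomorphism S (range \<sigma>) \<psi> (inv_into S \<psi>) \<and>
     (\<forall>c\<in>A. smooth_on (snd c ` fst c) (\<psi> \<circ> chart_inv c) \<and>
            smooth_on {x. \<sigma> x \<in> \<psi> ` fst c} (snd c \<circ> inv_into S \<psi> \<circ> \<sigma>))"

definition elliptic_paraboloid ::
    "'a::t2_space set \<Rightarrow> 'a chart set \<Rightarrow> ('a \<Rightarrow> real^3) \<Rightarrow> bool" where
  "elliptic_paraboloid S A \<psi> \<longleftrightarrow>
     (\<exists>(L :: real^3^3) b. \<bar>det L\<bar> = 1 \<and>
        diffeomorphism_onto S A \<psi> (\<lambda>x. L *v paraboloid_graph x + b))"

end

theory Submission
  imports Defs "HOL-Complex_Analysis.Complex_Analysis"
begin

text \<open>Let \<open>N\<close> be the conormal map of a complete affine maxface and suppose that it lies in a plane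
  \<open>a \<bullet> x = b\<close>; then \<open>b \<noteq> 0\<close>. As \<open>N\<close> is a conformal immersion, Euclidean coordinates in the plane,
  suitably oriented, turn \<open>N\<close> into a locally biholomorphic function \<open>F\<close>, and the affine metric is a
  constant multiple of \<open>\<bar>dF\<bar>\<^sup>2\<close>. Completeness therefore makes the local isometry \<open>F\<close> a bijection onto
  the plane, and integrating \<open>d\<psi>(v) = N \<times> dN(i v)\<close> in the coordinate \<open>F\<close> exhibits \<open>\<psi>\<close> as a
  quadratic graph. A constant unit normal \<open>\<nu>\<close> of \<open>N\<close> forces \<open>\<nu> \<bullet> N\<close> to be constant, so that case is
  included. Conversely, the conormal map of an elliptic paraboloid is the standard conormal
  \<open>(-x, 1)\<close> up to a factor \<open>\<lambda>\<close>, and the same equation for \<open>d\<psi>\<close> gives \<open>\<lambda>\<^sup>4 = 1\<close> pointwise.\<close>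

section \<open>Holomorphic developing maps\<close>

text \<open>The maxface property, planarity and completeness each bring their own conormal map, and
  these need not coincide. They are reconciled through \<psi>: its normal fixes the direction of a
  conormal map wherever the affine metric does not vanish, and the formula for
  \<open>d\<psi>\<close> fixes its length, so that only a sign is left open at each point. The
  metric is flat only off the compact support of \<open>T\<close>, and completeness speaks of Cauchy
  sequences for an infimum of lengths. The argument therefore avoids geodesics. Compactness bounds
  the metric above and below by multiples of \<open>|dF|^2\<close>, and inverse branches of
  \<open>F\<close> over discs are enlarged by gluing; an obstruction at one radius moves to a nearby
  point at half the radius, and completeness rules out the limit. The formula
  \<open>d\<psi>(v) = N \<times> dN(i v)\<close> is the integrand in real terms:
  \<open>N = 2 Re \<Phi>\<close> gives \<open>dN(i v) = 2 Re (i v \<Phi>\<^sub>z)\<close>.\<close>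

lemma riemann_surface_chartD:
  assumes "riemann_surface S A" "c \<in> A"
  shows "openin (top_of_set S) (fst c)" "open (snd c ` fst c)"
    "homeomorphism (fst c) (snd c ` fst c) (snd c) (chart_inv c)"
proof -
  have "\<forall>(U, \<phi>)\<in>A. openin (top_of_set S) U \<and> open (\<phi> ` U) \<and>
        homeomorphism U (\<phi> ` U) \<phi> (chart_inv (U, \<phi>))"
    using assms(1) unfolding riemann_surface_def by (elim conjE)
  from bspec[OF this assms(2)] show "openin (top_of_set S) (fst c)" "open (snd c ` fst c)"
    "homeomorphism (fst c) (snd c ` fst c) (snd c) (chart_inv c)"
    by (simp_all add: split_beta)
qed

section \<open>Charts and their transition maps\<close>

locale surface =
  fixes S :: "'a::t2_space set" and A :: "'a chart set"
  assumes surface: "riemann_surface S A"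
begin

lemma connected_S: "connected S"
  and S_nonempty: "S \<noteq> {}"
  and Union_domains: "(\<Union>c\<in>A. fst c) = S"
  using surface unfolding riemann_surface_def by auto

lemma chart_ex: "p \<in> S \<Longrightarrow> \<exists>c\<in>A. p \<in> fst c"
  using Union_domains by blast

lemma domain_subset: "c \<in> A \<Longrightarrow> fst c \<subseteq> S"
  using Union_domains by blast

lemmas domain_openin = riemann_surface_chartD(1)[OF surface]
  and image_open = riemann_surface_chartD(2)[OF surface]
  and chart_homeomorphism = riemann_surface_chartD(3)[OF surface]

lemma coord_continuous: "c \<in> A \<Longrightarrow> continuous_on (fst c) (snd c)"
  and chart_inv_continuous: "c \<in> A \<Longrightarrow> continuous_on (snd c ` fst c) (chart_inv c)"
  and chart_inv_coord [simp]: "c \<in> A \<Longrightarrow> p \<in> fst c \<Longrightarrow> chart_inv c (snd c p) = p"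
  and chart_inv_in: "c \<in> A \<Longrightarrow> z \<in> snd c ` fst c \<Longrightarrow> chart_inv c z \<in> fst c"
  and coord_chart_inv: "c \<in> A \<Longrightarrow> z \<in> snd c ` fst c \<Longrightarrow> snd c (chart_inv c z) = z"
  using chart_homeomorphism[of c] unfolding homeomorphism_def by auto

lemma coord_image_open:
  assumes "c \<in> A" "openin (top_of_set S) U" "U \<subseteq> fst c"
  shows "open (snd c ` U)"
proof -
  have "openin (top_of_set (fst c)) U"
    using assms by (meson openin_subset_trans domain_subset)
  then have "openin (top_of_set (snd c ` fst c)) (snd c ` U)"
    using chart_homeomorphism[OF assms(1)] homeomorphism_imp_open_map by blast
  then show ?thesis
    using image_open[OF assms(1)] openin_open_trans by blast
qed

lemma open_preimage:
  assumes "continuous_on B \<gamma>" "\<gamma> ` B \<subseteq> S" "open B" "openin (top_of_set S) U"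
  shows "open (B \<inter> \<gamma> -` U)"
proof -
  have "openin (top_of_set B) (B \<inter> \<gamma> -` U)"
    by (rule continuous_openin_preimage[OF assms(1) _ assms(4)]) (use assms(2) in auto)
  then show ?thesis using assms(3) by (rule openin_open_trans)
qed

lemma transition_holomorphic:
  assumes "c \<in> A" "e \<in> A"
  shows "(snd e \<circ> chart_inv c) holomorphic_on snd c ` (fst c \<inter> fst e)"
proof -
  have "\<forall>(U, \<phi>)\<in>A. \<forall>(V, \<eta>)\<in>A. (\<eta> \<circ> chart_inv (U, \<phi>)) holomorphic_on \<phi> ` (U \<inter> V)"
    using surface unfolding riemann_surface_def by (elim conjE)
  from bspec[OF bspec[OF this assms(1), unfolded split_beta] assms(2)] show ?thesis
    by (simp add: split_beta)
qed

lemma overlap_open: "c \<in> A \<Longrightarrow> e \<in> A \<Longrightarrow> open (snd c ` (fst c \<inter> fst e))"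
  by (intro coord_image_open) (auto intro: domain_openin)

lemma transition_derivative:
  assumes "c \<in> A" "e \<in> A" "p \<in> fst c" "p \<in> fst e"
  shows "((snd e \<circ> chart_inv c) has_field_derivative deriv (snd e \<circ> chart_inv c) (snd c p)) (at (snd c p))"
  using holomorphic_derivI[OF transition_holomorphic[OF assms(1,2)] overlap_open[OF assms(1,2)]] assms
  by auto

lemma change_of_chart:
  assumes c: "c \<in> A" "e \<in> A" "p \<in> fst c" "p \<in> fst e"
    and f: "((f \<circ> chart_inv e) has_derivative D) (at (snd e p))"
  shows "((f \<circ> chart_inv c) has_derivative (\<lambda>v. D (deriv (snd e \<circ> chart_inv c) (snd c p) * v)))
           (at (snd c p))"
proof -
  have "((\<lambda>z. (f \<circ> chart_inv e) ((snd e \<circ> chart_inv c) z)) has_derivative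
          (\<lambda>v. D (deriv (snd e \<circ> chart_inv c) (snd c p) * v))) (at (snd c p))"
  proof (rule has_derivative_compose[where g = "f \<circ> chart_inv e"])
    show "((snd e \<circ> chart_inv c) has_derivative (\<lambda>v. deriv (snd e \<circ> chart_inv c) (snd c p) * v)) (at (snd c p))"
      using transition_derivative[OF c] unfolding has_field_derivative_def .
    have "(snd e \<circ> chart_inv c) (snd c p) = snd e p" using c by simp
    then show "((f \<circ> chart_inv e) has_derivative D) (at ((snd e \<circ> chart_inv c) (snd c p)))"
      using f by (simp only:)
  qed
  then show ?thesis
    by (rule has_derivative_transform_within_open[OF _ overlap_open[OF c(1,2)]])
       (use c in auto)
qed

text \<open>The two transition maps are mutually inverse, so their derivatives are reciprocal. Later
  this serves to show that a transition derivative does not vanish.\<close>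

lemma transition_chain:
  assumes c: "c \<in> A" "e \<in> A" "p \<in> fst c" "p \<in> fst e"
  shows "deriv (snd c \<circ> chart_inv e) (snd e p) * deriv (snd e \<circ> chart_inv c) (snd c p) = 1"
proof -
  have "((snd c \<circ> chart_inv c) has_derivative
          (\<lambda>v. deriv (snd c \<circ> chart_inv e) (snd e p) * (deriv (snd e \<circ> chart_inv c) (snd c p) * v)))
        (at (snd c p))"
    using change_of_chart[OF c transition_derivative[OF c(2,1,4,3), unfolded has_field_derivative_def]] .
  moreover have "((snd c \<circ> chart_inv c) has_derivative (\<lambda>v. v)) (at (snd c p))"
    by (rule has_derivative_transform_within_open[OF has_derivative_ident image_open[OF c(1)]])
       (use c in auto)
  ultimately have "(\<lambda>v. deriv (snd c \<circ> chart_inv e) (snd e p) * (deriv (snd e \<circ> chart_inv c) (snd c p) * v))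
      = (\<lambda>v. v)"
    by (rule has_derivative_unique)
  from fun_cong[OF this, of 1] show ?thesis by (simp only: mult_1_right)
qed

lemma continuous_on_chartwise:
  assumes "\<And>c. c \<in> A \<Longrightarrow> continuous_on (fst c) f"
  shows "continuous_on S f"
  unfolding continuous_on_eq_continuous_within
proof
  fix p assume "p \<in> S"
  then obtain c where c: "c \<in> A" "p \<in> fst c" using chart_ex by blast
  obtain T where T: "open T" "fst c = S \<inter> T"
    using domain_openin[OF c(1)] by (auto simp: openin_open)
  have "continuous (at p within fst c) f"
    using assms[OF c(1)] c(2) by (simp add: continuous_on_eq_continuous_within)
  moreover have "at p within S = at p within fst c"
    by (rule at_within_nhd[of p T]) (use T c in auto)
  ultimately show "continuous (at p within S) f" by simp
qed

lemma continuous_on_coord: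
  assumes "\<And>c. c \<in> A \<Longrightarrow> continuous_on (snd c ` fst c) (f \<circ> chart_inv c)"
  shows "continuous_on S f"
proof (rule continuous_on_chartwise)
  fix c assume c: "c \<in> A"
  have "continuous_on (fst c) ((f \<circ> chart_inv c) \<circ> snd c)"
    by (rule continuous_on_compose[OF coord_continuous[OF c] assms[OF c]])
  then show "continuous_on (fst c) f"
    by (rule continuous_on_eq) (use c in auto)
qed

end

text \<open>\<open>F\<close> plays the role of the developing map of the flat metric
  \<open>|dF|^2\<close>: a coordinate near every point, with neither injectivity nor surjectivity
  assumed.\<close>

locale developing = surface S A for S :: "'a::t2_space set" and A +
  fixes F :: "'a \<Rightarrow> complex"
  assumes F_holomorphic: "c \<in> A \<Longrightarrow> (F \<circ> chart_inv c) holomorphic_on snd c ` fst c"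
    and F_regular: "c \<in> A \<Longrightarrow> p \<in> fst c \<Longrightarrow> deriv (F \<circ> chart_inv c) (snd c p) \<noteq> 0"
begin

definition dF :: "'a chart \<Rightarrow> 'a \<Rightarrow> complex" where
  "dF c p = deriv (F \<circ> chart_inv c) (snd c p)"

lemma dF_nonzero: "c \<in> A \<Longrightarrow> p \<in> fst c \<Longrightarrow> dF c p \<noteq> 0"
  unfolding dF_def by (rule F_regular)

lemma F_has_derivative:
  "c \<in> A \<Longrightarrow> p \<in> fst c \<Longrightarrow> ((F \<circ> chart_inv c) has_field_derivative dF c p) (at (snd c p))"
  unfolding dF_def by (intro holomorphic_derivI[OF F_holomorphic image_open]) auto

lemma dF_change:
  assumes "c \<in> A" "e \<in> A" "p \<in> fst c" "p \<in> fst e"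
  shows "dF c p = dF e p * deriv (snd e \<circ> chart_inv c) (snd c p)"
proof -
  have "((F \<circ> chart_inv c) has_derivative
      (\<lambda>v. dF e p * (deriv (snd e \<circ> chart_inv c) (snd c p) * v))) (at (snd c p))"
    by (rule change_of_chart[OF assms F_has_derivative[OF assms(2,4), unfolded has_field_derivative_def]])
  then have "((F \<circ> chart_inv c) has_field_derivative
      dF e p * deriv (snd e \<circ> chart_inv c) (snd c p)) (at (snd c p))"
    unfolding has_field_derivative_def by (rule has_derivative_eq_rhs) (simp add: fun_eq_iff)
  then show ?thesis
    using F_has_derivative assms DERIV_unique by blast
qed

lemma dF_continuous:
  assumes c: "c \<in> A"
  shows "continuous_on (fst c) (dF c)"
proof -
  have "deriv (F \<circ> chart_inv c) holomorphic_on snd c ` fst c"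
    by (rule holomorphic_deriv[OF F_holomorphic[OF c] image_open[OF c]])
  then have "continuous_on (snd c ` fst c) (deriv (F \<circ> chart_inv c))"
    by (rule holomorphic_on_imp_continuous_on)
  from continuous_on_compose[OF coord_continuous[OF c] this]
  show ?thesis by (simp only: dF_def[abs_def] comp_def)
qed

lemma F_continuous: "continuous_on S F"
proof (rule continuous_on_coord)
  fix c assume "c \<in> A"
  from F_holomorphic[OF this] show "continuous_on (snd c ` fst c) (F \<circ> chart_inv c)"
    by (rule holomorphic_on_imp_continuous_on)
qed

text \<open>The inverse function theorem in the chart \<open>c\<close>, carried over to the surface:
  near \<open>p\<close> the value of \<open>F\<close> is itself a coordinate, and \<open>h\<close>
  changes from it to the coordinate of \<open>c\<close>. The derivative of \<open>h\<close> later
  converts velocities of \<open>F \<circ> \<gamma>\<close> into velocities in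
  \<open>c\<close>.\<close>

lemma local_inverse:
  assumes c: "c \<in> A" and p: "p \<in> fst c"
  obtains U h where "openin (top_of_set S) U" "p \<in> U" "U \<subseteq> fst c" "open (F ` U)" "inj_on F U"
    "h holomorphic_on F ` U" "\<forall>x\<in>U. h (F x) = snd c x"
    "\<forall>x\<in>U. deriv h (F x) = 1 / dF c x"
proof -
  define f where "f = F \<circ> chart_inv c"
  have holf: "f holomorphic_on snd c ` fst c" by (simp add: f_def F_holomorphic c)
  obtain r where r: "r > 0" "ball (snd c p) r \<subseteq> snd c ` fst c" "open (f ` ball (snd c p) r)"
      "inj_on f (ball (snd c p) r)"
    using has_complex_derivative_locally_invertible[OF holf _ image_open[OF c], of "snd c p"]
      dF_nonzero[OF c p] p unfolding dF_def f_def by blast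
  define U where "U = fst c \<inter> snd c -` ball (snd c p) r"
  have holfb: "f holomorphic_on ball (snd c p) r"
    using holf r(2) holomorphic_on_subset by blast
  obtain h where h: "h holomorphic_on f ` ball (snd c p) r"
     "\<And>z. z \<in> ball (snd c p) r \<Longrightarrow> deriv f z * deriv h (f z) = 1"
     "\<And>z. z \<in> ball (snd c p) r \<Longrightarrow> h (f z) = z"
    using holomorphic_has_inverse[OF holfb _ r(4)] by auto
  have fF: "f (snd c x) = F x" if "x \<in> fst c" for x
    using that c by (simp add: f_def)
  have "openin (top_of_set (fst c)) U"
    unfolding U_def by (rule continuous_openin_preimage_gen[OF coord_continuous[OF c]]) simp
  then have oU: "openin (top_of_set S) U"
    using domain_openin[OF c] openin_trans by blast
  have img: "F ` U = f ` ball (snd c p) r"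
  proof
    show "F ` U \<subseteq> f ` ball (snd c p) r"
      using fF by (force simp: U_def)
    show "f ` ball (snd c p) r \<subseteq> F ` U"
    proof
      fix w assume "w \<in> f ` ball (snd c p) r"
      then obtain z where z: "z \<in> ball (snd c p) r" "w = f z" by blast
      then obtain x where "x \<in> fst c" "z = snd c x" using r(2) by blast
      with z fF show "w \<in> F ` U" by (auto simp: U_def)
    qed
  qed
  show ?thesis
  proof (rule that[of U h])
    show "p \<in> U" "U \<subseteq> fst c" using p r(1) by (auto simp: U_def)
    show "h holomorphic_on F ` U" "open (F ` U)" using h(1) r(3) by (simp_all add: img)
    show "\<forall>x\<in>U. h (F x) = snd c x"
    proof
      fix x assume "x \<in> U"
      then show "h (F x) = snd c x" using h(3)[of "snd c x"] fF[of x] by (auto simp: U_def)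
    qed
    show "inj_on F U"
    proof (rule inj_onI)
      fix x y assume xy: "x \<in> U" "y \<in> U" "F x = F y"
      then have "snd c x = snd c y"
        using fF r(4) unfolding U_def inj_on_def by auto
      then have "chart_inv c (snd c x) = chart_inv c (snd c y)" by simp
      then show "x = y" using xy c by (auto simp: U_def)
    qed
    show "\<forall>x\<in>U. deriv h (F x) = 1 / dF c x"
    proof
      fix x assume "x \<in> U"
      then have "x \<in> fst c" "snd c x \<in> ball (snd c p) r" by (auto simp: U_def)
      then have "dF c x * deriv h (F x) = 1"
        using h(2)[of "snd c x"] fF[of x] by (simp add: dF_def f_def)
      then show "deriv h (F x) = 1 / dF c x"
        using dF_nonzero[OF c \<open>x \<in> fst c\<close>] by (simp add: field_simps)
    qed
  qed (rule oU)
qed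

section \<open>Lifts through \<open>F\<close> and its inverse branches over discs\<close>

lemma locally_injective:
  assumes "p \<in> S"
  obtains U where "openin (top_of_set S) U" "p \<in> U" "inj_on F U"
proof -
  obtain c where c: "c \<in> A" "p \<in> fst c" using chart_ex[OF assms] by blast
  show ?thesis by (rule local_inverse[OF c]) (rule that)
qed

text \<open>The set where the lifts agree is open because \<open>F\<close> is locally injective, and
  its complement is open because the surface is Hausdorff; connectedness of \<open>T\<close>
  decides.\<close>

lemma lift_unique:
  fixes u v :: "'t::topological_space \<Rightarrow> 'a"
  assumes T: "connected T" "t0 \<in> T" "u t0 = v t0"
    and u: "continuous_on T u" "u ` T \<subseteq> S" and v: "continuous_on T v" "v ` T \<subseteq> S"
    and eq: "\<And>t. t \<in> T \<Longrightarrow> F (u t) = F (v t)"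
    and t: "t \<in> T"
  shows "u t = v t"
proof -
  let ?E = "{t \<in> T. u t = v t}" and ?D = "{t \<in> T. u t \<noteq> v t}"
  have E: "openin (top_of_set T) ?E"
  proof (subst openin_subopen, intro ballI)
    fix x assume x: "x \<in> ?E"
    then have "u x \<in> S" using u by auto
    then obtain U where U: "openin (top_of_set S) U" "u x \<in> U" "inj_on F U"
      using locally_injective by blast
    have "openin (top_of_set T) (T \<inter> u -` U \<inter> (T \<inter> v -` U))"
      using U u v by (intro openin_Int continuous_openin_preimage) auto
    moreover have "T \<inter> u -` U \<inter> (T \<inter> v -` U) \<subseteq> ?E"
      using U(3) eq by (auto simp: inj_on_def)
    ultimately show "\<exists>W. openin (top_of_set T) W \<and> x \<in> W \<and> W \<subseteq> ?E"
      using x U(2) by (intro exI[of _ "T \<inter> u -` U \<inter> (T \<inter> v -` U)"]) auto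
  qed
  have D: "openin (top_of_set T) ?D"
  proof (subst openin_subopen, intro ballI)
    fix x assume x: "x \<in> ?D"
    then obtain U V where UV: "open U" "open V" "u x \<in> U" "v x \<in> V" "U \<inter> V = {}"
      using hausdorff[of "u x" "v x"] by blast
    have "openin (top_of_set T) (T \<inter> u -` U \<inter> (T \<inter> v -` V))"
      using UV u v by (intro openin_Int continuous_openin_preimage_gen) auto
    moreover have "T \<inter> u -` U \<inter> (T \<inter> v -` V) \<subseteq> ?D"
      using UV(5) by auto
    ultimately show "\<exists>W. openin (top_of_set T) W \<and> x \<in> W \<and> W \<subseteq> ?D"
      using x UV(3,4) by (intro exI[of _ "T \<inter> u -` U \<inter> (T \<inter> v -` V)"]) auto
  qed
  have "T \<subseteq> ?E \<union> ?D" "?E \<inter> ?D = {}" "?E \<noteq> {}" using T by auto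
  then have "?D = {}"
    using T(1) E D unfolding connected_openin by blast
  then show ?thesis using t by blast
qed

text \<open>An inverse branch of \<open>F\<close> over the disc of radius \<open>r\<close> about
  \<open>F p\<close> that sends the centre back to \<open>p\<close>. Mere continuity is asked for,
  since lifts through \<open>F\<close> are already unique among continuous maps.\<close>

definition is_section :: "'a \<Rightarrow> real \<Rightarrow> (complex \<Rightarrow> 'a) \<Rightarrow> bool" where
  "is_section p r s \<longleftrightarrow> continuous_on (ball (F p) r) s \<and> s ` ball (F p) r \<subseteq> S \<and>
     (\<forall>w\<in>ball (F p) r. F (s w) = w) \<and> s (F p) = p"

text \<open>For \<open>y\<close> close to a point of the image, \<open>s (F y)\<close> lies in the
  same injectivity neighbourhood as \<open>y\<close>, which forces
  \<open>s (F y) = y\<close>.\<close>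

lemma section_image_open:
  assumes s: "continuous_on B s" "s ` B \<subseteq> S" "\<And>w. w \<in> B \<Longrightarrow> F (s w) = w" and B: "open B"
  shows "openin (top_of_set S) (s ` B)"
proof (subst openin_subopen, intro ballI)
  fix x assume "x \<in> s ` B"
  then obtain w where w: "w \<in> B" "x = s w" by blast
  then have "x \<in> S" using s by auto
  then obtain U where U: "openin (top_of_set S) U" "x \<in> U" "inj_on F U"
    using locally_injective by blast
  let ?B = "B \<inter> s -` U"
  have oB: "open ?B"
    by (rule open_preimage[OF s(1,2) B U(1)])
  have "openin (top_of_set S) (U \<inter> (S \<inter> F -` ?B))"
    by (intro openin_Int U continuous_openin_preimage_gen[OF F_continuous oB])
  moreover have "U \<inter> (S \<inter> F -` ?B) \<subseteq> s ` B"
  proof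
    fix y assume y: "y \<in> U \<inter> (S \<inter> F -` ?B)"
    then have "F (s (F y)) = F y" "s (F y) \<in> U" using s(3) by auto
    then have "s (F y) = y" using U(3) y by (auto simp: inj_on_def)
    then show "y \<in> s ` B" using y by (metis IntD1 IntD2 image_eqI vimageE)
  qed
  moreover have "x \<in> U \<inter> (S \<inter> F -` ?B)"
    using U(2) w \<open>x \<in> S\<close> s(3) by auto
  ultimately show "\<exists>W. openin (top_of_set S) W \<and> x \<in> W \<and> W \<subseteq> s ` B" by blast
qed

lemma local_section:
  assumes p: "p \<in> S"
  obtains r s where "r > 0" "is_section p r s"
proof -
  obtain c where c: "c \<in> A" "p \<in> fst c" using chart_ex[OF p] by blast
  obtain U h where U: "openin (top_of_set S) U" "p \<in> U" "U \<subseteq> fst c" "open (F ` U)" "inj_on F U"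
    "h holomorphic_on F ` U" "\<forall>x\<in>U. h (F x) = snd c x"
    "\<forall>x\<in>U. deriv h (F x) = 1 / dF c x"
    by (rule local_inverse[OF c])
  obtain r where r: "r > 0" "ball (F p) r \<subseteq> F ` U"
    using U(2,4) by (meson image_eqI open_contains_ball)
  have val: "chart_inv c (h (F x)) = x" if "x \<in> U" for x
    using that U c by auto
  have "continuous_on (F ` U) (\<lambda>w. chart_inv c (h w))"
    by (rule continuous_on_compose2[OF chart_inv_continuous[OF c(1)]
          holomorphic_on_imp_continuous_on[OF U(6)]]) (use U in auto)
  then have "continuous_on (ball (F p) r) (\<lambda>w. chart_inv c (h w))"
    using r(2) by (rule continuous_on_subset)
  moreover have "chart_inv c (h w) \<in> S \<and> F (chart_inv c (h w)) = w" if w: "w \<in> ball (F p) r" for w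
  proof -
    obtain x where "x \<in> U" "w = F x" using w r(2) by blast
    then show ?thesis using val[of x] U(3) domain_subset[OF c(1)] by auto
  qed
  ultimately have "is_section p r (\<lambda>w. chart_inv c (h w))"
    unfolding is_section_def using val[OF U(2)] by auto
  then show ?thesis using r that by blast
qed

text \<open>Two discs meet in a convex, hence connected, set, so one common value spreads over the
  whole intersection.\<close>

lemma section_unique:
  assumes "is_section p r s" "is_section q r' s'" "w0 \<in> ball (F p) r \<inter> ball (F q) r'" "s w0 = s' w0"
    "w \<in> ball (F p) r \<inter> ball (F q) r'"
  shows "s w = s' w"
  by (rule lift_unique[of "ball (F p) r \<inter> ball (F q) r'" w0])
     (use assms in \<open>auto simp: is_section_def intro: convex_connected convex_Int
        elim!: continuous_on_subset\<close>)

lemma section_restrict: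
  assumes s: "is_section p r s" and w: "w \<in> ball (F p) r" and r: "r' \<le> r - dist (F p) w"
  shows "is_section (s w) r' s"
proof -
  have Fw: "F (s w) = w" using s w by (auto simp: is_section_def)
  have "ball w r' \<subseteq> ball (F p) r"
  proof
    fix x assume "x \<in> ball w r'"
    then show "x \<in> ball (F p) r" using dist_triangle[of "F p" x w] r by auto
  qed
  then show ?thesis
    using s Fw unfolding is_section_def by (auto intro: continuous_on_subset)
qed

text \<open>Two of the small balls that meet have the midpoint of their centres in common, which lies in
  the large ball; so the sections over them agree.\<close>

lemma section_glue:
  assumes s: "is_section p r s" and r: "r > 0" "d > 0"
    and ext: "\<And>w. w \<in> ball (F p) r \<Longrightarrow> \<exists>s'. is_section (s w) d s'"
  shows "\<exists>s'. is_section p (r + d) s'"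
proof -
  obtain t where t: "\<And>w. w \<in> ball (F p) r \<Longrightarrow> is_section (s w) d (t w)"
    using ext by metis
  have Fs: "F (s w) = w" if "w \<in> ball (F p) r" for w using that s by (auto simp: is_section_def)
  have t': "continuous_on (ball w d) (t w)" "t w ` ball w d \<subseteq> S" "\<And>x. x \<in> ball w d \<Longrightarrow> F (t w x) = x"
    "t w w = s w" if "w \<in> ball (F p) r" for w
    using t[OF that] Fs[OF that] by (auto simp: is_section_def)
  have ts: "t w x = s x" if "w \<in> ball (F p) r" "x \<in> ball w d" "x \<in> ball (F p) r" for w x
    using section_unique[OF t[OF that(1)] s, of w x] that t'(4)[OF that(1)] r Fs by auto
  have tt: "t w x = t w' x"
    if w: "w \<in> ball (F p) r" "x \<in> ball w d" "w' \<in> ball (F p) r" "x \<in> ball w' d" for w w' x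
  proof -
    let ?m = "midpoint w w'"
    have "?m \<in> ball (F p) r"
      using convexD[OF convex_ball w(1,3), of "1/2" "1/2"]
      by (simp add: midpoint_def scaleR_right_distrib)
    moreover have "dist w w' < 2 * d"
      using w dist_triangle[of w w' x] by (simp add: dist_commute)
    then have "?m \<in> ball w d" "?m \<in> ball w' d" by (auto simp: dist_midpoint)
    ultimately show ?thesis
      using section_unique[OF t[OF w(1)] t[OF w(3)], of ?m x] w Fs ts by auto
  qed
  define near where "near x = (SOME w. w \<in> ball (F p) r \<and> x \<in> ball w d)" for x
  have near: "near x \<in> ball (F p) r \<and> x \<in> ball (near x) d" if "x \<in> ball (F p) (r + d)" for x
    unfolding near_def
  proof (rule someI_ex)
    have "\<exists>w. dist (F p) w < r \<and> dist w x < d"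
    proof (cases "dist (F p) x < r")
      case True then show ?thesis using r by (intro exI[of _ x]) auto
    next
      case False
      define l where "l = dist (F p) x"
      have l: "l \<ge> r" "l < r + d" using False that by (auto simp: l_def)
      \<comment> \<open>The point \<open>?w\<close> is sought on the segment from the centre to
        \<open>x\<close>, at distance \<open>a\<close> from the centre. It has to satisfy
        \<open>l - d < a < r\<close> and \<open>0 \<le> a\<close>; the midpoint of the admissible
        interval is taken.\<close>
      define a where "a = (max 0 (l - d) + r) / 2"
      have a: "0 \<le> a" "a < r" "l - a < d" "a \<le> l" using l r by (auto simp: a_def max_def field_simps)
      let ?w = "F p + (a / l) *\<^sub>R (x - F p)"
      have l': "norm (x - F p) = l" by (simp add: l_def dist_norm norm_minus_commute)
      have pw: "dist (F p) ?w = a" using l' l r a by (simp add: dist_norm)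
      have "?w - x = (a / l - 1) *\<^sub>R (x - F p)" by (simp add: algebra_simps)
      then have wx: "dist ?w x = \<bar>a / l - 1\<bar> * l" by (simp only: dist_norm norm_scaleR l')
      have "a / l \<le> 1" using l r a by simp
      then have "\<bar>a / l - 1\<bar> * l = l - a" using l r by (simp add: field_simps)
      then have "dist ?w x < d" using wx a by simp
      moreover have "dist (F p) ?w < r" using pw a by simp
      ultimately show ?thesis by blast
    qed
    then show "\<exists>w. w \<in> ball (F p) r \<and> x \<in> ball w d" by (auto simp: dist_commute)
  qed
  \<comment> \<open>By \<open>tt\<close> the disc picked by \<open>near\<close> does not matter, so
    locally \<open>s'\<close> is one of the continuous functions \<open>t w\<close>.\<close>
  define s' where "s' x = t (near x) x" for x
  have s't: "s' x = t w x" if "w \<in> ball (F p) r" "x \<in> ball w d" "x \<in> ball (F p) (r + d)" for w x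
    unfolding s'_def using near[OF that(3)] that tt by blast
  have "continuous_on (ball (F p) (r + d)) s'"
    unfolding continuous_on_eq_continuous_at[OF open_ball]
  proof
    fix x assume x: "x \<in> ball (F p) (r + d)"
    note n = near[OF x]
    have "isCont (t (near x)) x"
      using t'(1)[of "near x"] n continuous_on_eq_continuous_at[OF open_ball] by blast
    moreover have "\<forall>\<^sub>F y in nhds x. y \<in> ball (near x) d \<inter> ball (F p) (r + d)"
      by (rule eventually_nhds_in_open) (use n x in auto)
    then have "\<forall>\<^sub>F y in nhds x. s' y = t (near x) y"
      by eventually_elim (use n s't in auto)
    ultimately show "isCont s' x" using isCont_cong by blast
  qed
  moreover have "F (s' x) = x" "s' x \<in> S" if "x \<in> ball (F p) (r + d)" for x
    using near[OF that] t' unfolding s'_def by blast+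
  moreover have "s' (F p) = p"
    using s't[of "F p" "F p"] t'(4)[of "F p"] r s by (auto simp: is_section_def)
  ultimately show ?thesis unfolding is_section_def by blast
qed

text \<open>\<open>E p\<close> collects the points reached from \<open>p\<close> by inverse
  branches. These sets are open, and if two of them meet, each contains the centre of the other; so
  they are closed as well, and connectedness gives \<open>E p = S\<close>. Any two points are then
  values of branches at the same \<open>p\<close>, which agree on the smaller disc: this is
  injectivity. Discs of arbitrary radius give surjectivity.\<close>

lemma bijective_of_sections:
  assumes sec: "\<And>p r. p \<in> S \<Longrightarrow> r > 0 \<Longrightarrow> \<exists>s. is_section p r s"
  shows "bij_betw F S UNIV"
proof -
  define E where "E p = {q. \<exists>r s. r > 0 \<and> is_section p r s \<and> q \<in> s ` ball (F p) r}" for p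
  have Eself: "p \<in> E p" if pS: "p \<in> S" for p
  proof -
    obtain s where s: "is_section p 1 s" using sec[OF pS zero_less_one] by blast
    then have "p \<in> s ` ball (F p) 1"
      unfolding is_section_def by (metis centre_in_ball image_eqI zero_less_one)
    with s show ?thesis unfolding E_def using zero_less_one by blast
  qed
  have Eopen: "openin (top_of_set S) (E p)" for p
  proof -
    have "E p = \<Union>{s ` ball (F p) r |r s. r > 0 \<and> is_section p r s}" by (auto simp: E_def)
    moreover have "openin (top_of_set S) (s ` ball (F p) r)" if "is_section p r s" for r s
      using that section_image_open[of "ball (F p) r" s] by (auto simp: is_section_def)
    ultimately show ?thesis by auto
  qed
  have Eback: "q \<in> E p" if E: "x \<in> E p" "x \<in> E q" "p \<in> S" "q \<in> S" for p q x
  proof -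
    obtain r s r' s' where s: "is_section p r s" "x \<in> s ` ball (F p) r" "r > 0"
        "is_section q r' s'" "x \<in> s' ` ball (F q) r'" "r' > 0"
      using E unfolding E_def by blast
    have x: "F x \<in> ball (F p) r" "s (F x) = x" "F x \<in> ball (F q) r'" "s' (F x) = x"
      using s by (auto simp: is_section_def)
    \<comment> \<open>A disc about \<open>F p\<close> large enough to contain both
      \<open>F x\<close> and \<open>F q\<close>. Its section agrees with \<open>s\<close> at
      \<open>F p\<close>, hence at \<open>F x\<close>, and from there with \<open>s'\<close> up to
      \<open>F q\<close>.\<close>
    define R where "R = r + dist (F p) (F q) + 1"
    have R: "R > 0" "R > r" "F q \<in> ball (F p) R"
      using s(3) zero_le_dist[of "F p" "F q"] unfolding R_def mem_ball by linarith+
    obtain S' where S': "is_section p R S'" using sec \<open>p \<in> S\<close> R by blast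
    have "S' (F x) = s (F x)"
      using section_unique[OF S' s(1), of "F p"] S' s R x by (auto simp: is_section_def)
    then have "S' (F q) = s' (F q)"
      using section_unique[OF S' s(4), of "F x" "F q"] R x s by auto
    then have "S' (F q) = q" using s by (auto simp: is_section_def)
    then show "q \<in> E p" using R S' unfolding E_def by (metis (mono_tags, lifting) image_eqI mem_Collect_eq)
  qed
  obtain p where p: "p \<in> S" using S_nonempty by blast
  have "openin (top_of_set S) (S - E p)"
  proof (subst openin_subopen, intro ballI)
    fix q assume q: "q \<in> S - E p"
    then have "E q \<inter> E p = {}" using Eback[of _ p q] p by blast
    moreover have "E q \<subseteq> S" using Eopen openin_imp_subset by blast
    ultimately show "\<exists>T. openin (top_of_set S) T \<and> q \<in> T \<and> T \<subseteq> S - E p"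
      using Eopen Eself q by blast
  qed
  then have ES: "S - E p = {}"
    using connected_S Eopen[of p] Eself[OF p] p unfolding connected_openin by blast
  show ?thesis
    unfolding bij_betw_def
  proof
    show "inj_on F S"
    proof (rule inj_onI)
      fix x y assume xy: "x \<in> S" "y \<in> S" "F x = F y"
      then obtain r s r' s' where s: "is_section p r s" "x \<in> s ` ball (F p) r" "r > 0"
        "is_section p r' s'" "y \<in> s' ` ball (F p) r'" "r' > 0"
        using ES unfolding E_def by blast
      then have x: "F x \<in> ball (F p) r" "s (F x) = x" "F x \<in> ball (F p) r'" "s' (F x) = y"
        using xy by (auto simp: is_section_def)
      have "s (F x) = s' (F x)"
        using section_unique[OF s(1,4), of "F p"] s x by (auto simp: is_section_def)
      with x show "x = y" by simp
    qed
    have "w \<in> F ` S" for w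
    proof -
      have "0 < dist (F p) w + 1" by (simp add: add_nonneg_pos)
      then obtain s where "is_section p (dist (F p) w + 1) s" using sec[OF p] by blast
      then have "F (s w) = w" "s w \<in> S" by (auto simp: is_section_def)
      then show ?thesis by (metis image_eqI)
    qed
    then show "F ` S = UNIV" by blast
  qed
qed

end

section \<open>Completeness\<close>

text \<open>The comparison with \<open>\<kappa> |dF|^2\<close> is available only off
  \<open>K\<close>, the support of the correcting tensor; over \<open>K\<close> nothing but
  continuity and positivity of \<open>g\<close> is at hand.\<close>

locale complete_developing = developing S A F
  for S :: "'a::t2_space set" and A and F +
  fixes g :: "'a tensor2" and K :: "'a set" and \<kappa> :: real
  assumes g_metric: "riemannian_metric A g"
    and Metric_space_dist: "Metric_space S (riemannian_dist S A g)"
    and mcomplete_dist: "Metric_space.mcomplete S (riemannian_dist S A g)"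
    and kappa: "\<kappa> > 0" and K: "compact K" "K \<subseteq> S"
    and flat: "c \<in> A \<Longrightarrow> p \<in> fst c - K \<Longrightarrow> g c p v v = \<kappa> * (norm (dF c p * v))\<^sup>2"
begin

lemma g_bilinear: "c \<in> A \<Longrightarrow> p \<in> fst c \<Longrightarrow> bilinear (g c p)"
  and g_sym: "c \<in> A \<Longrightarrow> p \<in> fst c \<Longrightarrow> g c p v w = g c p w v"
  and g_change: "c \<in> A \<Longrightarrow> e \<in> A \<Longrightarrow> p \<in> fst c \<Longrightarrow> p \<in> fst e \<Longrightarrow>
     g c p v w = g e p (deriv (snd e \<circ> chart_inv c) (snd c p) * v) (deriv (snd e \<circ> chart_inv c) (snd c p) * w)"
  using g_metric unfolding riemannian_metric_def symmetric_tensor_def Let_def by blast+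

lemma g_pos: "c \<in> A \<Longrightarrow> p \<in> fst c \<Longrightarrow> v \<noteq> 0 \<Longrightarrow> g c p v v > 0"
  and g_continuous: "c \<in> A \<Longrightarrow> continuous_on (fst c) (\<lambda>p. g c p v w)"
  using g_metric unfolding riemannian_metric_def by blast+

lemma g_nonneg: "c \<in> A \<Longrightarrow> p \<in> fst c \<Longrightarrow> g c p v v \<ge> 0"
  using g_pos[of c p v] bilinear_lzero[OF g_bilinear[of c p], of v] by (cases "v = 0") auto

lemma g_expand:
  assumes c: "c \<in> A" "p \<in> fst c"
  shows "g c p (x *\<^sub>R a + y *\<^sub>R b) (x *\<^sub>R a + y *\<^sub>R b)
           = x\<^sup>2 * g c p a a + 2 * x * y * g c p a b + y\<^sup>2 * g c p b b"
  using g_bilinear[OF c] g_sym[OF c, of b a]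
  by (simp add: bilinear_ladd bilinear_radd bilinear_lmul bilinear_rmul power2_eq_square algebra_simps)

text \<open>\<open>Q p u\<close> is the squared length of the tangent vector at \<open>p\<close> that \<open>dF\<close> maps to \<open>u\<close>.\<close>

definition Q :: "'a \<Rightarrow> complex \<Rightarrow> real" where
  "Q p u = (let c = (SOME c. c \<in> A \<and> p \<in> fst c) in g c p (u / dF c p) (u / dF c p))"

text \<open>\<open>g\<close> and \<open>dF\<close> both transform by the transition derivative,
  which cancels; the chart selected in \<open>Q\<close> is therefore immaterial.\<close>

lemma Q_eq:
  assumes c: "c \<in> A" "p \<in> fst c"
  shows "Q p u = g c p (u / dF c p) (u / dF c p)"
proof -
  define e where "e = (SOME c. c \<in> A \<and> p \<in> fst c)"
  have e: "e \<in> A \<and> p \<in> fst e" unfolding e_def by (rule someI[of _ c]) (use c in simp)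
  have k: "dF e p = dF c p * deriv (snd c \<circ> chart_inv e) (snd e p)"
    using dF_change[of e c p] c e by blast
  moreover have "dF e p \<noteq> 0" using dF_nonzero e by blast
  ultimately have "deriv (snd c \<circ> chart_inv e) (snd e p) * (u / dF e p) = u / dF c p"
    by (simp add: k)
  then show ?thesis
    unfolding Q_def Let_def e_def[symmetric] using g_change[of e c p] c e by metis
qed

text \<open>A quadratic form in two real variables is determined by its values at \<open>1\<close>,
  \<open>\<i>\<close> and \<open>1 + \<i>\<close>. This reduces joint continuity of \<open>Q\<close>
  to continuity in \<open>p\<close> for fixed directions.\<close>

lemma Q_quadratic:
  assumes "p \<in> S"
  shows "Q p u = (Re u)\<^sup>2 * Q p 1 + Re u * Im u * (Q p (1 + \<i>) - Q p 1 - Q p \<i>) + (Im u)\<^sup>2 * Q p \<i>"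
proof -
  obtain c where c: "c \<in> A" "p \<in> fst c" using chart_ex[OF assms] by blast
  define a b where "a = 1 / dF c p" and "b = \<i> / dF c p"
  have u: "u / dF c p = Re u *\<^sub>R a + Im u *\<^sub>R b" for u
    unfolding a_def b_def
    by (subst complex_eq) (simp add: scaleR_conv_of_real add_divide_distrib)
  show ?thesis
    unfolding Q_eq[OF c] u g_expand[OF c] by (simp add: algebra_simps)
qed

lemma Q_continuous: "continuous_on S (\<lambda>p. Q p u)"
proof (rule continuous_on_chartwise)
  fix c assume c: "c \<in> A"
  have "continuous_on (fst c) (\<lambda>p. (Re (u / dF c p))\<^sup>2 * g c p 1 1
      + 2 * Re (u / dF c p) * Im (u / dF c p) * g c p 1 \<i> + (Im (u / dF c p))\<^sup>2 * g c p \<i> \<i>)"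
    using c by (intro continuous_intros g_continuous dF_continuous) (auto simp: dF_nonzero)
  moreover have "Q p u = (Re (u / dF c p))\<^sup>2 * g c p 1 1
      + 2 * Re (u / dF c p) * Im (u / dF c p) * g c p 1 \<i> + (Im (u / dF c p))\<^sup>2 * g c p \<i> \<i>"
    if "p \<in> fst c" for p
  proof -
    have "v = Re v *\<^sub>R 1 + Im v *\<^sub>R \<i>" for v by (simp add: complex_eq_iff)
    then show ?thesis using Q_eq[OF c that] g_expand[OF c that, of _ 1 _ \<i>] by metis
  qed
  ultimately show "continuous_on (fst c) (\<lambda>p. Q p u)"
    by (subst continuous_on_cong[OF refl]) auto
qed

lemma Q_continuous2: "continuous_on (S \<times> UNIV) (\<lambda>(p, u). Q p u)"
proof -
  have Q: "continuous_on (S \<times> UNIV) (\<lambda>x. Q (fst x) u)" for u :: complex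
    by (rule continuous_on_compose2[OF Q_continuous continuous_on_fst[OF continuous_on_id]]) auto
  have "continuous_on (S \<times> UNIV) (\<lambda>x. (Re (snd x))\<^sup>2 * Q (fst x) 1
      + Re (snd x) * Im (snd x) * (Q (fst x) (1 + \<i>) - Q (fst x) 1 - Q (fst x) \<i>) + (Im (snd x))\<^sup>2 * Q (fst x) \<i>)"
    by (intro continuous_intros Q)
  then show ?thesis
    by (rule continuous_on_eq) (auto simp: Q_quadratic[symmetric])
qed

lemma Q_pos: "p \<in> S \<Longrightarrow> u \<noteq> 0 \<Longrightarrow> Q p u > 0"
proof -
  assume p: "p \<in> S" and u: "u \<noteq> 0"
  obtain c where c: "c \<in> A" "p \<in> fst c" using chart_ex[OF p] by blast
  show "Q p u > 0"
    unfolding Q_eq[OF c] by (rule g_pos[OF c]) (use u dF_nonzero[OF c] in simp)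
qed

lemma Q_scale: "p \<in> S \<Longrightarrow> Q p (r *\<^sub>R u) = r\<^sup>2 * Q p u"
proof -
  assume p: "p \<in> S"
  obtain c where c: "c \<in> A" "p \<in> fst c" using chart_ex[OF p] by blast
  have "r *\<^sub>R u / dF c p = r *\<^sub>R (u / dF c p) + 0 *\<^sub>R (u / dF c p)"
    by (simp add: scaleR_conv_of_real)
  then show ?thesis
    unfolding Q_eq[OF c] by (simp only: g_expand[OF c]) simp
qed

text \<open>Uniform equivalence of \<open>g\<close> with the flat metric \<open>|dF|^2\<close>: off
  \<open>K\<close> the form is \<open>\<kappa> |u|^2\<close>, and over \<open>K\<close> it attains
  positive extremal values on the compact set of unit vectors.\<close>

lemma Q_bounds:
  obtains m M where "m > 0" "M > 0" "\<And>p u. p \<in> S \<Longrightarrow> m * norm u \<le> sqrt (Q p u)"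
    "\<And>p u. p \<in> S \<Longrightarrow> sqrt (Q p u) \<le> M * norm u"
proof -
  have "\<exists>a>0. \<exists>b>0. \<forall>p\<in>K. \<forall>u\<in>sphere 0 1. a \<le> Q p u \<and> Q p u \<le> b"
  proof (cases "K = {}")
    case True then show ?thesis by (auto intro: zero_less_one)
  next
    case False
    let ?B = "K \<times> sphere (0::complex) 1"
    have cB: "compact ?B" using K(1) by (intro compact_Times) auto
    have neB: "?B \<noteq> {}" using False by (auto simp: sphere_eq_empty)
    have cont: "continuous_on ?B (\<lambda>(p, u). Q p u)"
      using Q_continuous2 by (rule continuous_on_subset) (use K in auto)
    obtain x where x: "x \<in> ?B" "\<forall>y\<in>?B. (case x of (p, u) \<Rightarrow> Q p u) \<le> (case y of (p, u) \<Rightarrow> Q p u)"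
      using continuous_attains_inf[OF cB neB cont] by blast
    obtain y where y: "y \<in> ?B" "\<forall>z\<in>?B. (case z of (p, u) \<Rightarrow> Q p u) \<le> (case y of (p, u) \<Rightarrow> Q p u)"
      using continuous_attains_sup[OF cB neB cont] by blast
    have "Q (fst x) (snd x) > 0" "Q (fst y) (snd y) > 0"
      using x(1) y(1) K by (auto intro!: Q_pos)
    then show ?thesis
      using x(2) y(2) by (intro exI[of _ "Q (fst x) (snd x)"] exI[of _ "Q (fst y) (snd y)"] conjI)
        (auto simp: split_beta)
  qed
  then obtain a b where ab: "a > 0" "b > 0" "\<And>p u. p \<in> K \<Longrightarrow> norm u = 1 \<Longrightarrow> a \<le> Q p u"
      "\<And>p u. p \<in> K \<Longrightarrow> norm u = 1 \<Longrightarrow> Q p u \<le> b"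
    by (auto simp: dist_norm)
  have unit: "min a \<kappa> \<le> Q p u \<and> Q p u \<le> max b \<kappa>" if p: "p \<in> S" and u: "norm u = 1" for p u
  proof (cases "p \<in> K")
    case True then show ?thesis using ab u by fastforce
  next
    case False
    obtain c where c: "c \<in> A" "p \<in> fst c" using chart_ex[OF p] by blast
    have "Q p u = \<kappa>"
      using flat[OF c(1), of p "u / dF c p"] c False dF_nonzero[OF c] u by (simp add: Q_eq[OF c])
    then show ?thesis by simp
  qed
  have gen: "min a \<kappa> * (norm u)\<^sup>2 \<le> Q p u \<and> Q p u \<le> max b \<kappa> * (norm u)\<^sup>2" if p: "p \<in> S" for p u
  proof (cases "u = 0")
    case True then show ?thesis using Q_scale[OF p, of 0 0] by simp
  next
    case False
    have "Q p u = (norm u)\<^sup>2 * Q p (u /\<^sub>R norm u)"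
      using Q_scale[OF p, of "norm u" "u /\<^sub>R norm u"] False by simp
    then show ?thesis
      using unit[OF p, of "u /\<^sub>R norm u"] False by (simp add: mult.commute)
  qed
  have pos: "min a \<kappa> > 0" "max b \<kappa> > 0" using ab kappa by auto
  show ?thesis
  proof (rule that[of "sqrt (min a \<kappa>)" "sqrt (max b \<kappa>)"])
    fix p u assume p: "p \<in> S"
    have "sqrt (min a \<kappa> * (norm u)\<^sup>2) \<le> sqrt (Q p u)" "sqrt (Q p u) \<le> sqrt (max b \<kappa> * (norm u)\<^sup>2)"
      using gen[OF p, of u] real_sqrt_le_mono by blast+
    then show "sqrt (min a \<kappa>) * norm u \<le> sqrt (Q p u)" "sqrt (Q p u) \<le> sqrt (max b \<kappa>) * norm u"
      by (simp_all add: real_sqrt_mult)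
  qed (use pos in auto)
qed

section \<open>Lengths of curves compared with their developments in the plane\<close>

lemma coord_curve_derivative:
  assumes c: "c \<in> A" and t: "t \<in> {a<..<b}" "\<gamma> t \<in> fst c"
    and \<gamma>: "continuous_on {a<..<b} \<gamma>" "\<gamma> ` {a<..<b} \<subseteq> S"
    and u: "((F \<circ> \<gamma>) has_vector_derivative u) (at t)"
  shows "((snd c \<circ> \<gamma>) has_vector_derivative u / dF c (\<gamma> t)) (at t)"
proof -
  obtain U h where U: "openin (top_of_set S) U" "\<gamma> t \<in> U" "U \<subseteq> fst c" "open (F ` U)" "inj_on F U"
    "h holomorphic_on F ` U" "\<forall>x\<in>U. h (F x) = snd c x" "\<forall>x\<in>U. deriv h (F x) = 1 / dF c x"
    by (rule local_inverse[OF c t(2)])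
  have op: "open ({a<..<b} \<inter> \<gamma> -` U)"
    by (rule open_preimage[OF \<gamma> open_greaterThanLessThan U(1)])
  have "(h has_field_derivative 1 / dF c (\<gamma> t)) (at ((F \<circ> \<gamma>) t))"
    using holomorphic_derivI[OF U(6,4), of "F (\<gamma> t)"] U(2,8) by auto
  from field_vector_diff_chain_at[OF u this]
  have "((h \<circ> (F \<circ> \<gamma>)) has_vector_derivative u / dF c (\<gamma> t)) (at t)"
    by (simp only: times_divide_eq_right mult_1_right)
  then show ?thesis
    by (rule has_vector_derivative_transform_within_open[OF _ op]) (use t U in auto)
qed

lemma developed_curve_derivative:
  assumes c: "c \<in> A" and t: "t \<in> {a<..<b}" "\<gamma> t \<in> fst c"
    and \<gamma>: "continuous_on {a<..<b} \<gamma>" "\<gamma> ` {a<..<b} \<subseteq> S"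
    and v: "((snd c \<circ> \<gamma>) has_vector_derivative v) (at t)"
  shows "((F \<circ> \<gamma>) has_vector_derivative v * dF c (\<gamma> t)) (at t)"
proof -
  have op: "open ({a<..<b} \<inter> \<gamma> -` fst c)"
    by (rule open_preimage[OF \<gamma> open_greaterThanLessThan domain_openin[OF c]])
  have "((F \<circ> chart_inv c) has_field_derivative dF c (\<gamma> t)) (at ((snd c \<circ> \<gamma>) t))"
    using F_has_derivative[OF c t(2)] by simp
  from field_vector_diff_chain_at[OF v this]
  have "(((F \<circ> chart_inv c) \<circ> (snd c \<circ> \<gamma>)) has_vector_derivative v * dF c (\<gamma> t)) (at t)" .
  then show ?thesis
    by (rule has_vector_derivative_transform_within_open[OF _ op]) (use t c in auto)
qed

text \<open>\<open>speed\<close> selects a chart anew at every time; expressing it by the velocity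
  of \<open>F \<circ> \<gamma>\<close> removes this choice.\<close>

lemma speed_eq:
  assumes t: "t \<in> {a<..<b}" and \<gamma>: "continuous_on {a<..<b} \<gamma>" "\<gamma> ` {a<..<b} \<subseteq> S"
    and u: "((F \<circ> \<gamma>) has_vector_derivative u) (at t)"
  shows "speed A g \<gamma> t = sqrt (Q (\<gamma> t) u)"
proof -
  define c where "c = (SOME c. c \<in> A \<and> \<gamma> t \<in> fst c)"
  have "\<gamma> t \<in> S" using t \<gamma> by auto
  then have c: "c \<in> A" "\<gamma> t \<in> fst c"
    unfolding c_def using someI_ex[of "\<lambda>c. c \<in> A \<and> \<gamma> t \<in> fst c"] chart_ex by blast+
  have "vector_derivative (snd c \<circ> \<gamma>) (at t) = u / dF c (\<gamma> t)"
    by (rule vector_derivative_at[OF coord_curve_derivative[OF c(1) t c(2) \<gamma> u]])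
  then show ?thesis
    unfolding speed_def Let_def c_def[symmetric] by (simp add: Q_eq[OF c])
qed

lemma speed_nonneg:
  assumes "\<gamma> t \<in> S"
  shows "speed A g \<gamma> t \<ge> 0"
proof -
  define c where "c = (SOME c. c \<in> A \<and> \<gamma> t \<in> fst c)"
  have c: "c \<in> A" "\<gamma> t \<in> fst c"
    unfolding c_def using someI_ex[of "\<lambda>c. c \<in> A \<and> \<gamma> t \<in> fst c"] chart_ex[OF assms] by blast+
  then show ?thesis
    unfolding speed_def Let_def c_def[symmetric] by (simp add: g_nonneg)
qed

lemma curvesD:
  assumes "\<gamma> \<in> curves S A g x y"
  shows "continuous_on {0..1} \<gamma>" "\<gamma> ` {0..1} \<subseteq> S" "\<gamma> 0 = x" "\<gamma> 1 = y"
    "speed A g \<gamma> integrable_on {0..1}"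
  using assms unfolding curves_def path_def path_image_def pathstart_def pathfinish_def by auto

lemma interior_curve:
  fixes \<gamma> :: "real \<Rightarrow> 'a"
  assumes "continuous_on {0..1} \<gamma>" "\<gamma> ` {0..1} \<subseteq> S"
  shows "continuous_on {0<..<1} \<gamma>" "\<gamma> ` {0<..<1} \<subseteq> S"
proof -
  have sub: "{0<..<1::real} \<subseteq> {0..1}" by auto
  show "continuous_on {0<..<1} \<gamma>" by (rule continuous_on_subset[OF assms(1) sub])
  show "\<gamma> ` {0<..<1} \<subseteq> S" using image_mono[OF sub] assms(2) by (rule subset_trans)
qed

text \<open>Piecewise smoothness is given only on subintervals that stay inside one chart. Finitely
  many of them cover the unit interval, and their break points together form
  \<open>B\<close>.\<close>

lemma developed_curve_differentiable:
  assumes \<gamma>: "\<gamma> \<in> curves S A g x y"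
  obtains B where "finite B"
    "\<And>t. t \<in> {0<..<1} - B \<Longrightarrow> \<exists>u. ((F \<circ> \<gamma>) has_vector_derivative u) (at t)"
proof -
  let ?P = "\<lambda>t. \<exists>u. ((F \<circ> \<gamma>) has_vector_derivative u) (at t)"
  have "\<exists>r B. r > 0 \<and> finite B \<and> (\<forall>t\<in>ball t0 r \<inter> {0<..<1} - B. ?P t)" if t0: "t0 \<in> {0..1}" for t0
  proof -
    have "\<gamma> t0 \<in> S" using curvesD[OF \<gamma>] t0 by auto
    then obtain c where c: "c \<in> A" "\<gamma> t0 \<in> fst c" using chart_ex by blast
    have "openin (top_of_set {0..1}) ({0..1} \<inter> \<gamma> -` fst c)"
      using curvesD(1,2)[OF \<gamma>] domain_openin[OF c(1)] by (intro continuous_openin_preimage) auto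
    then obtain e where e: "e > 0" "cball t0 e \<inter> {0..1} \<subseteq> {0..1} \<inter> \<gamma> -` fst c"
      using c t0 unfolding openin_contains_cball by blast
    define a b where "a = max 0 (t0 - e)" and "b = min 1 (t0 + e)"
    have ab: "0 \<le> a" "a \<le> b" "b \<le> 1" using t0 e(1) by (auto simp: a_def b_def)
    have "{a..b} \<subseteq> cball t0 e \<inter> {0..1}" by (auto simp: a_def b_def dist_real_def)
    then have im: "\<gamma> ` {a..b} \<subseteq> fst c" using e(2) by blast
    then have "(snd c \<circ> \<gamma>) piecewise_C1_differentiable_on {a..b}"
      using \<gamma> c(1) ab unfolding curves_def by blast
    then obtain B where B: "finite B" "(snd c \<circ> \<gamma>) C1_differentiable_on ({a..b} - B)"
      unfolding piecewise_C1_differentiable_on_def by blast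
    have "?P t" if t: "t \<in> ball t0 e \<inter> {0<..<1} - B" for t
    proof -
      have tab: "t \<in> {a..b} - B" using t by (auto simp: a_def b_def dist_real_def)
      then obtain v where "((snd c \<circ> \<gamma>) has_vector_derivative v) (at t)"
        using B(2) unfolding C1_differentiable_on_def by blast
      moreover have "\<gamma> t \<in> fst c" using im tab by auto
      moreover have "continuous_on {0<..<1} \<gamma>" "\<gamma> ` {0<..<1} \<subseteq> S"
        by (rule interior_curve[OF curvesD(1,2)[OF \<gamma>]])+
      ultimately show ?thesis
        using developed_curve_derivative[OF c(1), of t 0 1 \<gamma> v] t by blast
    qed
    then show ?thesis using e(1) B(1) by blast
  qed
  then obtain r B where rB: "\<And>t0. t0 \<in> {0..1} \<Longrightarrow> r t0 > (0::real)" "\<And>t0. t0 \<in> {0..1} \<Longrightarrow> finite (B t0)"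
    "\<And>t0 t. t0 \<in> {0..1} \<Longrightarrow> t \<in> ball t0 (r t0) \<inter> {0<..<1} - B t0 \<Longrightarrow> ?P t"
    by metis
  obtain C where C: "C \<subseteq> {0..1::real}" "finite C" "{0..1} \<subseteq> (\<Union>t\<in>C. ball t (r t))"
    by (rule compactE_image[OF compact_Icc, of "{0..1}" "\<lambda>t. ball t (r t)"]) (use rB(1) in force)+
  show ?thesis
  proof (rule that[of "\<Union>t\<in>C. B t"])
    show "finite (\<Union>t\<in>C. B t)" using C rB(2) by auto
    fix t assume t: "t \<in> {0<..<1} - (\<Union>t\<in>C. B t)"
    then have "t \<in> {0..1}" by simp
    then obtain t0 where "t0 \<in> C" "t \<in> ball t0 (r t0)" using C(3) by blast
    then show "?P t" using rB(3)[of t0 t] t C(1) by blast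
  qed
qed

text \<open>The displacement of \<open>F \<circ> \<gamma>\<close> is the integral of its velocity,
  whose norm is at most the speed divided by \<open>m\<close>. Every intermediate time is included,
  so that a bound on the length confines the whole development and not only its endpoint.\<close>

lemma length_lower_bound:
  assumes m: "\<And>p u. p \<in> S \<Longrightarrow> m * norm u \<le> sqrt (Q p u)" "m > 0"
    and \<gamma>: "\<gamma> \<in> curves S A g x y" and t: "t \<in> {0..1}"
  shows "m * dist (F x) (F (\<gamma> t)) \<le> integral {0..1} (speed A g \<gamma>)"
proof -
  obtain B where B: "finite B"
    "\<And>t. t \<in> {0<..<1} - B \<Longrightarrow> \<exists>u. ((F \<circ> \<gamma>) has_vector_derivative u) (at t)"
    using developed_curve_differentiable[OF \<gamma>] by blast
  \<comment> \<open>At exceptional times the velocity is replaced by 0, so that the bound by the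
    nonnegative speed holds at every time.\<close>
  define f where "f s = (if s \<in> {0<..<1} - B then vector_derivative (F \<circ> \<gamma>) (at s) else 0)" for s
  have f: "((F \<circ> \<gamma>) has_vector_derivative f s) (at s)" if "s \<in> {0<..<1} - B" for s
    using B(2)[OF that] that unfolding f_def
    by (metis vector_derivative_at)
  have cont: "continuous_on {0..1} (F \<circ> \<gamma>)"
    using curvesD(1,2)[OF \<gamma>] by (intro continuous_on_compose continuous_on_subset[OF F_continuous]) auto
  have "(f has_integral ((F \<circ> \<gamma>) t - (F \<circ> \<gamma>) 0)) {0..t}"
  proof (rule fundamental_theorem_of_calculus_interior_strong[OF B(1)])
    show "continuous_on {0..t} (F \<circ> \<gamma>)" using cont by (rule continuous_on_subset) (use t in auto)
    show "((F \<circ> \<gamma>) has_vector_derivative f s) (at s)" if "s \<in> {0<..<t} - B" for s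
      by (rule f) (use t that in auto)
  qed (use t in auto)
  then have fi: "((\<lambda>s. m *\<^sub>R f s) has_integral m *\<^sub>R ((F \<circ> \<gamma>) t - (F \<circ> \<gamma>) 0)) {0..t}"
    by (rule has_integral_cmul)
  have int: "speed A g \<gamma> integrable_on {0..t}"
    using curvesD(5)[OF \<gamma>] t integrable_on_subinterval by fastforce
  have nn: "speed A g \<gamma> s \<ge> 0" if "s \<in> {0..1}" for s
    by (rule speed_nonneg) (use that curvesD(2)[OF \<gamma>] in auto)
  have \<gamma>': "continuous_on {0<..<1} \<gamma>" "\<gamma> ` {0<..<1} \<subseteq> S"
    by (rule interior_curve[OF curvesD(1,2)[OF \<gamma>]])+
  have "norm (integral {0..t} (\<lambda>s. m *\<^sub>R f s)) \<le> integral {0..t} (speed A g \<gamma>)"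
  proof (rule integral_norm_bound_integral)
    show "(\<lambda>s. m *\<^sub>R f s) integrable_on {0..t}" using fi by (rule has_integral_integrable)
    fix s assume s: "s \<in> {0..t}"
    show "norm (m *\<^sub>R f s) \<le> speed A g \<gamma> s"
    proof (cases "s \<in> {0<..<1} - B")
      case True
      have "\<gamma> s \<in> S" using \<gamma>' True by auto
      then show ?thesis using speed_eq[OF _ \<gamma>' f[OF True]] m(1)[of "\<gamma> s" "f s"] m(2) True by simp
    next
      case False
      then have "f s = 0" unfolding f_def by (simp only: if_False)
      then show ?thesis using nn[of s] s t by simp
    qed
  qed (rule int)
  also have "integral {0..t} (speed A g \<gamma>) \<le> integral {0..1} (speed A g \<gamma>)"
    by (rule integral_subset_le) (use int curvesD(5)[OF \<gamma>] nn t in auto)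
  finally show ?thesis
    using integral_unique[OF fi] m(2) curvesD(3)[OF \<gamma>] by (simp add: dist_norm norm_minus_commute)
qed

text \<open>The length bound keeps \<open>F \<circ> \<gamma>\<close> inside the disc, so
  \<open>s \<circ> F \<circ> \<gamma>\<close> is a second lift of it starting at \<open>q\<close>;
  by uniqueness it is \<open>\<gamma>\<close>.\<close>

lemma short_curve_in_section:
  assumes m: "\<And>p u. p \<in> S \<Longrightarrow> m * norm u \<le> sqrt (Q p u)" "m > 0"
    and s: "is_section q r s" and \<gamma>: "\<gamma> \<in> curves S A g q y"
    and short: "integral {0..1} (speed A g \<gamma>) < m * r"
  shows "y \<in> s ` ball (F q) r"
proof -
  have in_ball: "F (\<gamma> t) \<in> ball (F q) r" if "t \<in> {0..1}" for t
  proof -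
    have "m * dist (F q) (F (\<gamma> t)) < m * r"
      using length_lower_bound[OF m \<gamma> that] short by simp
    then show ?thesis using m(2) by simp
  qed
  have s': "continuous_on (ball (F q) r) s" "s ` ball (F q) r \<subseteq> S" "\<And>w. w \<in> ball (F q) r \<Longrightarrow> F (s w) = w"
     "s (F q) = q"
    using s by (auto simp: is_section_def)
  have "\<gamma> 1 = s (F (\<gamma> 1))"
  proof (rule lift_unique[where u = \<gamma> and v = "\<lambda>t. s (F (\<gamma> t))" and T = "{0..1}" and ?t0.0 = 0])
    show "continuous_on {0..1} (\<lambda>t. s (F (\<gamma> t)))"
      by (rule continuous_on_compose2[OF s'(1) continuous_on_compose2[OF F_continuous curvesD(1)[OF \<gamma>]]])
         (use in_ball curvesD(2)[OF \<gamma>] in auto)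
    show "(\<lambda>t. s (F (\<gamma> t))) ` {0..1} \<subseteq> S" using s'(2) in_ball by blast
    show "F (\<gamma> t) = F (s (F (\<gamma> t)))" if "t \<in> {0..1}" for t using s'(3)[OF in_ball[OF that]] by simp
  qed (use curvesD[OF \<gamma>] s' in auto)
  then show ?thesis using in_ball[of 1] curvesD(4)[OF \<gamma>] by auto
qed

lemma constant_curve:
  assumes "x \<in> S"
  shows "(\<lambda>_. x) \<in> curves S A g x x"
proof -
  \<comment> \<open>Neither the selected chart nor the velocity depends on the time, so
    integrability follows without evaluating the speed.\<close>
  have "speed A g (\<lambda>_. x) = (\<lambda>_. speed A g (\<lambda>_. x) 0)"
    unfolding speed_def Let_def by (simp add: comp_def)
  then have "speed A g (\<lambda>_. x) integrable_on {0..1}"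
    by (metis integrable_const_ivl)
  moreover have "(snd c \<circ> (\<lambda>_. x)) piecewise_C1_differentiable_on {a..b}" for c and a b :: real
    unfolding comp_def piecewise_C1_differentiable_on_def C1_differentiable_on_def
    by (intro conjI exI[of _ "{}"] exI[of _ "\<lambda>_. 0"]) auto
  ultimately show ?thesis
    using assms unfolding curves_def path_def path_image_def pathstart_def pathfinish_def by auto
qed

text \<open>Where \<open>curves S A g x y\<close> is empty, \<open>riemannian_dist\<close> is the junk value \<open>Inf {}\<close>; it cannot be
  \<open>0\<close>, because the distance of distinct points is positive.\<close>

lemma short_curve:
  obtains e0 where "e0 > 0"
    "\<And>x y e. x \<in> S \<Longrightarrow> y \<in> S \<Longrightarrow> riemannian_dist S A g x y < e \<Longrightarrow> e \<le> e0 \<Longrightarrow>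
       \<exists>\<gamma>\<in>curves S A g x y. integral {0..1} (speed A g \<gamma>) < e"
proof -
  interpret M: Metric_space S "riemannian_dist S A g" by (rule Metric_space_dist)
  define z where "z = (Inf {} :: real)"
  \<comment> \<open>With no curve from \<open>x\<close> to \<open>y\<close> the distance would be
    \<open>z\<close>, and positive since \<open>x\<close> and \<open>y\<close> are distinct. If
    \<open>z > 0\<close>, distances below \<open>z\<close> exclude this; if \<open>z \<le> 0\<close>
    it cannot happen, and any positive bound will do.\<close>
  define e0 where "e0 = (if z > 0 then z else 1)"
  have ne: "curves S A g x y \<noteq> {}" if xy: "x \<in> S" "y \<in> S" "riemannian_dist S A g x y < e0" for x y
  proof
    assume emp: "curves S A g x y = {}"
    then have "x \<noteq> y" using constant_curve[OF xy(1)] by auto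
    then have "riemannian_dist S A g x y > 0" using xy M.nonneg[of x y] M.zero[of x y] by linarith
    moreover have "riemannian_dist S A g x y = z" using xy emp by (simp add: riemannian_dist_def z_def)
    ultimately show False using xy(3) by (simp add: e0_def)
  qed
  show ?thesis
  proof (rule that[of e0])
    show "e0 > 0" by (simp add: e0_def)
    fix x y e assume xy: "x \<in> S" "y \<in> S" "riemannian_dist S A g x y < e" "e \<le> e0"
    then have "curves S A g x y \<noteq> {}" using ne by auto
    then show "\<exists>\<gamma>\<in>curves S A g x y. integral {0..1} (speed A g \<gamma>) < e"
      using xy cInf_lessD[of "(\<lambda>\<gamma>. integral {0..1} (speed A g \<gamma>)) ` curves S A g x y" e]
      by (auto simp: riemannian_dist_def)
  qed
qed

lemma dist_le_length:
  assumes "\<gamma> \<in> curves S A g x y"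
  shows "riemannian_dist S A g x y \<le> integral {0..1} (speed A g \<gamma>)"
proof -
  have "x \<in> S" "y \<in> S" using curvesD[OF assms] by (auto simp: image_subset_iff)
  moreover have "bdd_below ((\<lambda>\<gamma>. integral {0..1} (speed A g \<gamma>)) ` curves S A g x y)"
  proof (rule bdd_belowI2[of _ 0])
    fix \<gamma> assume "\<gamma> \<in> curves S A g x y"
    from curvesD[OF this] show "0 \<le> integral {0..1} (speed A g \<gamma>)"
      by (intro integral_nonneg speed_nonneg) auto
  qed
  ultimately show ?thesis
    unfolding riemannian_dist_def using assms by (auto intro: cINF_lower)
qed

text \<open>The test curve is the image under \<open>s\<close> of the segment from
  \<open>F p\<close> to \<open>w\<close>; its development has the constant velocity
  \<open>w - F p\<close>.\<close>

lemma dist_section_le: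
  assumes M: "\<And>p u. p \<in> S \<Longrightarrow> sqrt (Q p u) \<le> M * norm u"
    and s: "is_section p r s" and w: "w \<in> ball (F p) r"
  shows "riemannian_dist S A g p (s w) \<le> M * dist (F p) w"
proof -
  define l where "l = (\<lambda>t::real. F p + t *\<^sub>R (w - F p))"
  define I where "I = l -` ball (F p) r"
  define \<gamma> where "\<gamma> = (\<lambda>t. s (l t))"
  have lcont: "continuous_on T l" for T unfolding l_def by (intro continuous_intros)
  have ld: "(l has_vector_derivative (w - F p)) (at t)" for t
    unfolding l_def by (auto intro!: derivative_eq_intros)
  have r: "r > 0" using w by (metis ball_eq_empty empty_iff not_le)
  have I01: "{0..1} \<subseteq> I"
  proof
    fix t :: real assume t: "t \<in> {0..1}"
    have "dist (F p) (l t) = t * dist (F p) w" using t by (simp add: l_def dist_norm norm_minus_commute)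
    also have "\<dots> \<le> dist (F p) w" using t by (simp add: mult_left_le_one_le)
    finally show "t \<in> I" using w by (simp add: I_def)
  qed
  have s': "continuous_on (ball (F p) r) s" "s ` ball (F p) r \<subseteq> S" "\<And>w. w \<in> ball (F p) r \<Longrightarrow> F (s w) = w"
     "s (F p) = p"
    using s by (auto simp: is_section_def)
  have \<gamma>cont: "continuous_on {0..1} \<gamma>"
    unfolding \<gamma>_def by (rule continuous_on_compose2[OF s'(1) lcont]) (use I01 in \<open>auto simp: I_def\<close>)
  have \<gamma>S: "\<gamma> ` {0..1} \<subseteq> S" using I01 s'(2) by (auto simp: \<gamma>_def I_def)
  have \<gamma>': "continuous_on {0<..<1} \<gamma>" "\<gamma> ` {0<..<1} \<subseteq> S"
    by (rule interior_curve[OF \<gamma>cont \<gamma>S])+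
  have d: "((F \<circ> \<gamma>) has_vector_derivative (w - F p)) (at t)" if t: "t \<in> {0<..<1}" for t
  proof (rule has_vector_derivative_transform_within_open[OF ld open_greaterThanLessThan t])
    fix y :: real assume "y \<in> {0<..<1}"
    then have "y \<in> I" by (intro subsetD[OF I01]) auto
    then show "l y = (F \<circ> \<gamma>) y" using s'(3)[of "l y"] by (simp add: \<gamma>_def I_def)
  qed
  have Qcont: "continuous_on {0..1} (\<lambda>t. sqrt (Q (\<gamma> t) (w - F p)))"
    by (intro continuous_intros continuous_on_compose2[OF Q_continuous \<gamma>cont \<gamma>S])
  have sp: "speed A g \<gamma> t = sqrt (Q (\<gamma> t) (w - F p))" if "t \<in> {0..1} - {0, 1}" for t
    by (rule speed_eq[OF _ \<gamma>' d]) (use that in auto)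
  have int: "speed A g \<gamma> integrable_on {0..1}"
    by (rule integrable_spike_finite[of "{0, 1}", OF _ sp integrable_continuous_real[OF Qcont]]) auto
  have "\<gamma> \<in> curves S A g p (s w)"
  proof -
    \<comment> \<open>The endpoints \<open>a\<close> and \<open>b\<close> are declared break points,
      because two-sided derivatives of \<open>\<gamma>\<close> are known only strictly inside the
      unit interval.\<close>
    have "(snd c \<circ> \<gamma>) piecewise_C1_differentiable_on {a..b}"
      if c: "c \<in> A" and ab: "0 \<le> a" "a \<le> b" "b \<le> 1" "\<gamma> ` {a..b} \<subseteq> fst c" for c and a b :: real
      unfolding piecewise_C1_differentiable_on_def
    proof (intro conjI exI[of _ "{a, b}"])
      have g0: "continuous_on {a..b} \<gamma>" using \<gamma>cont by (rule continuous_on_subset) (use ab in auto)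
      then show "continuous_on {a..b} (snd c \<circ> \<gamma>)"
        by (rule continuous_on_compose) (rule continuous_on_subset[OF coord_continuous[OF c] ab(4)])
      have "continuous_on ({a..b} - {a, b}) (\<lambda>t. (w - F p) / dF c (\<gamma> t))"
      proof (intro continuous_intros)
        show "continuous_on ({a..b} - {a, b}) (\<lambda>t. dF c (\<gamma> t))"
          by (rule continuous_on_compose2[OF dF_continuous[OF c], of _ \<gamma>])
             (use ab(4) in \<open>auto intro: continuous_on_subset[OF g0]\<close>)
        show "\<forall>t\<in>{a..b} - {a, b}. dF c (\<gamma> t) \<noteq> 0"
          using dF_nonzero[OF c] ab(4) by blast
      qed
      moreover have "((snd c \<circ> \<gamma>) has_vector_derivative (w - F p) / dF c (\<gamma> t)) (at t)"
        if t: "t \<in> {a..b} - {a, b}" for t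
        by (rule coord_curve_derivative[OF c _ _ \<gamma>' d]) (use t ab in auto)
      ultimately show "(snd c \<circ> \<gamma>) C1_differentiable_on {a..b} - {a, b}"
        unfolding C1_differentiable_on_def
        by (intro exI[of _ "\<lambda>t. (w - F p) / dF c (\<gamma> t)"] conjI ballI)
    qed simp
    moreover have "\<gamma> 0 = p" "\<gamma> 1 = s w" using s' by (auto simp: \<gamma>_def l_def)
    ultimately show ?thesis
      using \<gamma>cont \<gamma>S int unfolding curves_def path_def path_image_def pathstart_def pathfinish_def by blast
  qed
  then have "riemannian_dist S A g p (s w) \<le> integral {0..1} (speed A g \<gamma>)" by (rule dist_le_length)
  also have "\<dots> = integral {0..1} (\<lambda>t. sqrt (Q (\<gamma> t) (w - F p)))"
    by (rule integral_spike[of "{0, 1}"]) (use sp in auto)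
  also have "\<dots> \<le> integral {0..1} (\<lambda>t::real. M * norm (w - F p))"
  proof (rule integral_le[OF integrable_continuous_real[OF Qcont]])
    fix t :: real assume "t \<in> {0..1}"
    then have "\<gamma> t \<in> S" using \<gamma>S by blast
    then show "sqrt (Q (\<gamma> t) (w - F p)) \<le> M * norm (w - F p)" by (rule M)
  qed auto
  finally show ?thesis by (simp add: dist_norm norm_minus_commute)
qed

text \<open>If a section of radius \<open>r\<close> is missing at \<open>p\<close>, one of radius
  \<open>r / 2\<close> is missing at some point within distance \<open>M * r\<close>, since
  otherwise sections of radius \<open>r / 2\<close> would glue to one of radius \<open>r\<close>.
  The resulting Cauchy sequence converges to a point with a section of positive radius, and
  recentring that section at a late member of the sequence produces what this member lacks.\<close>

lemma section_exists:
  assumes p0: "p0 \<in> S" and r0: "r0 > 0"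
  shows "\<exists>s. is_section p0 r0 s"
proof (rule ccontr)
  assume no: "\<nexists>s. is_section p0 r0 s"
  interpret M: Metric_space S "riemannian_dist S A g" by (rule Metric_space_dist)
  let ?d = "riemannian_dist S A g"
  obtain m M where m: "m > 0" "M > 0" "\<And>p u. p \<in> S \<Longrightarrow> m * norm u \<le> sqrt (Q p u)"
    "\<And>p u. p \<in> S \<Longrightarrow> sqrt (Q p u) \<le> M * norm u"
    using Q_bounds by blast
  define bad where "bad r p \<longleftrightarrow> p \<in> S \<and> \<not> (\<exists>s. is_section p r s)" for r p
  have step: "\<exists>q. bad (r / 2) q \<and> ?d p q \<le> M * r" if r: "r > 0" and b: "bad r p" for r p
  proof (cases "\<exists>s. is_section p (r / 2) s")
    case False
    have p: "p \<in> S" using b by (simp add: bad_def)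
    then have "?d p p \<le> M * r" using M.zero[OF p p] m(2) r by simp
    moreover have "bad (r / 2) p" using False p by (simp add: bad_def)
    ultimately show ?thesis by blast
  next
    case True
    then obtain s where s: "is_section p (r / 2) s" by blast
    obtain w where w: "w \<in> ball (F p) (r / 2)" "\<not> (\<exists>s'. is_section (s w) (r / 2) s')"
      using section_glue[OF s, of "r / 2"] r b by (auto simp: bad_def)
    have "?d p (s w) \<le> M * dist (F p) w" by (rule dist_section_le[OF m(4) s w(1)])
    also have "\<dots> \<le> M * r" using w(1) m(2) r by (intro mult_left_mono) auto
    finally have "?d p (s w) \<le> M * r" .
    moreover have "s w \<in> S" using s w(1) by (auto simp: is_section_def)
    ultimately show ?thesis using w(2) unfolding bad_def by blast
  qed
  obtain f where f: "\<And>n. bad (r0 / 2 ^ n) (f n)" "\<And>n. ?d (f n) (f (Suc n)) \<le> M * (r0 / 2 ^ n)"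
  proof -
    have "\<exists>f. \<forall>n. bad (r0 / 2 ^ n) (f n) \<and> ?d (f n) (f (Suc n)) \<le> M * (r0 / 2 ^ n)"
    proof (rule dependent_nat_choice)
      show "\<exists>x. bad (r0 / 2 ^ 0) x" using no p0 by (auto simp: bad_def)
      fix x n assume "bad (r0 / 2 ^ n) x"
      then show "\<exists>y. bad (r0 / 2 ^ Suc n) y \<and> ?d x y \<le> M * (r0 / 2 ^ n)"
        using step[of "r0 / 2 ^ n" x] r0 by (simp add: field_simps)
    qed
    then show thesis using that by blast
  qed
  have fS: "f n \<in> S" for n using f(1) by (simp add: bad_def)
  \<comment> \<open>The steps are dominated by a geometric series. Keeping its partial sum in closed
    form lets the induction close and leaves the tail bound
    \<open>M * r0 * (2 / 2 ^ n)\<close>.\<close>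
  have geo: "?d (f n) (f (n + k)) \<le> M * r0 * (2 / 2 ^ n - 2 / 2 ^ (n + k))" for n k
  proof (induction k)
    case 0 then show ?case using M.zero[OF fS fS, of n n] by simp
  next
    case (Suc k)
    have "?d (f n) (f (n + Suc k)) \<le> ?d (f n) (f (n + k)) + ?d (f (n + k)) (f (Suc (n + k)))"
      using M.triangle[OF fS fS fS] by simp
    also have "\<dots> \<le> M * r0 * (2 / 2 ^ n - 2 / 2 ^ (n + k)) + M * (r0 / 2 ^ (n + k))"
      by (intro add_mono Suc.IH f(2))
    finally show ?case by (simp add: field_simps)
  qed
  have "M.MCauchy f"
    unfolding M.MCauchy_def
  proof (intro conjI allI impI)
    show "range f \<subseteq> S" using fS by blast
    fix e :: real assume e: "e > 0"
    obtain N where N: "(1/2::real) ^ N < e / (2 * M * r0)"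
      using real_arch_pow_inv[of "e / (2 * M * r0)" "1/2"] e m(2) r0 by auto
    have tail: "?d (f n) (f n') < e" if "N \<le> n" "n \<le> n'" for n n'
    proof -
      have "?d (f n) (f n') \<le> M * r0 * (2 / 2 ^ n - 2 / 2 ^ n')" using geo[of n "n' - n"] that by simp
      also have "\<dots> \<le> M * r0 * (2 / 2 ^ n)" using m(2) r0 by (intro mult_left_mono) auto
      also have "\<dots> \<le> M * r0 * (2 / 2 ^ N)" using m(2) r0 that
        by (intro mult_left_mono divide_left_mono power_increasing) auto
      also have "\<dots> < e" using N m(2) r0 by (simp add: field_simps power_one_over)
      finally show ?thesis .
    qed
    show "\<exists>N. \<forall>n n'. N \<le> n \<longrightarrow> N \<le> n' \<longrightarrow> ?d (f n) (f n') < e"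
      using tail M.commute by (metis nle_le)
  qed
  then obtain q where "limitin M.mtopology f q sequentially"
    using mcomplete_dist unfolding M.mcomplete_def by blast
  then have q: "q \<in> S" "\<And>e. e > 0 \<Longrightarrow> \<exists>N. \<forall>n\<ge>N. ?d (f n) q < e"
    unfolding M.limit_metric_sequentially by blast+
  obtain d s where s: "d > 0" "is_section q d s" using local_section[OF q(1)] by blast
  have Fq: "F q \<in> ball (F q) d" "s (F q) = q" using s by (auto simp: is_section_def)
  \<comment> \<open>Over the disc of half the radius, every point still has a disc of radius
    \<open>d / 2\<close> inside the domain of \<open>s\<close>.\<close>
  have s2: "is_section q (d / 2) s" using section_restrict[OF s(2) Fq(1), of "d / 2"] s Fq by simp
  obtain e0 where e0: "e0 > 0"
    "\<And>x y e. x \<in> S \<Longrightarrow> y \<in> S \<Longrightarrow> ?d x y < e \<Longrightarrow> e \<le> e0 \<Longrightarrow>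
       \<exists>\<gamma>\<in>curves S A g x y. integral {0..1} (speed A g \<gamma>) < e"
    using short_curve by blast
  \<comment> \<open>The bound \<open>e0\<close> turns a small distance into an actual curve of small
    length; the other bound keeps the development of this curve inside the half disc.\<close>
  define e where "e = min e0 (m * (d / 2))"
  have "e > 0" using e0 m s by (simp add: e_def)
  then obtain N1 where N1: "\<And>n. n \<ge> N1 \<Longrightarrow> ?d (f n) q < e" using q(2) by blast
  obtain N2 where N2: "(1/2::real) ^ N2 < d / 2 / r0"
    using real_arch_pow_inv[of "d / 2 / r0" "1/2"] r0 s by auto
  define n where "n = max N1 N2"
  have "(1/2::real) ^ n \<le> (1/2) ^ N2" by (rule power_decreasing) (auto simp: n_def)
  then have "r0 * (1/2) ^ n \<le> r0 * (1/2) ^ N2" using r0 by (intro mult_left_mono) auto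
  also have "\<dots> \<le> d / 2" using N2 r0 by (simp add: field_simps)
  finally have small: "r0 / 2 ^ n \<le> d / 2" by (simp add: power_one_over)
  have dq: "?d q (f n) < e" using N1[of n] M.commute by (simp add: n_def)
  have "e \<le> e0" by (simp add: e_def)
  then obtain \<gamma> where \<gamma>: "\<gamma> \<in> curves S A g q (f n)" "integral {0..1} (speed A g \<gamma>) < e"
    using e0(2)[OF q(1) fS dq] by blast
  then have "f n \<in> s ` ball (F q) (d / 2)"
    using short_curve_in_section[OF m(3,1) s2 \<gamma>(1)] by (simp add: e_def)
  then obtain w where w: "w \<in> ball (F q) (d / 2)" "f n = s w" by blast
  then have "is_section (f n) (r0 / 2 ^ n) s"
    using section_restrict[OF s(2), of w "r0 / 2 ^ n"] small s(1) by auto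
  then show False using f(1)[of n] by (auto simp: bad_def)
qed

theorem developing_bijective: "bij_betw F S UNIV"
  using bijective_of_sections section_exists by blast

end

section \<open>The conormal map in real form\<close>

lemma has_derivative_vec3I:
  fixes f :: "'x::real_normed_vector \<Rightarrow> real^3"
  assumes "\<And>i. ((\<lambda>x. f x $ i) has_derivative (\<lambda>v. D v $ i)) (at a within T)"
  shows "(f has_derivative D) (at a within T)"
  unfolding has_derivative_componentwise_within[of f]
  using assms by (auto simp: Basis_vec_def inner_axis)

lemma pd_eq:
  assumes "(f has_derivative D) (at z)"
  shows "pd1 f z = D 1" "pd2 f z = D \<i>"
proof -
  have D: "linear D" using assms by (rule has_derivative_linear)
  have gen: "((\<lambda>t. f (z + of_real t * d)) has_vector_derivative D d) (at 0)" for d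
  proof -
    have "((\<lambda>t. z + of_real t * d) has_derivative (\<lambda>t. of_real t * d)) (at 0)"
      by (auto intro!: derivative_eq_intros)
    moreover have "(f has_derivative D) (at (z + of_real 0 * d))" using assms by simp
    ultimately have "((\<lambda>t. f (z + of_real t * d)) has_derivative (\<lambda>t. D (of_real t * d))) (at 0)"
      by (rule has_derivative_compose)
    moreover have "D (of_real t * d) = t *\<^sub>R D d" for t
      using linear_scale[OF D, of t d] by (simp add: scaleR_conv_of_real)
    ultimately show ?thesis by (simp add: has_vector_derivative_def)
  qed
  show "pd1 f z = D 1" unfolding pd1_def using vector_derivative_at[OF gen[of 1]] by simp
  show "pd2 f z = D \<i>" unfolding pd2_def using vector_derivative_at[OF gen[of \<i>]] by simp
qed

lemma linear_complex_expand:
  assumes "linear (D :: complex \<Rightarrow> 'v::real_normed_vector)"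
  shows "D v = Re v *\<^sub>R D 1 + Im v *\<^sub>R D \<i>"
proof -
  have "v = Re v *\<^sub>R 1 + Im v *\<^sub>R \<i>" by (simp add: complex_eq_iff)
  then have "D v = D (Re v *\<^sub>R 1 + Im v *\<^sub>R \<i>)" by simp
  then show ?thesis by (simp only: linear_add[OF assms] linear_scale[OF assms])
qed

definition dx :: "'a chart \<Rightarrow> ('a \<Rightarrow> 'v::real_normed_vector) \<Rightarrow> 'a \<Rightarrow> 'v" where
  "dx c f p = pd1 (f \<circ> chart_inv c) (snd c p)"

definition dy :: "'a chart \<Rightarrow> ('a \<Rightarrow> 'v::real_normed_vector) \<Rightarrow> 'a \<Rightarrow> 'v" where
  "dy c f p = pd2 (f \<circ> chart_inv c) (snd c p)"

lemma dxy_eq: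
  assumes "((f \<circ> chart_inv c) has_derivative D) (at (snd c p))"
  shows "dx c f p = D 1" "dy c f p = D \<i>"
  unfolding dx_def dy_def by (rule pd_eq[OF assms])+

text \<open>The real form of the Lelieuvre formula, \<open>d\<psi>(v) = N \<times> dN(i v)\<close>.\<close>

definition conormal :: "'a chart set \<Rightarrow> ('a \<Rightarrow> real^3) \<Rightarrow> ('a \<Rightarrow> real^3) \<Rightarrow> bool" where
  "conormal A \<psi> N \<longleftrightarrow> (\<forall>c\<in>A. \<forall>p\<in>fst c.
     ((N \<circ> chart_inv c) has_derivative (\<lambda>v. Re v *\<^sub>R dx c N p + Im v *\<^sub>R dy c N p)) (at (snd c p)) \<and>
     ((\<psi> \<circ> chart_inv c) has_derivative
        (\<lambda>v. N p \<times> (Re v *\<^sub>R dy c N p - Im v *\<^sub>R dx c N p))) (at (snd c p)))"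

text \<open>The coefficient of the affine metric in the chart \<open>c\<close>, in terms of the real
  partial derivatives of \<open>N\<close>; despite the name it may be negative.\<close>

definition area :: "'a chart \<Rightarrow> ('a \<Rightarrow> real^3) \<Rightarrow> 'a \<Rightarrow> real" where
  "area c N p = N p \<bullet> (dx c N p \<times> dy c N p)"

section \<open>From the universal cover down to the surface\<close>

lemma (in surface) lift_image_open:
  assumes cov: "covering_space St pr S" and W: "openin (top_of_set St) W"
  shows "openin (top_of_set S) (pr ` W)"
proof (subst openin_subopen, intro ballI)
  fix y assume "y \<in> pr ` W"
  then obtain q where q: "q \<in> W" "y = pr q" by blast
  then have "q \<in> St" using W openin_imp_subset by blast
  then obtain T u r where T: "q \<in> T" "openin (top_of_set St) T" "pr q \<in> u"
      "openin (top_of_set S) u" "homeomorphism T u pr r"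
    using covering_space_local_homeomorphism[OF cov] by metis
  have TSt: "T \<subseteq> St" using T(2) by (rule openin_imp_subset)
  have "openin (top_of_set T) (T \<inter> W)"
    using openin_subset_trans[OF openin_Int[OF T(2) W] _ TSt] by simp
  then have "openin (top_of_set u) (pr ` (T \<inter> W))"
    using T(5) homeomorphism_imp_open_map by blast
  then have "openin (top_of_set S) (pr ` (T \<inter> W))"
    using T(4) by (rule openin_trans)
  then show "\<exists>V. openin (top_of_set S) V \<and> y \<in> V \<and> V \<subseteq> pr ` W"
    using q T(1) by blast
qed

lemma (in surface) lift_exists:
  assumes cov: "covering_space St pr S" and c: "c \<in> A" "p \<in> fst c"
  obtains W q where "is_lift St pr c W" "q \<in> W" "pr q = p"
proof -
  have "p \<in> S" using c domain_subset by blast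
  then obtain q T u r where T: "pr q = p" "q \<in> T" "openin (top_of_set St) T" "p \<in> u"
      "openin (top_of_set S) u" "homeomorphism T u pr r"
    using covering_space_local_homeomorphism_alt[OF cov] by metis
  have im: "pr ` St = S" using cov covering_space_imp_surjective by blast
  have "openin (top_of_set St) (St \<inter> pr -` fst c)"
    using cov domain_openin[OF c(1)] im
    by (intro continuous_openin_preimage[OF covering_space_imp_continuous]) auto
  then have "openin (top_of_set St) (T \<inter> (St \<inter> pr -` fst c))" by (rule openin_Int[OF T(3)])
  moreover have "inj_on pr (T \<inter> (St \<inter> pr -` fst c))"
    using T(6) by (metis homeomorphism_def inf_le1 inj_on_inverseI inj_on_subset)
  ultimately have "is_lift St pr c (T \<inter> (St \<inter> pr -` fst c))"
    unfolding is_lift_def by auto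
  moreover have "q \<in> T \<inter> (St \<inter> pr -` fst c)" using T c openin_imp_subset by blast
  ultimately show ?thesis using T(1) that by blast
qed

lemma (in surface) conormal_lift:
  assumes cov: "covering_space St pr S" and data: "affine_maximal_data S A St pr \<psi> \<Phi> N"
    and c: "c \<in> A" and W: "is_lift St pr c W" and q: "q \<in> W"
  shows "((N \<circ> chart_inv c) has_derivative
           (\<lambda>v. Re v *\<^sub>R dx c N (pr q) + Im v *\<^sub>R dy c N (pr q))) (at (snd c (pr q)))"
    and "((\<psi> \<circ> chart_inv c) has_derivative
        (\<lambda>v. N (pr q) \<times> (Re v *\<^sub>R dy c N (pr q) - Im v *\<^sub>R dx c N (pr q)))) (at (snd c (pr q)))"
    and "affine_metric_coeff (W, snd c \<circ> pr) \<Phi> q = of_real (area c N (pr q))"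
proof -
  define c' where "c' = (W, snd c \<circ> pr)"
  have c': "c' \<in> cover_atlas St pr A" unfolding cover_atlas_def c'_def using c W by blast
  have W': "openin (top_of_set St) W" "inj_on pr W" "pr ` W \<subseteq> fst c"
    using W by (auto simp: is_lift_def)
  have WSt: "W \<subseteq> St" using W'(1) by (rule openin_imp_subset)
  define V where "V = snd c ` pr ` W"
  have V: "open V"
    unfolding V_def by (rule coord_image_open[OF c lift_image_open[OF cov W'(1)] W'(3)])
  have V': "V = snd c' ` fst c'" by (simp add: V_def c'_def image_comp)
  have inj: "inj_on (snd c \<circ> pr) W"
  proof (rule comp_inj_on[OF W'(2)])
    show "inj_on (snd c) (pr ` W)"
      using chart_inv_coord[OF c] W'(3) by (metis inj_on_def subsetD)
  qed
  have inv: "chart_inv c' (snd c (pr x)) = x" if "x \<in> W" for x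
    unfolding chart_inv_def c'_def using inv_into_f_f[OF inj that] by simp
  have prinv: "pr (chart_inv c' z) = chart_inv c z" "chart_inv c' z \<in> W" if "z \<in> V" for z
    using that inv W'(3) c by (auto simp: V_def)
  define z0 where "z0 = snd c (pr q)"
  have z0: "z0 \<in> V" "chart_inv c' z0 = q" "snd c' q = z0" "chart_inv c z0 = pr q"
    using q inv W'(3) c by (auto simp: z0_def V_def c'_def)
  define f where "f = dz c' \<Phi> q"
  have NPhi: "N (pr x) $ i = 2 * Re (\<Phi> x $ i)" if "x \<in> W" for x i
  proof -
    have "of_real3 (N (pr x)) = \<Phi> x + cnj3 (\<Phi> x)"
      using data that WSt unfolding affine_maximal_data_def by blast
    then have "of_real3 (N (pr x)) $ i = (\<Phi> x + cnj3 (\<Phi> x)) $ i" by simp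
    then show ?thesis by (simp add: of_real3_def cnj3_def complex_eq_iff)
  qed
  have der: "((\<lambda>z. \<Phi> (chart_inv c' z) $ i) has_field_derivative f $ i) (at z0)" for i
  proof -
    have "(\<lambda>z. \<Phi> (chart_inv c' z) $ i) holomorphic_on V"
      using data c' unfolding affine_maximal_data_def holomorphic_map3_def V' by blast
    from holomorphic_derivI[OF this V z0(1)] show ?thesis
      by (simp add: f_def dz_def z0(3))
  qed
  \<comment> \<open>\<open>f\<close> is \<open>\<Phi>\<^sub>z\<close>, and
    \<open>N = 2 Re \<Phi>\<close>, so these are the partial derivatives of \<open>N\<close>.
    Equivalently \<open>f = (X - i Y) / 2\<close>, from which the formulas for
    \<open>d\<psi>\<close> and for the affine metric follow by expansion.\<close>
  define X where "X = (\<chi> i. 2 * Re (f $ i))"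
  define Y where "Y = (\<chi> i. - 2 * Im (f $ i))"
  have dN: "((N \<circ> chart_inv c) has_derivative (\<lambda>v. Re v *\<^sub>R X + Im v *\<^sub>R Y)) (at z0)"
  proof (rule has_derivative_vec3I)
    fix i
    have "((\<lambda>z. \<Phi> (chart_inv c' z) $ i) has_derivative (\<lambda>v. f $ i * v)) (at z0)"
      using der[of i] by (simp add: has_field_derivative_def)
    then have "((\<lambda>z. 2 * Re (\<Phi> (chart_inv c' z) $ i)) has_derivative (\<lambda>v. 2 * Re (f $ i * v))) (at z0)"
      by (intro derivative_intros)
    then have "((\<lambda>z. (N \<circ> chart_inv c) z $ i) has_derivative (\<lambda>v. 2 * Re (f $ i * v))) (at z0)"
      by (rule has_derivative_transform_within_open[OF _ V z0(1)])
         (use NPhi prinv in \<open>metis comp_apply\<close>)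
    then show "((\<lambda>z. (N \<circ> chart_inv c) z $ i) has_derivative (\<lambda>v. (Re v *\<^sub>R X + Im v *\<^sub>R Y) $ i)) (at z0)"
      by (rule has_derivative_eq_rhs) (simp add: X_def Y_def fun_eq_iff algebra_simps)
  qed
  have XY: "dx c N (pr q) = X" "dy c N (pr q) = Y"
    using dxy_eq[OF dN[unfolded z0_def]] by simp_all
  show "((N \<circ> chart_inv c) has_derivative
           (\<lambda>v. Re v *\<^sub>R dx c N (pr q) + Im v *\<^sub>R dy c N (pr q))) (at (snd c (pr q)))"
    using dN by (simp only: XY z0_def)
  have Nq: "\<Phi> q + cnj3 (\<Phi> q) = of_real3 (N (pr q))"
    using data q WSt unfolding affine_maximal_data_def by fastforce
  have "((\<lambda>z. \<psi> (pr (chart_inv c' z))) has_derivative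
         (\<lambda>v. 2 *\<^sub>R Re3 (\<i> *s cross_c (\<Phi> q + cnj3 (\<Phi> q)) (v *s dz c' \<Phi> q)))) (at (snd c' q))"
    using data c' q unfolding affine_maximal_data_def by (auto simp: c'_def)
  then have "((\<psi> \<circ> chart_inv c) has_derivative
         (\<lambda>v. 2 *\<^sub>R Re3 (\<i> *s cross_c (of_real3 (N (pr q))) (v *s f)))) (at z0)"
    unfolding Nq z0(3) f_def[symmetric]
    by (rule has_derivative_transform_within_open[OF _ V z0(1)]) (use prinv in auto)
  moreover have "2 *\<^sub>R Re3 (\<i> *s cross_c (of_real3 (N (pr q))) (v *s f)) =
     N (pr q) \<times> (Re v *\<^sub>R Y - Im v *\<^sub>R X)" for v
    by (simp add: vec_eq_iff forall_3 cross3_def cross_c_def of_real3_def Re3_def X_def Y_def algebra_simps)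
  ultimately show "((\<psi> \<circ> chart_inv c) has_derivative
        (\<lambda>v. N (pr q) \<times> (Re v *\<^sub>R dy c N (pr q) - Im v *\<^sub>R dx c N (pr q)))) (at (snd c (pr q)))"
    by (simp only: XY z0_def)
  show "affine_metric_coeff (W, snd c \<circ> pr) \<Phi> q = of_real (area c N (pr q))"
    unfolding c'_def[symmetric] affine_metric_coeff_def area_def XY Nq f_def[symmetric]
    by (simp add: complex_eq_iff triple_c_def det_3 inner_vec_def sum_3 cross3_def of_real3_def cnj3_def
        X_def Y_def algebra_simps)
qed

lemma (in surface) conormal_data:
  assumes cov: "covering_space St pr S" and data: "affine_maximal_data S A St pr \<psi> \<Phi> N"
  shows "conormal A \<psi> N" and "\<exists>c\<in>A. \<exists>p\<in>fst c. area c N p \<noteq> 0"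
proof -
  show "conormal A \<psi> N"
    unfolding conormal_def
  proof (intro ballI conjI)
    fix c p assume c: "c \<in> A" "p \<in> fst c"
    obtain W q where W: "is_lift St pr c W" "q \<in> W" "pr q = p" by (rule lift_exists[OF cov c])
    show "((N \<circ> chart_inv c) has_derivative (\<lambda>v. Re v *\<^sub>R dx c N p + Im v *\<^sub>R dy c N p)) (at (snd c p))"
      using conormal_lift(1)[OF cov data c(1) W(1,2)] W(3) by simp
    show "((\<psi> \<circ> chart_inv c) has_derivative
        (\<lambda>v. N p \<times> (Re v *\<^sub>R dy c N p - Im v *\<^sub>R dx c N p))) (at (snd c p))"
      using conormal_lift(2)[OF cov data c(1) W(1,2)] W(3) by simp
  qed
  obtain c' q where q: "c' \<in> cover_atlas St pr A" "q \<in> fst c'"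
      "triple_c (\<Phi> q + cnj3 (\<Phi> q)) (dz c' \<Phi> q) (cnj3 (dz c' \<Phi> q)) \<noteq> 0"
    using data unfolding affine_maximal_data_def by blast
  then obtain W c where c: "c' = (W, snd c \<circ> pr)" "c \<in> A" "is_lift St pr c W"
    unfolding cover_atlas_def by blast
  have qW: "q \<in> W" using q(2) c(1) by simp
  have "area c N (pr q) \<noteq> 0"
    using conormal_lift(3)[OF cov data c(2,3) qW] q(3) unfolding c(1) affine_metric_coeff_def by auto
  moreover have "pr q \<in> fst c" using c(3) qW by (auto simp: is_lift_def)
  ultimately show "\<exists>c\<in>A. \<exists>p\<in>fst c. area c N p \<noteq> 0" using c(2) by blast
qed

section \<open>Planar conormal maps\<close>

lemma cross_eq_0_imp_parallel:
  fixes a w :: "real^3"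
  assumes "a \<times> w = 0"
  shows "(a \<bullet> a) *\<^sub>R w = (a \<bullet> w) *\<^sub>R a"
  using Lagrange[of a a w] assms by simp

text \<open>Orthogonality makes \<open>v \<times> w\<close> a multiple of \<open>a\<close>, so the
  triple product depends on \<open>u\<close> only through \<open>a \<bullet> u\<close>. This
  evaluates \<open>area\<close> for planar conormal maps.\<close>

lemma triple_orthogonal:
  fixes a u v w :: "real^3"
  assumes "a \<bullet> v = 0" "a \<bullet> w = 0"
  shows "(a \<bullet> a) * (u \<bullet> (v \<times> w)) = (a \<bullet> (v \<times> w)) * (a \<bullet> u)"
proof -
  have "a \<times> (v \<times> w) = 0" using Lagrange[of a v w] assms by simp
  from cross_eq_0_imp_parallel[OF this]
  have "u \<bullet> ((a \<bullet> a) *\<^sub>R (v \<times> w)) = u \<bullet> ((a \<bullet> (v \<times> w)) *\<^sub>R a)" by simp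
  then show ?thesis by (simp add: inner_commute[of u a])
qed

lemma cross_cross_common:
  fixes n x y :: "real^3"
  shows "(n \<times> x) \<times> (n \<times> y) = (n \<bullet> (x \<times> y)) *\<^sub>R n"
  by (simp add: vec_eq_iff forall_3 cross3_def inner_vec_def sum_3 algebra_simps)

text \<open>The factor is the determinant of multiplication by \<open>a + i b\<close> as a real
  linear map of the plane.\<close>

lemma cross_bilinear_combination:
  fixes x y :: "real^3"
  shows "(a *\<^sub>R x + b *\<^sub>R y) \<times> (- b *\<^sub>R x + a *\<^sub>R y) = (a\<^sup>2 + b\<^sup>2) *\<^sub>R (x \<times> y)"
  by (simp add: vec_eq_iff forall_3 cross3_def power2_eq_square algebra_simps)

lemma has_derivative_cross:
  fixes f g :: "'x::real_normed_vector \<Rightarrow> real^3"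
  assumes "(f has_derivative f') (at x within T)" "(g has_derivative g') (at x within T)"
  shows "((\<lambda>x. f x \<times> g x) has_derivative (\<lambda>h. f x \<times> g' h + f' h \<times> g x)) (at x within T)"
  using bounded_bilinear.FDERIV[OF _ assms, of cross3] bilinear_cross
  by (simp add: bilinear_conv_bounded_bilinear)

context surface
begin

lemma conormalD:
  assumes "conormal A \<psi> N" "c \<in> A" "p \<in> fst c"
  shows "((N \<circ> chart_inv c) has_derivative (\<lambda>v. Re v *\<^sub>R dx c N p + Im v *\<^sub>R dy c N p)) (at (snd c p))"
    and "((\<psi> \<circ> chart_inv c) has_derivative
        (\<lambda>v. N p \<times> (Re v *\<^sub>R dy c N p - Im v *\<^sub>R dx c N p))) (at (snd c p))"
    and "dx c \<psi> p = N p \<times> dy c N p" and "dy c \<psi> p = - (N p \<times> dx c N p)"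
proof -
  show 1: "((N \<circ> chart_inv c) has_derivative (\<lambda>v. Re v *\<^sub>R dx c N p + Im v *\<^sub>R dy c N p)) (at (snd c p))"
    and 2: "((\<psi> \<circ> chart_inv c) has_derivative
        (\<lambda>v. N p \<times> (Re v *\<^sub>R dy c N p - Im v *\<^sub>R dx c N p))) (at (snd c p))"
    using assms unfolding conormal_def by blast+
  show "dx c \<psi> p = N p \<times> dy c N p" "dy c \<psi> p = - (N p \<times> dx c N p)"
    using dxy_eq[OF 2] by simp_all
qed

lemma differentiable_continuous:
  assumes "\<And>c p. c \<in> A \<Longrightarrow> p \<in> fst c \<Longrightarrow> \<exists>D. ((f \<circ> chart_inv c) has_derivative D) (at (snd c p))"
  shows "continuous_on S f"
proof (rule continuous_on_coord)
  fix c assume c: "c \<in> A"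
  show "continuous_on (snd c ` fst c) (f \<circ> chart_inv c)"
    unfolding continuous_on_eq_continuous_at[OF image_open[OF c]]
    using assms[OF c] has_derivative_continuous by blast
qed

lemma conormal_continuous: "conormal A \<psi> N \<Longrightarrow> continuous_on S N"
  "conormal A \<psi> N \<Longrightarrow> continuous_on S \<psi>"
  using conormalD by (blast intro: differentiable_continuous)+

text \<open>Where \<open>area\<close> does not vanish, \<open>N\<close> is a multiple of the normal
  of \<open>\<psi>\<close>; thus \<psi> alone fixes its direction.\<close>

lemma jacobian:
  assumes "conormal A \<psi> N" "c \<in> A" "p \<in> fst c"
  shows "dx c \<psi> p \<times> dy c \<psi> p = area c N p *\<^sub>R N p"
  using conormalD(3,4)[OF assms] cross_cross_common[of "N p" "dx c N p" "dy c N p"]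
    cross_skew[of "N p \<times> dy c N p" "N p \<times> dx c N p"]
  by (simp add: area_def)

text \<open>If \<open>k\<close> is the derivative of the holomorphic coordinate change, the new
  partial derivatives are the images of \<open>k\<close> and \<open>k * \<i>\<close>, a rotated
  frame scaled by \<open>|k|\<close>.\<close>

lemma jacobian_change:
  assumes c: "c \<in> A" "e \<in> A" "p \<in> fst c" "p \<in> fst e"
    and f: "((f \<circ> chart_inv e) has_derivative D) (at (snd e p))"
  shows "dx c f p \<times> dy c f p = (norm (deriv (snd e \<circ> chart_inv c) (snd c p)))\<^sup>2 *\<^sub>R (dx e f p \<times> dy e f p)"
proof -
  define k where "k = deriv (snd e \<circ> chart_inv c) (snd c p)"
  have lin: "linear D" using f by (rule has_derivative_linear)
  have e: "dx e f p = D 1" "dy e f p = D \<i>" using dxy_eq[OF f] by auto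
  have "dx c f p = D k" "dy c f p = D (k * \<i>)"
    using dxy_eq[OF change_of_chart[OF c f]] by (auto simp: k_def)
  then have "dx c f p = Re k *\<^sub>R D 1 + Im k *\<^sub>R D \<i>" "dy c f p = - Im k *\<^sub>R D 1 + Re k *\<^sub>R D \<i>"
    using linear_complex_expand[OF lin, of k] linear_complex_expand[OF lin, of "k * \<i>"] by simp_all
  then show ?thesis
    unfolding e k_def[symmetric] cmod_power2 by (simp only: cross_bilinear_combination)
qed

lemma transition_nonzero:
  assumes "c \<in> A" "e \<in> A" "p \<in> fst c" "p \<in> fst e"
  shows "norm (deriv (snd e \<circ> chart_inv c) (snd c p)) > 0"
  using transition_chain[OF assms] by auto

text \<open>As the factor is positive on an overlap, neither the vanishing nor the sign of
  \<open>area\<close> depends on the chart.\<close>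

lemma area_change:
  assumes N: "conormal A \<psi> N" and c: "c \<in> A" "e \<in> A" "p \<in> fst c" "p \<in> fst e"
  shows "area c N p = (norm (deriv (snd e \<circ> chart_inv c) (snd c p)))\<^sup>2 * area e N p"
  unfolding area_def jacobian_change[OF c conormalD(1)[OF N c(2,4)]] by simp

text \<open>If \<open>N = \<lambda> M\<close> are both conormal for \<open>\<psi>\<close>, then \<open>N \<times> dN = \<lambda>\<^sup>2 (M \<times> dM)\<close>, and
  both sides describe \<open>d\<psi>\<close>.\<close>

lemma conormal_unique:
  assumes N: "conormal A \<psi> N" and M: "conormal A \<psi> M" and c: "c \<in> A" "p \<in> fst c"
    and cont: "continuous_on (fst c) (area c N)" and nz: "area c N p \<noteq> 0"
  shows "N p = M p \<or> N p = - M p"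
proof -
  have par: "\<exists>t. N q = t *\<^sub>R M q" if q: "q \<in> fst c" "area c N q \<noteq> 0" for q
  proof -
    have eq: "area c N q *\<^sub>R N q = area c M q *\<^sub>R M q"
      using jacobian[OF N c(1) q(1)] jacobian[OF M c(1) q(1)] by simp
    have "N q = inverse (area c N q) *\<^sub>R (area c N q *\<^sub>R N q)" using q(2) by simp
    then have "N q = (inverse (area c N q) * area c M q) *\<^sub>R M q" by (simp only: eq scaleR_scaleR)
    then show ?thesis by (rule exI)
  qed
  let ?U = "fst c \<inter> area c N -` (- {0})"
  have "openin (top_of_set (fst c)) ?U"
    by (rule continuous_openin_preimage_gen[OF cont]) auto
  then have "openin (top_of_set S) ?U" using domain_openin[OF c(1)] by (rule openin_trans)
  then have oU: "open (snd c ` ?U)" by (rule coord_image_open[OF c(1)]) auto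
  \<comment> \<open>Near \<open>p\<close> the maps are parallel. Differentiating
    \<open>N \<times> M = 0\<close> exploits this without any regularity of the factor of
    proportionality.\<close>
  have "((\<lambda>z. (N \<circ> chart_inv c) z \<times> (M \<circ> chart_inv c) z) has_derivative
     (\<lambda>v. N p \<times> (Re v *\<^sub>R dx c M p + Im v *\<^sub>R dy c M p) + (Re v *\<^sub>R dx c N p + Im v *\<^sub>R dy c N p) \<times> M p))
     (at (snd c p))"
    using has_derivative_cross[OF conormalD(1)[OF N c] conormalD(1)[OF M c]] c by simp
  moreover have "((\<lambda>z. (N \<circ> chart_inv c) z \<times> (M \<circ> chart_inv c) z) has_derivative (\<lambda>v. 0)) (at (snd c p))"
  proof (rule has_derivative_transform_within_open[OF has_derivative_const oU])
    show "snd c p \<in> snd c ` ?U" using c nz by auto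
    fix z assume "z \<in> snd c ` ?U"
    then obtain q where q: "q \<in> fst c" "area c N q \<noteq> 0" "z = snd c q" by auto
    then show "0 = (N \<circ> chart_inv c) z \<times> (M \<circ> chart_inv c) z"
      using par[OF q(1,2)] c(1) by (auto simp: cross_mult_left)
  qed
  ultimately have "(\<lambda>v. N p \<times> (Re v *\<^sub>R dx c M p + Im v *\<^sub>R dy c M p)
      + (Re v *\<^sub>R dx c N p + Im v *\<^sub>R dy c N p) \<times> M p) = (\<lambda>v. 0)"
    by (rule has_derivative_unique)
  from fun_cong[OF this, of \<i>] have y: "N p \<times> dy c M p + dy c N p \<times> M p = 0" by simp
  obtain t where t: "N p = t *\<^sub>R M p" using par[OF c(2) nz] by blast
  have "dx c \<psi> p = t *\<^sub>R (M p \<times> dy c N p)"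
    using conormalD(3)[OF N c] t by (simp add: cross_mult_left)
  also have "M p \<times> dy c N p = t *\<^sub>R (M p \<times> dy c M p)"
    using y t cross_skew[of "M p" "dy c N p"] by (simp add: cross_mult_left add_eq_0_iff)
  also have "M p \<times> dy c M p = dx c \<psi> p" using conormalD(3)[OF M c] by simp
  finally have eq: "dx c \<psi> p = t *\<^sub>R t *\<^sub>R dx c \<psi> p" .
  have "(1 - t * t) *\<^sub>R dx c \<psi> p = dx c \<psi> p - t *\<^sub>R t *\<^sub>R dx c \<psi> p"
    by (simp add: scaleR_left_diff_distrib)
  also have "\<dots> = 0" by (rule iffD2[OF right_minus_eq eq])
  finally have "(1 - t * t) *\<^sub>R dx c \<psi> p = 0" .
  moreover have "dx c \<psi> p \<noteq> 0"
  proof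
    assume "dx c \<psi> p = 0"
    then have "N p = 0" using jacobian[OF N c] nz by auto
    then show False using nz by (simp add: area_def)
  qed
  ultimately have "t * t = 1" by simp
  then have "t = 1 \<or> t = -1" by (simp add: square_eq_1_iff)
  then show ?thesis using t by auto
qed

lemma locally_constant_imp_constant:
  assumes "\<And>p. p \<in> S \<Longrightarrow> \<exists>U. openin (top_of_set S) U \<and> p \<in> U \<and> (\<forall>q\<in>U. f q = f p)"
    and pq: "p \<in> S" "q \<in> S"
  shows "f p = f q"
proof -
  obtain U where U: "\<And>x. x \<in> S \<Longrightarrow> openin (top_of_set S) (U x) \<and> x \<in> U x \<and> (\<forall>y\<in>U x. f y = f x)"
    using assms(1) by metis
  have op: "openin (top_of_set S) {x \<in> S. P (f x)}" for P
  proof (subst openin_subopen, intro ballI)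
    fix x assume x: "x \<in> {x \<in> S. P (f x)}"
    then have Ux: "openin (top_of_set S) (U x)" "x \<in> U x" "\<forall>y\<in>U x. f y = f x" using U by blast+
    have "U x \<subseteq> {x \<in> S. P (f x)}"
    proof
      fix y assume y: "y \<in> U x"
      then have "y \<in> S" "f y = f x" using Ux openin_imp_subset by blast+
      then show "y \<in> {x \<in> S. P (f x)}" using x by (simp only: mem_Collect_eq)
    qed
    then show "\<exists>T. openin (top_of_set S) T \<and> x \<in> T \<and> T \<subseteq> {x \<in> S. P (f x)}"
      using Ux by blast
  qed
  have "{x \<in> S. f x \<noteq> f p} = {}"
  proof (rule ccontr)
    assume "{x \<in> S. f x \<noteq> f p} \<noteq> {}"
    moreover have "{x \<in> S. f x = f p} \<noteq> {}" using pq by auto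
    ultimately show False
      using connected_S op[of "\<lambda>y. y = f p"] op[of "\<lambda>y. y \<noteq> f p"] unfolding connected_openin by blast
  qed
  then have "q \<notin> {x \<in> S. f x \<noteq> f p}" by (simp only: empty_iff not_False_eq_True)
  then show ?thesis using pq(2) by simp
qed

lemma derivative_zero_imp_constant:
  fixes f :: "'a \<Rightarrow> real"
  assumes D: "\<And>c p. c \<in> A \<Longrightarrow> p \<in> fst c \<Longrightarrow> ((f \<circ> chart_inv c) has_derivative (\<lambda>v. 0)) (at (snd c p))"
    and pq: "p \<in> S" "q \<in> S"
  shows "f p = f q"
proof (rule locally_constant_imp_constant[OF _ pq])
  fix x assume "x \<in> S"
  then obtain c where c: "c \<in> A" "x \<in> fst c" using chart_ex by blast
  obtain r where r: "r > 0" "ball (snd c x) r \<subseteq> snd c ` fst c"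
    using image_open[OF c(1)] c(2) by (meson image_eqI open_contains_ball)
  let ?U = "fst c \<inter> snd c -` ball (snd c x) r"
  have "openin (top_of_set (fst c)) ?U"
    by (rule continuous_openin_preimage_gen[OF coord_continuous[OF c(1)]]) auto
  then have "openin (top_of_set S) ?U" using domain_openin[OF c(1)] by (rule openin_trans)
  moreover have "f y = f x" if y: "y \<in> ?U" for y
  proof -
    have "\<exists>k. \<forall>z\<in>ball (snd c x) r. (f \<circ> chart_inv c) z = k"
    proof (rule has_derivative_zero_constant[OF convex_ball])
      fix z assume "z \<in> ball (snd c x) r"
      then obtain p where "p \<in> fst c" "z = snd c p" using r(2) by blast
      then show "((f \<circ> chart_inv c) has_derivative (\<lambda>v. 0)) (at z within ball (snd c x) r)"
        using D[OF c(1)] has_derivative_at_withinI by blast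
    qed
    then obtain k where k: "\<And>z. z \<in> ball (snd c x) r \<Longrightarrow> (f \<circ> chart_inv c) z = k" by blast
    show ?thesis using k[of "snd c x"] k[of "snd c y"] y r(1) c by simp
  qed
  moreover have "x \<in> ?U" using c(2) r(1) by simp
  ultimately show "\<exists>U. openin (top_of_set S) U \<and> x \<in> U \<and> (\<forall>q\<in>U. f q = f x)" by blast
qed

lemma conformal_immersionD:
  assumes N: "conformal_minimal_immersion A N" and c: "c \<in> A"
  shows "continuous_on (fst c) (dx c N)" "continuous_on (fst c) (dy c N)"
    and "p \<in> fst c \<Longrightarrow> \<exists>r>0. dx c N p \<bullet> dx c N p = r \<and> dy c N p \<bullet> dy c N p = r \<and> dx c N p \<bullet> dy c N p = 0"
    and "p \<in> fst c \<Longrightarrow> dx c N p \<times> dy c N p \<noteq> 0"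
proof -
  have sm: "smooth_on (snd c ` fst c) (N \<circ> chart_inv c)"
    using N c unfolding conformal_minimal_immersion_def by blast
  \<comment> \<open>Differentiability of the once differentiated map gives continuity of the first
    partial derivatives.\<close>
  have "foldr (\<lambda>d. d) [pd1] (N \<circ> chart_inv c) differentiable_on snd c ` fst c"
    "foldr (\<lambda>d. d) [pd2] (N \<circ> chart_inv c) differentiable_on snd c ` fst c"
    using spec[OF sm[unfolded smooth_on_def], of "[pd1]"] spec[OF sm[unfolded smooth_on_def], of "[pd2]"]
    by auto
  then have "continuous_on (snd c ` fst c) (pd1 (N \<circ> chart_inv c))"
    "continuous_on (snd c ` fst c) (pd2 (N \<circ> chart_inv c))"
    using differentiable_imp_continuous_on by auto
  then show "continuous_on (fst c) (dx c N)" "continuous_on (fst c) (dy c N)"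
    unfolding dx_def[abs_def] dy_def[abs_def]
    by (auto intro: continuous_on_compose2[OF _ coord_continuous[OF c]])
  show 1: "\<exists>r>0. dx c N p \<bullet> dx c N p = r \<and> dy c N p \<bullet> dy c N p = r \<and> dx c N p \<bullet> dy c N p = 0"
    if p: "p \<in> fst c" for p
  proof -
    obtain D r where D: "((N \<circ> chart_inv c) has_derivative D) (at (snd c p))" "r > 0"
      "\<And>v w. D v \<bullet> D w = r * (v \<bullet> w)"
      using N c p unfolding conformal_minimal_immersion_def by blast
    show ?thesis
      unfolding dxy_eq[OF D(1)] using D(2,3) by (intro exI[of _ r]) (simp add: inner_complex_def)
  qed
  show "dx c N p \<times> dy c N p \<noteq> 0" if p: "p \<in> fst c"
  proof
    assume "dx c N p \<times> dy c N p = 0"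
    moreover obtain r where r: "r > 0" "dx c N p \<bullet> dx c N p = r" "dy c N p \<bullet> dy c N p = r" "dx c N p \<bullet> dy c N p = 0"
      using 1[OF p] by blast
    ultimately have "norm (dx c N p) * norm (dy c N p) = 0"
      using norm_cross_dot[of "dx c N p" "dy c N p"] by simp
    then show False using r by auto
  qed
qed

lemma area_continuous:
  assumes "conformal_minimal_immersion A N" "conormal A \<psi> N" "c \<in> A"
  shows "continuous_on (fst c) (area c N)"
  unfolding area_def[abs_def]
  by (intro continuous_on_inner continuous_on_cross conformal_immersionD[OF assms(1,3)]
      continuous_on_subset[OF conormal_continuous(1)[OF assms(2)] domain_subset[OF assms(3)]])

text \<open>Squares appear because \<open>N\<close> may be known only up to a sign that varies from
  point to point. The derivative of the square is \<open>2 (a \<bullet> N) (a \<bullet> dN)\<close>,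
  and \<open>b \<noteq> 0\<close> allows the first factor to be cancelled.\<close>

lemma affine_plane_derivative:
  assumes N: "conormal A \<psi> N" and c: "c \<in> A" "p \<in> fst c"
    and U: "open V" "snd c p \<in> V" and eq: "\<And>z. z \<in> V \<Longrightarrow> (a \<bullet> N (chart_inv c z))\<^sup>2 = b\<^sup>2" and b: "b \<noteq> 0"
  shows "a \<bullet> dx c N p = 0" "a \<bullet> dy c N p = 0"
proof -
  let ?D = "\<lambda>v. Re v *\<^sub>R dx c N p + Im v *\<^sub>R dy c N p"
  have inner: "((\<lambda>z. a \<bullet> (N \<circ> chart_inv c) z) has_derivative (\<lambda>v. a \<bullet> ?D v)) (at (snd c p))"
    by (rule has_derivative_inner_right[OF conormalD(1)[OF N c]])
  have "((\<lambda>z. (a \<bullet> (N \<circ> chart_inv c) z) * (a \<bullet> (N \<circ> chart_inv c) z)) has_derivative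
      (\<lambda>v. (a \<bullet> (N \<circ> chart_inv c) (snd c p)) * (a \<bullet> ?D v) + (a \<bullet> ?D v) * (a \<bullet> (N \<circ> chart_inv c) (snd c p))))
      (at (snd c p))"
    by (rule has_derivative_mult[OF inner inner])
  moreover have "((\<lambda>z. (a \<bullet> (N \<circ> chart_inv c) z) * (a \<bullet> (N \<circ> chart_inv c) z)) has_derivative (\<lambda>v. 0))
      (at (snd c p))"
  proof (rule has_derivative_transform_within_open[OF has_derivative_const[of "b\<^sup>2"] U])
    fix z assume "z \<in> V"
    from eq[OF this] show "b\<^sup>2 = (a \<bullet> (N \<circ> chart_inv c) z) * (a \<bullet> (N \<circ> chart_inv c) z)"
      by (simp add: power2_eq_square)
  qed
  ultimately have "(\<lambda>v. (a \<bullet> (N \<circ> chart_inv c) (snd c p)) * (a \<bullet> ?D v) + (a \<bullet> ?D v) * (a \<bullet> (N \<circ> chart_inv c) (snd c p)))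
      = (\<lambda>v. 0)"
    by (rule has_derivative_unique)
  then have z: "(a \<bullet> N p) * (a \<bullet> ?D v) = 0" for v
    using c by (auto dest: fun_cong[of _ _ v])
  have "a \<bullet> N p \<noteq> 0" using eq[OF U(2)] b c by auto
  then show "a \<bullet> dx c N p = 0" "a \<bullet> dy c N p = 0"
    using z[of 1] z[of \<i>] by simp_all
qed

text \<open>In a plane through the origin, \<open>N\<close> and its two partial derivatives at
  \<open>p0\<close> would all be orthogonal to \<open>a\<close>, hence linearly dependent, and
  \<open>area\<close> would vanish there.\<close>

lemma planar_conormal_off_origin:
  assumes N: "conormal A \<psi> N" and nd: "c0 \<in> A" "p0 \<in> fst c0" "area c0 N p0 \<noteq> 0"
    and pl: "a \<noteq> 0" "\<And>p. p \<in> S \<Longrightarrow> a \<bullet> N p = b"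
  shows "b \<noteq> 0"
proof
  assume b: "b = 0"
  have d: "((\<lambda>z. a \<bullet> (N \<circ> chart_inv c0) z) has_derivative
      (\<lambda>v. a \<bullet> (Re v *\<^sub>R dx c0 N p0 + Im v *\<^sub>R dy c0 N p0))) (at (snd c0 p0))"
    by (rule has_derivative_inner_right[OF conormalD(1)[OF N nd(1,2)]])
  have "((\<lambda>z. a \<bullet> (N \<circ> chart_inv c0) z) has_derivative (\<lambda>v. 0)) (at (snd c0 p0))"
  proof (rule has_derivative_transform_within_open[OF has_derivative_const[of b] image_open[OF nd(1)]])
    show "snd c0 p0 \<in> snd c0 ` fst c0" using nd by blast
    fix z assume "z \<in> snd c0 ` fst c0"
    then show "b = a \<bullet> (N \<circ> chart_inv c0) z"
      using pl(2) chart_inv_in[OF nd(1)] domain_subset[OF nd(1)] by (metis comp_apply subsetD)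
  qed
  from has_derivative_unique[OF d this]
  have z: "a \<bullet> (Re v *\<^sub>R dx c0 N p0 + Im v *\<^sub>R dy c0 N p0) = 0" for v by (rule fun_cong)
  have "a \<bullet> dx c0 N p0 = 0" "a \<bullet> dy c0 N p0 = 0" using z[of 1] z[of \<i>] by simp_all
  from triple_orthogonal[OF this, of "N p0"]
  have "(a \<bullet> a) * area c0 N p0 = (a \<bullet> (dx c0 N p0 \<times> dy c0 N p0)) * (a \<bullet> N p0)" by (simp add: area_def)
  also have "a \<bullet> N p0 = 0" using pl(2) b nd domain_subset by blast
  finally show False using pl(1) nd(3) by simp
qed

text \<open>The set where \<open>\<psi>\<close> is an immersion is open. There \<open>N = \<plusminus> M\<close> lies in one of the planes
  \<open>a \<bullet> x = \<plusminus> b\<close>; this persists in the closure, where \<open>\<psi>\<close> is then an immersion too, because \<open>N\<close> is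
  one. By connectedness the set is the whole surface.\<close>

lemma planar_transfer:
  assumes N: "conormal A \<psi> N" "conformal_minimal_immersion A N"
    and nd: "c0 \<in> A" "p0 \<in> fst c0" "area c0 N p0 \<noteq> 0"
    and M: "conormal A \<psi> M" "\<And>p. p \<in> S \<Longrightarrow> a \<bullet> M p = b" and a: "a \<noteq> 0" and b: "b \<noteq> 0"
  shows "\<exists>b'. b' \<noteq> 0 \<and> (\<forall>p\<in>S. a \<bullet> N p = b')"
    and "c \<in> A \<Longrightarrow> p \<in> fst c \<Longrightarrow> area c N p \<noteq> 0"
proof -
  note cont = area_continuous[OF N(2,1)]
  define G where "G = {p \<in> S. \<exists>c\<in>A. p \<in> fst c \<and> area c N p \<noteq> 0}"
  have Gc: "area c N p \<noteq> 0" if p: "p \<in> G" "c \<in> A" "p \<in> fst c" for c p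
  proof -
    obtain e where e: "e \<in> A" "p \<in> fst e" "area e N p \<noteq> 0" using p by (auto simp: G_def)
    show ?thesis
      using area_change[OF N(1) p(2) e(1) p(3) e(2)] transition_nonzero[OF p(2) e(1) p(3) e(2)] e(3) by auto
  qed
  have oGc: "openin (top_of_set S) (fst c \<inter> area c N -` (- {0}))" if c: "c \<in> A" for c
    using continuous_openin_preimage_gen[OF cont[OF c], of "- {0}"] openin_trans[OF _ domain_openin[OF c]] by auto
  have Gchart: "fst c \<inter> area c N -` (- {0}) = fst c \<inter> G" if c: "c \<in> A" for c
    using Gc[OF _ c] domain_subset[OF c] c unfolding G_def by auto
  have Gopen: "openin (top_of_set S) G"
  proof -
    have "G = (\<Union>c\<in>A. fst c \<inter> area c N -` (- {0}))"
      using domain_subset by (auto simp: G_def)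
    then show ?thesis using oGc by auto
  qed
  have Gplane: "(a \<bullet> N p)\<^sup>2 = b\<^sup>2" if p: "p \<in> G" for p
  proof -
    obtain c where c: "c \<in> A" "p \<in> fst c" "p \<in> S" "area c N p \<noteq> 0" using p by (auto simp: G_def)
    have "N p = M p \<or> N p = - M p" by (rule conormal_unique[OF N(1) M(1) c(1,2) cont[OF c(1)] c(4)])
    then show ?thesis using M(2)[OF c(3)] by auto
  qed
  \<comment> \<open>Equations between continuous functions that describe \<open>G\<close> inside a
    chart, so that the complement of \<open>G\<close> is seen to be open.\<close>
  define H where "H c = {p \<in> fst c. (a \<bullet> N p)\<^sup>2 = b\<^sup>2 \<and> a \<bullet> dx c N p = 0 \<and> a \<bullet> dy c N p = 0}" for c
  have GH: "fst c \<inter> G = H c" if c: "c \<in> A" for c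
  proof
    show "fst c \<inter> G \<subseteq> H c"
    proof
      fix p assume p: "p \<in> fst c \<inter> G"
      have op: "open (snd c ` (fst c \<inter> G))"
        using coord_image_open[OF c oGc[OF c]] Gchart[OF c] by simp
      have "(a \<bullet> N (chart_inv c z))\<^sup>2 = b\<^sup>2" if "z \<in> snd c ` (fst c \<inter> G)" for z
        using that Gplane c by auto
      from affine_plane_derivative[OF N(1) c _ op _ this b]
      show "p \<in> H c" using p Gplane by (auto simp: H_def)
    qed
    show "H c \<subseteq> fst c \<inter> G"
    proof
      fix p assume "p \<in> H c"
      then have p: "p \<in> fst c" "(a \<bullet> N p)\<^sup>2 = b\<^sup>2" "a \<bullet> dx c N p = 0" "a \<bullet> dy c N p = 0"
        by (auto simp: H_def)
      let ?w = "dx c N p \<times> dy c N p"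
      have "a \<bullet> ?w \<noteq> 0"
      proof
        assume z: "a \<bullet> ?w = 0"
        have "a \<times> ?w = 0" using Lagrange[of a "dx c N p" "dy c N p"] p(3,4) by simp
        from cross_eq_0_imp_parallel[OF this] z have "?w = 0" using a by simp
        then show False using conformal_immersionD(4)[OF N(2) c p(1)] by simp
      qed
      moreover have "a \<bullet> N p \<noteq> 0" using p(2) b by auto
      ultimately have "area c N p \<noteq> 0"
        using triple_orthogonal[OF p(3,4), of "N p"] by (auto simp: area_def)
      then show "p \<in> fst c \<inter> G" using p(1) c domain_subset[OF c] by (auto simp: G_def)
    qed
  qed
  have "openin (top_of_set S) (S - G)"
  proof (subst openin_subopen, intro ballI)
    fix p assume p: "p \<in> S - G"
    then obtain c where c: "c \<in> A" "p \<in> fst c" using chart_ex by blast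
    let ?f = "\<lambda>p. ((a \<bullet> N p)\<^sup>2 - b\<^sup>2, a \<bullet> dx c N p, a \<bullet> dy c N p)"
    have "continuous_on (fst c) ?f"
      by (intro continuous_intros conformal_immersionD[OF N(2) c(1)]
        continuous_on_subset[OF conormal_continuous(1)[OF N(1)] domain_subset[OF c(1)]])
    then have "openin (top_of_set (fst c)) (fst c \<inter> ?f -` (- {(0, 0, 0)}))"
      by (rule continuous_openin_preimage_gen) auto
    then have "openin (top_of_set S) (fst c \<inter> ?f -` (- {(0, 0, 0)}))"
      using domain_openin[OF c(1)] by (rule openin_trans)
    moreover have "fst c \<inter> ?f -` (- {(0, 0, 0)}) = fst c - G"
      using GH[OF c(1)] by (auto simp: H_def)
    ultimately show "\<exists>T. openin (top_of_set S) T \<and> p \<in> T \<and> T \<subseteq> S - G"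
      using p c domain_subset[OF c(1)] by auto
  qed
  moreover have "p0 \<in> G" using nd domain_subset[OF nd(1)] by (auto simp: G_def)
  ultimately have "S - G = {}"
    using connected_S Gopen openin_imp_subset[OF Gopen] unfolding connected_openin by blast
  then have SG: "S \<subseteq> G" by blast
  show "area c N p \<noteq> 0" if "c \<in> A" "p \<in> fst c"
    using Gc that SG domain_subset by blast
  have "continuous_on S (\<lambda>p. a \<bullet> N p)"
    by (intro continuous_intros conormal_continuous(1)[OF N(1)])
  then have "connected ((\<lambda>p. a \<bullet> N p) ` S)" using connected_S by (rule connected_continuous_image)
  moreover have fin: "(\<lambda>p. a \<bullet> N p) ` S \<subseteq> {b, - b}"
    using Gplane SG by (auto simp: power2_eq_iff)
  then have "finite ((\<lambda>p. a \<bullet> N p) ` S)" by (rule finite_subset) auto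
  ultimately obtain x where "(\<lambda>p. a \<bullet> N p) ` S = {x}"
    using connected_finite_iff_sing S_nonempty by (metis image_is_empty)
  then show "\<exists>b'. b' \<noteq> 0 \<and> (\<forall>p\<in>S. a \<bullet> N p = b')"
    using fin b by (intro exI[of _ x]) auto
qed

text \<open>The sign does not depend on the chart, and it is locally constant because
  \<open>area\<close> is continuous without zeros.\<close>

lemma area_sign:
  assumes N: "conormal A \<psi> N" "conformal_minimal_immersion A N"
    and nz: "\<And>c p. c \<in> A \<Longrightarrow> p \<in> fst c \<Longrightarrow> area c N p \<noteq> 0"
  shows "\<exists>e\<in>{1, -1}. \<forall>c\<in>A. \<forall>p\<in>fst c. e * area c N p > 0"
proof -
  define f where "f p = sgn (area (SOME c. c \<in> A \<and> p \<in> fst c) N p)" for p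
  have f: "f p = sgn (area c N p)" if c: "c \<in> A" "p \<in> fst c" for c p
  proof -
    define e where "e = (SOME c. c \<in> A \<and> p \<in> fst c)"
    have e: "e \<in> A \<and> p \<in> fst e" unfolding e_def by (rule someI[of _ c]) (use c in simp)
    then show ?thesis
      unfolding f_def e_def[symmetric]
      using area_change[OF N(1), of e c p] transition_nonzero[of e c p] c by (simp add: sgn_mult)
  qed
  have loc: "\<exists>U. openin (top_of_set S) U \<and> p \<in> U \<and> (\<forall>q\<in>U. f q = f p)" if pS: "p \<in> S" for p
  proof -
    obtain c where c: "c \<in> A" "p \<in> fst c" using chart_ex[OF pS] by blast
    let ?U = "fst c \<inter> (\<lambda>q. area c N q * area c N p) -` {0<..}"
    have "continuous_on (fst c) (\<lambda>q. area c N q * area c N p)"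
      by (intro continuous_intros area_continuous[OF N(2,1) c(1)])
    then have "openin (top_of_set (fst c)) ?U" by (rule continuous_openin_preimage_gen) auto
    then have "openin (top_of_set S) ?U" using domain_openin[OF c(1)] by (rule openin_trans)
    moreover have "p \<in> ?U" using c nz[OF c] by (simp add: zero_less_mult_iff) linarith
    moreover have "f q = f p" if "q \<in> ?U" for q
      using that f[OF c] f[OF c(1), of q] by (auto simp: zero_less_mult_iff)
    ultimately show ?thesis by blast
  qed
  obtain p0 where p0: "p0 \<in> S" using S_nonempty by blast
  have const: "f p = f p0" if "p \<in> S" for p by (rule locally_constant_imp_constant[OF loc that p0])
  obtain c0 where c0: "c0 \<in> A" "p0 \<in> fst c0" using chart_ex[OF p0] by blast
  have "f p0 \<in> {1, -1}" using f[OF c0] nz[OF c0] by (auto simp: sgn_if)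
  moreover have "f p0 * area c N p > 0" if c: "c \<in> A" "p \<in> fst c" for c p
  proof -
    have "f p = f p0" by (rule const) (use c domain_subset in blast)
    then have "f p0 * area c N p = \<bar>area c N p\<bar>" using f[OF c] by (simp add: abs_sgn mult.commute)
    then show ?thesis using nz[OF c] by simp
  qed
  ultimately show ?thesis by blast
qed

end

lemma orthonormal_frame:
  fixes n :: "real^3"
  assumes n: "norm n = 1"
  obtains e1 e2 where "e1 \<bullet> e1 = 1" "e2 \<bullet> e2 = 1" "e1 \<bullet> e2 = 0" "e1 \<bullet> n = 0" "e2 \<bullet> n = 0"
    "e1 \<times> e2 = n" "e2 \<times> n = e1" "n \<times> e1 = e2"
    "\<And>w. w = (e1 \<bullet> w) *\<^sub>R e1 + (e2 \<bullet> w) *\<^sub>R e2 + (n \<bullet> w) *\<^sub>R n"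
proof -
  have nn: "n \<bullet> n = 1" using n by (simp add: dot_square_norm)
  have "\<exists>u. n \<times> u \<noteq> 0"
  proof (rule ccontr)
    assume "\<not> ?thesis"
    then have "n \<times> axis 1 1 = 0" "n \<times> axis 2 1 = 0" by auto
    then have "n = 0" by (auto simp: cross3_def vec_eq_iff forall_3 axis_def)
    then show False using n by simp
  qed
  then obtain u where u: "n \<times> u \<noteq> 0" by blast
  define e1 where "e1 = (n \<times> u) /\<^sub>R norm (n \<times> u)"
  define e2 where "e2 = n \<times> e1"
  have e11: "e1 \<bullet> e1 = 1" using u by (simp add: e1_def dot_square_norm power2_eq_square)
  have e1n: "e1 \<bullet> n = 0" by (simp add: e1_def dot_cross_self)
  have e12: "e1 \<bullet> e2 = 0" "e2 \<bullet> n = 0" by (simp_all add: e2_def dot_cross_self)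
  have "(norm (n \<times> e1))\<^sup>2 = 1"
    using norm_cross_dot[of n e1] e11 e1n n by (simp add: inner_commute dot_square_norm)
  then have e22: "e2 \<bullet> e2 = 1" by (simp add: e2_def dot_square_norm)
  have c12: "e1 \<times> e2 = n"
    using Lagrange[of e1 n e1] e11 e1n by (simp add: e2_def)
  have c2n: "e2 \<times> n = e1"
  proof -
    have "n \<times> e2 = - e1" using Lagrange[of n n e1] e1n nn by (simp add: e2_def inner_commute)
    then show ?thesis using cross_skew[of e2 n] by simp
  qed
  show ?thesis
  proof (rule that[OF e11 e22 e12(1) e1n e12(2) c12 c2n e2_def[symmetric]])
    fix w
    \<comment> \<open>The remainder is orthogonal to \<open>e1\<close> and \<open>e2\<close>, hence
      parallel to their cross product \<open>n\<close>; being orthogonal to \<open>n\<close> too, it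
      vanishes.\<close>
    define w' where "w' = w - ((e1 \<bullet> w) *\<^sub>R e1 + (e2 \<bullet> w) *\<^sub>R e2 + (n \<bullet> w) *\<^sub>R n)"
    have o: "e1 \<bullet> w' = 0" "e2 \<bullet> w' = 0" "n \<bullet> w' = 0"
      using e11 e22 e12 e1n nn by (simp_all add: w'_def inner_diff_right inner_add_right inner_commute)
    have "w' \<times> n = 0" using Lagrange[of w' e1 e2] o c12 by (simp add: inner_commute)
    then have "n \<times> w' = 0" using cross_skew[of n w'] by simp
    from cross_eq_0_imp_parallel[OF this] have "w' = 0" using nn o by simp
    then show "w = (e1 \<bullet> w) *\<^sub>R e1 + (e2 \<bullet> w) *\<^sub>R e2 + (n \<bullet> w) *\<^sub>R n" by (simp add: w'_def)
  qed
qed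

section \<open>Integration of the conormal map\<close>

text \<open>Real-linear images of products \<open>h \<cdot> cnj k\<close> of holomorphic functions; a class closed under the partial
  derivatives that contains all functions whose smoothness is at stake.\<close>

inductive hol_poly :: "complex set \<Rightarrow> (complex \<Rightarrow> 'v::real_normed_vector) \<Rightarrow> bool" for W where
  basic: "bounded_linear T \<Longrightarrow> h holomorphic_on W \<Longrightarrow> k holomorphic_on W \<Longrightarrow>
     hol_poly W (\<lambda>z. T (h z * cnj (k z)))"
| add: "hol_poly W f \<Longrightarrow> hol_poly W g \<Longrightarrow> hol_poly W (\<lambda>z. f z + g z)"
| cong: "hol_poly W f \<Longrightarrow> (\<And>z. z \<in> W \<Longrightarrow> g z = f z) \<Longrightarrow> hol_poly W g"

lemma hol_poly_derivative:
  assumes "hol_poly W f" and W: "open W"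
  shows "\<exists>f1 f2. hol_poly W f1 \<and> hol_poly W f2 \<and>
    (\<forall>z\<in>W. (f has_derivative (\<lambda>v. Re v *\<^sub>R f1 z + Im v *\<^sub>R f2 z)) (at z))"
  using assms(1)
proof induction
  case (basic T h k)
  interpret T: bounded_linear T by fact
  \<comment> \<open>The product rule. In the imaginary direction the holomorphic factor contributes
    \<open>\<i>\<close> and the conjugated one \<open>- \<i>\<close>, so both partial derivatives
    are again sums of terms of the original shape.\<close>
  let ?f1 = "\<lambda>z. T (deriv h z * cnj (k z)) + T (h z * cnj (deriv k z))"
  let ?f2 = "\<lambda>z. T ((\<i> * deriv h z) * cnj (k z)) + T ((- \<i> * h z) * cnj (deriv k z))"
  have "hol_poly W ?f1" "hol_poly W ?f2"
    by (intro hol_poly.add hol_poly.basic basic holomorphic_intros holomorphic_deriv W)+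
  moreover have "((\<lambda>z. T (h z * cnj (k z))) has_derivative (\<lambda>v. Re v *\<^sub>R ?f1 z + Im v *\<^sub>R ?f2 z)) (at z)"
    if z: "z \<in> W" for z
  proof -
    have "(h has_derivative (\<lambda>v. deriv h z * v)) (at z)" "(k has_derivative (\<lambda>v. deriv k z * v)) (at z)"
      using holomorphic_derivI[OF basic(2) W z] holomorphic_derivI[OF basic(3) W z]
      by (auto simp: has_field_derivative_def)
    then have "((\<lambda>z. T (h z * cnj (k z))) has_derivative
        (\<lambda>v. T (h z * cnj (deriv k z * v) + deriv h z * v * cnj (k z)))) (at z)"
      by (intro T.has_derivative has_derivative_mult has_derivative_cnj)
    moreover have "T (h z * cnj (deriv k z * v) + deriv h z * v * cnj (k z)) = Re v *\<^sub>R ?f1 z + Im v *\<^sub>R ?f2 z" for v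
    proof -
      have "h z * cnj (deriv k z * v) + deriv h z * v * cnj (k z) =
         Re v *\<^sub>R (deriv h z * cnj (k z) + h z * cnj (deriv k z)) +
         Im v *\<^sub>R ((\<i> * deriv h z) * cnj (k z) + (- \<i> * h z) * cnj (deriv k z))"
        by (simp add: complex_eq_iff algebra_simps)
      then show ?thesis by (simp only: T.add T.scaleR)
    qed
    ultimately show ?thesis by simp
  qed
  ultimately show ?case by blast
next
  case (add f g)
  then obtain f1 f2 g1 g2 where
    f: "hol_poly W f1" "hol_poly W f2" "\<And>z. z \<in> W \<Longrightarrow> (f has_derivative (\<lambda>v. Re v *\<^sub>R f1 z + Im v *\<^sub>R f2 z)) (at z)" and
    g: "hol_poly W g1" "hol_poly W g2" "\<And>z. z \<in> W \<Longrightarrow> (g has_derivative (\<lambda>v. Re v *\<^sub>R g1 z + Im v *\<^sub>R g2 z)) (at z)"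
    by blast
  show ?case
  proof (intro exI conjI ballI)
    show "hol_poly W (\<lambda>z. f1 z + g1 z)" "hol_poly W (\<lambda>z. f2 z + g2 z)"
      using f g by (auto intro: hol_poly.add)
    fix z assume "z \<in> W"
    then show "((\<lambda>z. f z + g z) has_derivative
        (\<lambda>v. Re v *\<^sub>R (f1 z + g1 z) + Im v *\<^sub>R (f2 z + g2 z))) (at z)"
      by (intro has_derivative_eq_rhs[OF has_derivative_add[OF f(3) g(3)]])
         (auto simp: scaleR_right_distrib algebra_simps)
  qed
next
  case (cong f g)
  then obtain f1 f2 where
    f: "hol_poly W f1" "hol_poly W f2" "\<And>z. z \<in> W \<Longrightarrow> (f has_derivative (\<lambda>v. Re v *\<^sub>R f1 z + Im v *\<^sub>R f2 z)) (at z)"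
    by blast
  have "(g has_derivative (\<lambda>v. Re v *\<^sub>R f1 z + Im v *\<^sub>R f2 z)) (at z)" if "z \<in> W" for z
    by (rule has_derivative_transform_within_open[OF f(3)[OF that] W that]) (simp add: cong)
  then show ?case using f by blast
qed

lemma hol_poly_smooth:
  assumes f: "hol_poly W f" and W: "open W"
  shows "smooth_on W f"
  unfolding smooth_on_def
proof (intro allI impI)
  fix ds :: "((complex \<Rightarrow> 'a) \<Rightarrow> complex \<Rightarrow> 'a) list"
  assume "set ds \<subseteq> {pd1, pd2}"
  then have "hol_poly W (foldr (\<lambda>d. d) ds f)"
  proof (induction ds)
    case Nil then show ?case using f by simp
  next
    case (Cons d ds)
    then have "hol_poly W (foldr (\<lambda>d. d) ds f)" by simp
    from hol_poly_derivative[OF this W] obtain f1 f2 where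
      g: "hol_poly W f1" "hol_poly W f2"
        "\<And>z. z \<in> W \<Longrightarrow> (foldr (\<lambda>d. d) ds f has_derivative (\<lambda>v. Re v *\<^sub>R f1 z + Im v *\<^sub>R f2 z)) (at z)"
      by blast
    \<comment> \<open>The partial derivative is identified only on \<open>W\<close>; the rule
      \<open>cong\<close> makes its values elsewhere irrelevant.\<close>
    have "hol_poly W (pd1 (foldr (\<lambda>d. d) ds f))"
      by (rule hol_poly.cong[OF g(1)]) (use pd_eq(1)[OF g(3)] in simp)
    moreover have "hol_poly W (pd2 (foldr (\<lambda>d. d) ds f))"
      by (rule hol_poly.cong[OF g(2)]) (use pd_eq(2)[OF g(3)] in simp)
    ultimately show ?case using Cons.prems by auto
  qed
  from hol_poly_derivative[OF this W] show "foldr (\<lambda>d. d) ds f differentiable_on W"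
    unfolding differentiable_on_def differentiable_def by (blast intro: has_derivative_at_withinI)
qed

section \<open>The inverse of a bijective developing map as a global coordinate\<close>

context developing
begin

context
  assumes bij: "bij_betw F S UNIV"
begin

definition "G = inv_into S F"

lemma F_G: "F (G w) = w" and G_in: "G w \<in> S" and G_F: "p \<in> S \<Longrightarrow> G (F p) = p"
  using bij unfolding G_def bij_betw_def
  by (auto simp: f_inv_into_f inv_into_into inv_into_f_f)

text \<open>Read in a chart, the global inverse \<open>G\<close> is the holomorphic local inverse of
  \<open>F\<close>, and its derivative is the reciprocal of that of \<open>F\<close>.\<close>

lemma G_local:
  assumes c: "c \<in> A" "G w \<in> fst c"
  obtains V h where "open V" "w \<in> V" "h holomorphic_on V" "(h has_field_derivative 1 / dF c (G w)) (at w)"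
    "\<And>x. x \<in> V \<Longrightarrow> G x \<in> fst c \<and> h x = snd c (G x) \<and> G x = chart_inv c (h x) \<and> h x \<in> snd c ` fst c"
proof -
  obtain U h where U: "openin (top_of_set S) U" "G w \<in> U" "U \<subseteq> fst c" "open (F ` U)" "inj_on F U"
    "h holomorphic_on F ` U" "\<forall>x\<in>U. h (F x) = snd c x" "\<forall>x\<in>U. deriv h (F x) = 1 / dF c x"
    by (rule local_inverse[OF c])
  have w: "w \<in> F ` U" using U(2) F_G by (metis image_eqI)
  show ?thesis
  proof (rule that[of "F ` U" h])
    show "(h has_field_derivative 1 / dF c (G w)) (at w)"
      using holomorphic_derivI[OF U(6,4) w] U(2,8) F_G by metis
    show "G x \<in> fst c \<and> h x = snd c (G x) \<and> G x = chart_inv c (h x) \<and> h x \<in> snd c ` fst c" if xU: "x \<in> F ` U" for x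
    proof -
      obtain q where q: "q \<in> U" "x = F q" using xU by blast
      then have "q \<in> fst c" "q \<in> S" using U(3) domain_subset[OF c(1)] by auto
      then show ?thesis using q U(7) G_F c(1) by auto
    qed
  qed (use U w in auto)
qed

lemma G_continuous: "continuous_on UNIV G"
  unfolding continuous_on_eq_continuous_at[OF open_UNIV]
proof
  fix w :: complex
  obtain c where c: "c \<in> A" "G w \<in> fst c" using chart_ex[OF G_in] by blast
  obtain V h where V: "open V" "w \<in> V" "h holomorphic_on V" "(h has_field_derivative 1 / dF c (G w)) (at w)"
    "\<And>x. x \<in> V \<Longrightarrow> G x \<in> fst c \<and> h x = snd c (G x) \<and> G x = chart_inv c (h x) \<and> h x \<in> snd c ` fst c"
    using G_local[OF c] by blast
  have "continuous_on V (\<lambda>x. chart_inv c (h x))"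
    by (rule continuous_on_compose2[OF chart_inv_continuous[OF c(1)] holomorphic_on_imp_continuous_on[OF V(3)]])
       (use V(5) in blast)
  then have "continuous_on V G" by (rule continuous_on_eq) (metis V(5))
  then show "isCont G w" using V(1,2) continuous_on_eq_continuous_at by blast
qed

lemma G_chart_open: "c \<in> A \<Longrightarrow> open {w. G w \<in> fst c}"
  using open_preimage[OF G_continuous _ open_UNIV domain_openin, of c] G_in
  by (auto simp: vimage_def)

lemma G_coord_holomorphic: "c \<in> A \<Longrightarrow> (\<lambda>w. snd c (G w)) holomorphic_on {w. G w \<in> fst c}"
proof -
  assume c: "c \<in> A"
  have "\<exists>f'. ((\<lambda>w. snd c (G w)) has_field_derivative f') (at w)" if w: "G w \<in> fst c" for w
  proof -
    obtain V h where V: "open V" "w \<in> V" "h holomorphic_on V" "(h has_field_derivative 1 / dF c (G w)) (at w)"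
    "\<And>x. x \<in> V \<Longrightarrow> G x \<in> fst c \<and> h x = snd c (G x) \<and> G x = chart_inv c (h x) \<and> h x \<in> snd c ` fst c"
      using G_local[OF c w] by blast
    have "((\<lambda>w. snd c (G w)) has_field_derivative 1 / dF c (G w)) (at w)"
      by (rule has_field_derivative_transform_within_open[OF V(4,1,2)]) (use V(5) in blast)
    then show ?thesis by blast
  qed
  then show ?thesis using G_chart_open[OF c] by (simp add: holomorphic_on_open)
qed

text \<open>In the coordinate \<open>w = F\<close> the conormal map is affine, so
  \<open>N \<times> dN(i u)\<close> is affine in \<open>w\<close>. Multiplying it out with the frame
  relations gives \<open>?D\<close>, the differential of the quadratic map
  \<open>?q\<close>.\<close>

lemma conormal_integral:
  fixes n e1 e2 :: "real^3"
  assumes N: "conormal A \<psi> N" and b: "b \<noteq> 0"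
    and frame: "n \<times> e1 = e2" "e1 \<times> e2 = n" "e2 \<times> n = e1"
    and N_eq: "\<And>p. p \<in> S \<Longrightarrow> N p = Re (F p) *\<^sub>R e1 + Im (F p) *\<^sub>R e2 + b *\<^sub>R n"
    and dN: "\<And>c p. c \<in> A \<Longrightarrow> p \<in> fst c \<Longrightarrow> dx c N p = Re (dF c p) *\<^sub>R e1 + Im (dF c p) *\<^sub>R e2"
      "\<And>c p. c \<in> A \<Longrightarrow> p \<in> fst c \<Longrightarrow> dy c N p = - Im (dF c p) *\<^sub>R e1 + Re (dF c p) *\<^sub>R e2"
  obtains \<beta> where "\<And>w. \<psi> (G w) = - b *\<^sub>R (Re w *\<^sub>R e1 + Im w *\<^sub>R e2) + (((Re w)\<^sup>2 + (Im w)\<^sup>2) / 2) *\<^sub>R n + \<beta>"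
proof -
  let ?q = "\<lambda>w. - b *\<^sub>R (Re w *\<^sub>R e1 + Im w *\<^sub>R e2) + (((Re w)\<^sup>2 + (Im w)\<^sup>2) / 2) *\<^sub>R n"
  let ?D = "\<lambda>w u. - b *\<^sub>R (Re u *\<^sub>R e1 + Im u *\<^sub>R e2) + (Re w * Re u + Im w * Im u) *\<^sub>R n"
  have q: "(?q has_derivative ?D w) (at w)" for w
    by (auto intro!: derivative_eq_intros simp: fun_eq_iff algebra_simps)
       (simp add: add_divide_distrib scaleR_left_distrib)
  have frame': "e2 \<times> e1 = - n" "n \<times> e2 = - e1" "e1 \<times> n = - e2"
    using frame cross_skew by metis+
  have \<psi>: "((\<lambda>w. \<psi> (G w)) has_derivative ?D w) (at w)" for w
  proof -
    obtain c where c: "c \<in> A" "G w \<in> fst c" using chart_ex[OF G_in] by blast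
    obtain V h where V: "open V" "w \<in> V" "h holomorphic_on V" "(h has_field_derivative 1 / dF c (G w)) (at w)"
      "\<And>x. x \<in> V \<Longrightarrow> G x \<in> fst c \<and> h x = snd c (G x) \<and> G x = chart_inv c (h x) \<and> h x \<in> snd c ` fst c"
      using G_local[OF c] by blast
    have hw: "h w = snd c (G w)" using V(2,5) by blast
    have "(h has_derivative (\<lambda>u. u / dF c (G w))) (at w)"
      using V(4) unfolding has_field_derivative_def by (rule has_derivative_eq_rhs) (simp add: fun_eq_iff)
    moreover have "((\<psi> \<circ> chart_inv c) has_derivative
        (\<lambda>v. N (G w) \<times> (Re v *\<^sub>R dy c N (G w) - Im v *\<^sub>R dx c N (G w)))) (at (h w))"
      unfolding hw by (rule conormalD(2)[OF N c])
    ultimately have "((\<lambda>x. (\<psi> \<circ> chart_inv c) (h x)) has_derivative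
        (\<lambda>u. N (G w) \<times> (Re (u / dF c (G w)) *\<^sub>R dy c N (G w) - Im (u / dF c (G w)) *\<^sub>R dx c N (G w)))) (at w)"
      by (rule has_derivative_compose)
    then have "((\<lambda>x. \<psi> (G x)) has_derivative
        (\<lambda>u. N (G w) \<times> (Re (u / dF c (G w)) *\<^sub>R dy c N (G w) - Im (u / dF c (G w)) *\<^sub>R dx c N (G w)))) (at w)"
      by (rule has_derivative_transform_within_open[OF _ V(1,2)]) (metis V(5) comp_apply)
    moreover have "N (G w) \<times> (Re (u / dF c (G w)) *\<^sub>R dy c N (G w) - Im (u / dF c (G w)) *\<^sub>R dx c N (G w)) = ?D w u" for u
    proof -
      define v where "v = u / dF c (G w)"
      have u: "u = v * dF c (G w)" using dF_nonzero[OF c] by (simp add: v_def)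
      have "Re v *\<^sub>R dy c N (G w) - Im v *\<^sub>R dx c N (G w) = - Im u *\<^sub>R e1 + Re u *\<^sub>R e2"
        unfolding dN[OF c] u by (simp add: algebra_simps)
      moreover have "N (G w) = Re w *\<^sub>R e1 + Im w *\<^sub>R e2 + b *\<^sub>R n" using N_eq[OF G_in] F_G by simp
      ultimately have "N (G w) \<times> (Re v *\<^sub>R dy c N (G w) - Im v *\<^sub>R dx c N (G w)) =
          (Re w *\<^sub>R e1 + Im w *\<^sub>R e2 + b *\<^sub>R n) \<times> (- Im u *\<^sub>R e1 + Re u *\<^sub>R e2)" by (simp only:)
      also have "\<dots> = ?D w u"
        by (simp add: cross_add_left cross_add_right cross_mult_left cross_mult_right Cross3.right_diff_distrib
              frame frame' algebra_simps)
      finally show ?thesis by (simp only: v_def)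
    qed
    ultimately show ?thesis by simp
  qed
  have "\<exists>\<beta>. \<forall>w\<in>UNIV. \<psi> (G w) - ?q w = \<beta>"
  proof (rule has_derivative_zero_constant[OF convex_UNIV])
    fix w :: complex
    show "((\<lambda>w. \<psi> (G w) - ?q w) has_derivative (\<lambda>h. 0)) (at w within UNIV)"
      using has_derivative_diff[OF \<psi> q, of w] by simp
  qed
  then obtain \<beta> where "\<And>w. \<psi> (G w) - ?q w = \<beta>" by blast
  then have "\<psi> (G w) = ?q w + \<beta>" for w by (metis diff_add_cancel add.commute)
  then show ?thesis by (rule that)
qed

text \<open>The scaling by \<open>k\<close> makes the linear part of the resulting affine map volume-preserving.\<close>

lemma elliptic_paraboloid_of_formula:
  fixes n e1 e2 :: "real^3"
  assumes b: "b \<noteq> 0"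
    and frame: "e1 \<bullet> e1 = 1" "e2 \<bullet> e2 = 1" "e1 \<bullet> e2 = 0" "e1 \<bullet> n = 0" "e2 \<bullet> n = 0" "e2 \<times> n = e1"
    and \<psi>: "\<And>w. \<psi> (G w) = - b *\<^sub>R (Re w *\<^sub>R e1 + Im w *\<^sub>R e2) + (((Re w)\<^sup>2 + (Im w)\<^sup>2) / 2) *\<^sub>R n + \<beta>"
  shows "elliptic_paraboloid S A \<psi>"
proof -
  \<comment> \<open>Substituting \<open>w = k x\<close> multiplies the linear terms by
    \<open>k\<close> and the quadratic one by \<open>k^2\<close>. The determinant becomes
    \<open>b^2 k^4\<close>, which is 1 for this \<open>k\<close>.\<close>
  define k where "k = 1 / sqrt \<bar>b\<bar>"
  have k: "k > 0" "k\<^sup>2 = 1 / \<bar>b\<bar>" using b by (simp_all add: k_def power_divide)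
  define L :: "real^3^3" where "L = transpose (vector [- (b * k) *\<^sub>R e1, - (b * k) *\<^sub>R e2, k\<^sup>2 *\<^sub>R n])"
  define \<sigma> where "\<sigma> = (\<lambda>x. L *v paraboloid_graph x + \<beta>)"
  have detL: "det L = 1"
  proof -
    have "det L = (b * k)\<^sup>2 * k\<^sup>2 * (e1 \<bullet> (e2 \<times> n))"
      unfolding L_def det_transpose dot_cross_det[symmetric]
      by (simp add: cross_mult_left cross_mult_right power2_eq_square)
    also have "\<dots> = b\<^sup>2 * (k\<^sup>2)\<^sup>2" using frame by (simp add: power_mult_distrib power2_eq_square)
    also have "\<dots> = 1" using b by (simp add: k(2) power_divide)
    finally show ?thesis .
  qed
  have \<sigma>: "\<sigma> x = \<psi> (G (of_real k * x))" for x
    unfolding \<psi> \<sigma>_def L_def paraboloid_graph_def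
    by (simp add: vec_eq_iff forall_3 matrix_vector_mult_def transpose_def sum_3 power2_eq_square algebra_simps)
  have \<psi>F: "\<psi> p = \<sigma> (F p / of_real k)" if "p \<in> S" for p
    using \<sigma> G_F[OF that] k by simp
  \<comment> \<open>The components along \<open>e1\<close> and \<open>e2\<close> recover the
    coordinate \<open>w\<close> from the point of the surface. This left inverse is continuous on
    all of space and yields both injectivity and continuity of the inverse of \<psi>.\<close>
  define X where "X y = Complex (- (e1 \<bullet> (y - \<beta>)) / b) (- (e2 \<bullet> (y - \<beta>)) / b)" for y
  have X: "X (\<psi> (G w)) = w" for w
    unfolding \<psi> X_def using frame b
    by (simp add: inner_add_right inner_diff_right inner_commute complex_eq_iff)
  have inj: "inj_on \<psi> S"
    by (rule inj_onI) (metis G_F X)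
  have inv: "inv_into S \<psi> (\<psi> p) = p" if "p \<in> S" for p by (rule inv_into_f_f[OF inj that])
  have im: "\<psi> ` S = range \<sigma>"
  proof
    show "\<psi> ` S \<subseteq> range \<sigma>" using \<psi>F by (metis image_subsetI rangeI)
    show "range \<sigma> \<subseteq> \<psi> ` S" using \<sigma> G_in by (metis image_eqI image_subsetI)
  qed
  have inv': "inv_into S \<psi> y = G (X y)" if y: "y \<in> range \<sigma>" for y
  proof -
    obtain p where p: "p \<in> S" "y = \<psi> p" using y im by blast
    then have "X y = F p" using X[of "F p"] G_F[OF p(1)] by simp
    then show ?thesis using inv[OF p(1)] p G_F by simp
  qed
  have \<psi>F': "\<psi> p = - b *\<^sub>R (Re (F p) *\<^sub>R e1 + Im (F p) *\<^sub>R e2) + (((Re (F p))\<^sup>2 + (Im (F p))\<^sup>2) / 2) *\<^sub>R n + \<beta>"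
    if "p \<in> S" for p using \<psi>[of "F p"] G_F[OF that] by simp
  have cont\<psi>: "continuous_on S \<psi>"
  proof -
    have "continuous_on S (\<lambda>p. - b *\<^sub>R (Re (F p) *\<^sub>R e1 + Im (F p) *\<^sub>R e2)
        + (((Re (F p))\<^sup>2 + (Im (F p))\<^sup>2) / 2) *\<^sub>R n + \<beta>)"
      by (intro continuous_intros F_continuous) auto
    then show ?thesis by (rule continuous_on_eq) (simp only: \<psi>F')
  qed
  have "homeomorphism S (range \<sigma>) \<psi> (inv_into S \<psi>)"
    unfolding homeomorphism_def
  proof (intro conjI ballI)
    show "inv_into S \<psi> (\<psi> p) = p" if "p \<in> S" for p by (rule inv[OF that])
    show "\<psi> ` S = range \<sigma>" by (rule im)
    show "\<psi> (inv_into S \<psi> y) = y" if "y \<in> range \<sigma>" for y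
      using that im by (auto intro: f_inv_into_f)
    show "inv_into S \<psi> ` range \<sigma> = S"
      unfolding im[symmetric] by (force simp: inv image_iff)
    have "continuous_on (range \<sigma>) X"
      unfolding X_def[abs_def] Complex_eq using b by (intro continuous_intros) auto
    then have "continuous_on (range \<sigma>) (\<lambda>y. G (X y))"
      using continuous_on_compose2[OF G_continuous] by blast
    then show "continuous_on (range \<sigma>) (inv_into S \<psi>)"
      by (rule continuous_on_eq) (simp only: inv')
  qed (rule cont\<psi>)
  moreover have "smooth_on (snd c ` fst c) (\<psi> \<circ> chart_inv c)" if c: "c \<in> A" for c
  proof (rule hol_poly_smooth[OF _ image_open[OF c]])
    let ?W = "snd c ` fst c" and ?f = "F \<circ> chart_inv c"
    have f: "?f holomorphic_on ?W" by (rule F_holomorphic[OF c])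
    have T1: "bounded_linear (\<lambda>z. - b *\<^sub>R (Re z *\<^sub>R e1 + Im z *\<^sub>R e2))"
      by (intro bounded_linear_intros bounded_linear_Re bounded_linear_Im)
    have T2: "bounded_linear (\<lambda>z. Re z *\<^sub>R ((1 / 2) *\<^sub>R n))"
      by (intro bounded_linear_intros bounded_linear_Re bounded_linear_Im)
    have T3: "bounded_linear (\<lambda>z. Re z *\<^sub>R \<beta>)"
      by (intro bounded_linear_intros bounded_linear_Re bounded_linear_Im)
    \<comment> \<open>The linear, quadratic and constant parts of the formula arise as real-linear
      images of \<open>F cnj 1\<close>, \<open>F cnj F\<close> and \<open>1 cnj 1\<close>.\<close>
    have "hol_poly ?W (\<lambda>z. (- b *\<^sub>R (Re (?f z * cnj 1) *\<^sub>R e1 + Im (?f z * cnj 1) *\<^sub>R e2)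
        + Re (?f z * cnj (?f z)) *\<^sub>R ((1 / 2) *\<^sub>R n)) + Re (1 * cnj 1) *\<^sub>R \<beta>)"
      by (intro hol_poly.add hol_poly.basic[OF T1 f, of "\<lambda>_. 1"] hol_poly.basic[OF T2 f f]
          hol_poly.basic[OF T3, of "\<lambda>_. 1" _ "\<lambda>_. 1"] holomorphic_on_const)
    then show "hol_poly ?W (\<psi> \<circ> chart_inv c)"
    proof (rule hol_poly.cong)
      fix z assume "z \<in> ?W"
      then have "chart_inv c z \<in> S" using chart_inv_in[OF c] domain_subset[OF c] by blast
      from \<psi>F'[OF this] show "(\<psi> \<circ> chart_inv c) z = (- b *\<^sub>R (Re (?f z * cnj 1) *\<^sub>R e1 + Im (?f z * cnj 1) *\<^sub>R e2)
        + Re (?f z * cnj (?f z)) *\<^sub>R ((1 / 2) *\<^sub>R n)) + Re (1 * cnj 1) *\<^sub>R \<beta>"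
        by (simp add: power2_eq_square)
    qed
  qed
  moreover have "smooth_on {x. \<sigma> x \<in> \<psi> ` fst c} (snd c \<circ> inv_into S \<psi> \<circ> \<sigma>)" if c: "c \<in> A" for c
  proof -
    let ?V = "{w. G w \<in> fst c}" and ?m = "\<lambda>x. of_real k * x :: complex"
    have e: "{x. \<sigma> x \<in> \<psi> ` fst c} = ?m -` ?V"
      using inj domain_subset[OF c] G_in by (auto simp: \<sigma> inj_on_def)
    have op: "open (?m -` ?V)"
      by (rule open_vimage[OF G_chart_open[OF c]]) (intro continuous_intros)
    have "((\<lambda>w. snd c (G w)) \<circ> ?m) holomorphic_on ?m -` ?V"
      by (rule holomorphic_on_compose_gen[OF _ G_coord_holomorphic[OF c]]) (auto intro!: holomorphic_intros)
    from hol_poly.basic[OF bounded_linear_ident this holomorphic_on_const[of 1]]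
    have "hol_poly (?m -` ?V) (\<lambda>x. snd c (G (?m x)))" by simp
    then have "hol_poly (?m -` ?V) (snd c \<circ> inv_into S \<psi> \<circ> \<sigma>)"
      by (rule hol_poly.cong) (use \<sigma> inv G_in in simp)
    then show ?thesis unfolding e using op by (rule hol_poly_smooth)
  qed
  ultimately have "diffeomorphism_onto S A \<psi> \<sigma>" unfolding diffeomorphism_onto_def by blast
  then show ?thesis unfolding elliptic_paraboloid_def \<sigma>_def using detL by (intro exI[of _ L] exI[of _ \<beta>]) simp
qed

end

end

section \<open>Paraboloids\<close>

lemma (in surface) planar_complete_imp_paraboloid:
  assumes N: "conormal A \<psi> N" "conformal_minimal_immersion A N"
    and nz: "\<And>c p. c \<in> A \<Longrightarrow> p \<in> fst c \<Longrightarrow> area c N p \<noteq> 0"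
    and plane: "a \<noteq> 0" "b' \<noteq> 0" "\<And>p. p \<in> S \<Longrightarrow> a \<bullet> N p = b'"
    and g: "complete_riemannian_metric S A g" and K: "compact K" "K \<subseteq> S"
    and flat: "\<And>c p v. c \<in> A \<Longrightarrow> p \<in> fst c - K \<Longrightarrow> g c p v v = \<bar>area c N p\<bar> * (v \<bullet> v)"
  shows "elliptic_paraboloid S A \<psi>"
proof -
  obtain e where e: "e = 1 \<or> e = (-1::real)" "\<And>c p. c \<in> A \<Longrightarrow> p \<in> fst c \<Longrightarrow> e * area c N p > 0"
    using area_sign[OF N nz] by blast
  \<comment> \<open>This choice of sign for the normal makes \<open>e * b\<close> positive. The
    frame then has the orientation for which \<open>F\<close> is holomorphic rather than
    antiholomorphic.\<close>
  define s where "s = e * sgn b'"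
  define n where "n = (s / norm a) *\<^sub>R a"
  define b where "b = s * b' / norm a"
  have s: "s = 1 \<or> s = -1" using e plane(2) by (auto simp: s_def sgn_if)
  have nn: "norm n = 1" using s plane(1) by (auto simp: n_def)
  have eb: "e * b > 0" using e(1) plane(1,2) by (auto simp: b_def s_def sgn_if divide_simps)
  have nN: "n \<bullet> N p = b" if "p \<in> S" for p using plane(3)[OF that] by (simp add: n_def b_def)
  have nd: "n \<bullet> dx c N p = 0" "n \<bullet> dy c N p = 0" if c: "c \<in> A" "p \<in> fst c" for c p
  proof -
    have "a \<bullet> N (chart_inv c z) = b'" if "z \<in> snd c ` fst c" for z
      using plane(3) chart_inv_in[OF c(1) that] domain_subset[OF c(1)] by blast
    then have "(a \<bullet> N (chart_inv c z))\<^sup>2 = b'\<^sup>2" if "z \<in> snd c ` fst c" for z using that by simp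
    from affine_plane_derivative[OF N(1) c image_open[OF c(1)] _ this plane(2)] c
    show "n \<bullet> dx c N p = 0" "n \<bullet> dy c N p = 0" by (auto simp: n_def)
  qed
  have area: "area c N p = (n \<bullet> (dx c N p \<times> dy c N p)) * b" if c: "c \<in> A" "p \<in> fst c" for c p
    using triple_orthogonal[OF nd[OF c], of "N p"] nn nN domain_subset[OF c(1)] c(2)
    by (auto simp: area_def dot_square_norm)
  obtain e1 e2 where fr: "e1 \<bullet> e1 = 1" "e2 \<bullet> e2 = 1" "e1 \<bullet> e2 = 0" "e1 \<bullet> n = 0" "e2 \<bullet> n = 0"
    "e1 \<times> e2 = n" "e2 \<times> n = e1" "n \<times> e1 = e2"
    and ex: "\<And>w. w = (e1 \<bullet> w) *\<^sub>R e1 + (e2 \<bullet> w) *\<^sub>R e2 + (n \<bullet> w) *\<^sub>R n"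
    using orthonormal_frame[OF nn] by blast
  define F where "F p = Complex (e1 \<bullet> N p) (e2 \<bullet> N p)" for p
  define d where "d c p = Complex (e1 \<bullet> dx c N p) (e2 \<bullet> dx c N p)" for c p
  have key: "dx c N p = Re (d c p) *\<^sub>R e1 + Im (d c p) *\<^sub>R e2 \<and>
      dy c N p = - Im (d c p) *\<^sub>R e1 + Re (d c p) *\<^sub>R e2 \<and>
      area c N p = b * (norm (d c p))\<^sup>2 \<and> d c p \<noteq> 0" if c: "c \<in> A" "p \<in> fst c" for c p
  proof -
    define x1 x2 y1 y2 where "x1 = e1 \<bullet> dx c N p" and "x2 = e2 \<bullet> dx c N p"
      and "y1 = e1 \<bullet> dy c N p" and "y2 = e2 \<bullet> dy c N p"
    have X: "dx c N p = x1 *\<^sub>R e1 + x2 *\<^sub>R e2" using ex[of "dx c N p"] nd[OF c] by (simp add: x1_def x2_def)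
    have Y: "dy c N p = y1 *\<^sub>R e1 + y2 *\<^sub>R e2" using ex[of "dy c N p"] nd[OF c] by (simp add: y1_def y2_def)
    have fr': "e2 \<times> e1 = - n" using cross_skew[of e2 e1] fr by simp
    have nn': "n \<bullet> n = 1" using nn by (simp add: dot_square_norm)
    have tr: "n \<bullet> (dx c N p \<times> dy c N p) = x1 * y2 - x2 * y1"
      unfolding X Y
      by (simp add: cross_add_left cross_add_right cross_mult_left cross_mult_right fr fr' inner_diff_right
          inner_add_right nn' algebra_simps)
    obtain r where r: "r > 0" "dx c N p \<bullet> dx c N p = r" "dy c N p \<bullet> dy c N p = r" "dx c N p \<bullet> dy c N p = 0"
      using conformal_immersionD(3)[OF N(2) c] by blast
    have r': "x1\<^sup>2 + x2\<^sup>2 = r" "y1\<^sup>2 + y2\<^sup>2 = r" "x1 * y1 + x2 * y2 = 0"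
      using r(2,3,4) fr(1,2,3) unfolding X Y
      by (simp_all add: inner_add_left inner_add_right power2_eq_square inner_commute mult.commute)
    have pos: "x1 * y2 - x2 * y1 > 0"
    proof -
      have "e * area c N p = (e * b) * (x1 * y2 - x2 * y1)" using area[OF c] tr by simp
      then have "0 < (e * b) * (x1 * y2 - x2 * y1)" using e(2)[OF c] by (simp only:)
      then show ?thesis using eb by (rule zero_less_mult_pos)
    qed
    \<comment> \<open>Lagrange's identity gives the Jacobian up to sign, and the orientation selects
      the value \<open>r\<close>. The sum of squares considered next then vanishes, which amounts to
      the Cauchy-Riemann equations.\<close>
    have "(x1 * y2 - x2 * y1)\<^sup>2 = (x1\<^sup>2 + x2\<^sup>2) * (y1\<^sup>2 + y2\<^sup>2) - (x1 * y1 + x2 * y2)\<^sup>2"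
      by (simp add: power2_eq_square algebra_simps)
    also have "\<dots> = r\<^sup>2" unfolding r' by (simp add: power2_eq_square)
    finally have j: "x1 * y2 - x2 * y1 = r" using pos r(1) by simp
    have "(y1 + x2)\<^sup>2 + (y2 - x1)\<^sup>2 = (x1\<^sup>2 + x2\<^sup>2) + (y1\<^sup>2 + y2\<^sup>2) - 2 * (x1 * y2 - x2 * y1)"
      by (simp add: power2_eq_square algebra_simps)
    also have "\<dots> = 0" unfolding r' j by simp
    finally have y: "y1 = - x2" "y2 = x1" by (simp_all add: sum_power2_eq_zero_iff)
    have dd: "d c p = Complex x1 x2" by (simp add: d_def x1_def x2_def)
    have nd2: "(norm (d c p))\<^sup>2 = r" using r'(1) by (simp add: dd cmod_power2)
    then have "d c p \<noteq> 0" using r(1) by auto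
    moreover have "area c N p = b * (norm (d c p))\<^sup>2" using area[OF c] tr j nd2 by simp
    ultimately show ?thesis using X Y y by (simp add: dd)
  qed
  have der: "((F \<circ> chart_inv c) has_field_derivative d c p) (at (snd c p))" if c: "c \<in> A" "p \<in> fst c" for c p
  proof -
    note D = conormalD(1)[OF N(1) c]
    have "((\<lambda>z. of_real (e1 \<bullet> (N \<circ> chart_inv c) z) + \<i> * of_real (e2 \<bullet> (N \<circ> chart_inv c) z)) has_derivative
      (\<lambda>v. of_real (e1 \<bullet> (Re v *\<^sub>R dx c N p + Im v *\<^sub>R dy c N p)) +
           \<i> * of_real (e2 \<bullet> (Re v *\<^sub>R dx c N p + Im v *\<^sub>R dy c N p)))) (at (snd c p))"
      by (intro has_derivative_add has_derivative_of_real has_derivative_mult_right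
          has_derivative_inner_right[OF D])
    moreover have "(\<lambda>z. of_real (e1 \<bullet> (N \<circ> chart_inv c) z) + \<i> * of_real (e2 \<bullet> (N \<circ> chart_inv c) z))
       = F \<circ> chart_inv c"
      by (simp add: fun_eq_iff F_def complex_eq_iff)
    moreover have "of_real (e1 \<bullet> (Re v *\<^sub>R dx c N p + Im v *\<^sub>R dy c N p)) +
           \<i> * of_real (e2 \<bullet> (Re v *\<^sub>R dx c N p + Im v *\<^sub>R dy c N p)) = d c p * v" for v
    proof -
      have kd: "dx c N p = Re (d c p) *\<^sub>R e1 + Im (d c p) *\<^sub>R e2"
        "dy c N p = - Im (d c p) *\<^sub>R e1 + Re (d c p) *\<^sub>R e2" using key[OF c] by blast+
      have "e2 \<bullet> e1 = 0" using fr(3) by (simp add: inner_commute)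
      then show ?thesis
        unfolding kd by (simp add: complex_eq_iff inner_add_right inner_diff_right fr algebra_simps)
    qed
    ultimately show ?thesis by (simp add: has_field_derivative_def)
  qed
  interpret developing S A F
  proof
    fix c assume c: "c \<in> A"
    show "(F \<circ> chart_inv c) holomorphic_on snd c ` fst c"
      unfolding holomorphic_on_open[OF image_open[OF c]] using der[OF c] by blast
    show "deriv (F \<circ> chart_inv c) (snd c p) \<noteq> 0" if "p \<in> fst c" for p
      using DERIV_imp_deriv[OF der[OF c that]] key[OF c that] by simp
  qed
  have dF: "dF c p = d c p" if "c \<in> A" "p \<in> fst c" for c p
    unfolding dF_def by (rule DERIV_imp_deriv[OF der[OF that]])
  have b0: "b \<noteq> 0" using eb by auto
  interpret complete_developing S A F g K "\<bar>b\<bar>"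
  proof (rule complete_developing.intro[OF developing_axioms], rule complete_developing_axioms.intro)
    show "riemannian_metric A g" "Metric_space S (riemannian_dist S A g)"
      "Metric_space.mcomplete S (riemannian_dist S A g)"
      using g by (auto simp: complete_riemannian_metric_def)
    show "\<bar>b\<bar> > 0" using b0 by simp
    show "compact K" "K \<subseteq> S" by (fact K)+
    show "g c p v v = \<bar>b\<bar> * (norm (dF c p * v))\<^sup>2" if c: "c \<in> A" "p \<in> fst c - K" for c p v
    proof -
      have "p \<in> fst c" using c by blast
      then show ?thesis
        using flat[OF c, of v] key[OF c(1)] dF[OF c(1)]
        by (simp add: abs_mult norm_mult power_mult_distrib dot_square_norm)
    qed
  qed
  note bij = developing_bijective
  have N_eq: "N p = Re (F p) *\<^sub>R e1 + Im (F p) *\<^sub>R e2 + b *\<^sub>R n" if "p \<in> S" for p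
    using ex[of "N p"] nN[OF that] by (simp add: F_def)
  obtain \<beta> where "\<And>w. \<psi> (G w) = - b *\<^sub>R (Re w *\<^sub>R e1 + Im w *\<^sub>R e2) + (((Re w)\<^sup>2 + (Im w)\<^sup>2) / 2) *\<^sub>R n + \<beta>"
    using conormal_integral[OF bij N(1) b0 fr(8,6,7) N_eq] key dF by metis
  then show ?thesis by (rule elliptic_paraboloid_of_formula[OF bij b0 fr(1-5,7)])
qed

text \<open>Three conormal maps meet here: \<open>N\<close> is an immersion, \<open>M\<close> is
  planar, and \<open>N2\<close> carries the complete metric. Planarity is transferred from
  \<open>M\<close> to \<open>N\<close>, and the metric from \<open>N2\<close> to
  \<open>N\<close>.\<close>

lemma (in surface) planar_complete_maxface:
  assumes cov: "covering_space St pr S"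
    and N: "affine_maximal_data S A St pr \<psi> \<Phi> N" "conformal_minimal_immersion A N"
    and M: "affine_maximal_data S A St pr \<psi> \<Phi>' M" "a \<noteq> 0" "\<And>p. p \<in> S \<Longrightarrow> a \<bullet> M p = b"
    and compl: "complete_map S A St pr \<psi>"
  shows "elliptic_paraboloid S A \<psi>"
proof -
  note cN = conormal_data[OF cov N(1)] and cM = conormal_data[OF cov M(1)]
  obtain c0 p0 where nd: "c0 \<in> A" "p0 \<in> fst c0" "area c0 N p0 \<noteq> 0" using cN(2) by blast
  obtain c1 p1 where nd1: "c1 \<in> A" "p1 \<in> fst c1" "area c1 M p1 \<noteq> 0" using cM(2) by blast
  have b: "b \<noteq> 0" by (rule planar_conormal_off_origin[OF cM(1) nd1 M(2,3)])
  obtain b' where b': "b' \<noteq> 0" "\<And>p. p \<in> S \<Longrightarrow> a \<bullet> N p = b'"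
    using planar_transfer(1)[OF cN(1) N(2) nd cM(1) M(3,2) b] by blast
  have nz: "area c N p \<noteq> 0" if "c \<in> A" "p \<in> fst c" for c p
    by (rule planar_transfer(2)[OF cN(1) N(2) nd cM(1) M(3,2) b that])
  obtain \<Phi>2 N2 T g where C: "affine_maximal_data S A St pr \<psi> \<Phi>2 N2 \<and> symmetric_tensor A T \<and>
      compact_support S A T \<and>
      (\<forall>c\<in>A. \<forall>W. is_lift St pr c W \<longrightarrow> (\<forall>q\<in>W. \<forall>v w.
         g c (pr q) v w = norm (affine_metric_coeff (W, snd c \<circ> pr) \<Phi>2 q) * (v \<bullet> w) + T c (pr q) v w)) \<and>
      complete_riemannian_metric S A g"
    using compl unfolding complete_map_def by (elim exE)
  have C1: "affine_maximal_data S A St pr \<psi> \<Phi>2 N2" and C2: "compact_support S A T"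
    and C4: "complete_riemannian_metric S A g" using C by simp_all
  note C3 = C[THEN conjunct2, THEN conjunct2, THEN conjunct2, THEN conjunct1, rule_format]
  obtain K where K: "compact K" "K \<subseteq> S" "\<And>c p v w. c \<in> A \<Longrightarrow> p \<in> fst c - K \<Longrightarrow> T c p v w = 0"
    using C2 unfolding compact_support_def by blast
  have c2: "conormal A \<psi> N2" by (rule conormal_data(1)[OF cov C1])
  show ?thesis
  proof (rule planar_complete_imp_paraboloid[OF cN(1) N(2) nz M(2) b' C4 K(1,2)])
    fix c p v assume c: "c \<in> A" "p \<in> fst c - K"
    then have cp: "c \<in> A" "p \<in> fst c" by auto
    obtain W q where W: "is_lift St pr c W" "q \<in> W" "pr q = p" by (rule lift_exists[OF cov cp])
    have g: "g c p v v = \<bar>area c N2 p\<bar> * (v \<bullet> v)"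
      using C3[OF c(1) W(1,2), of v v] K(3)[OF c, of v v] conormal_lift(3)[OF cov C1 c(1) W(1,2)] W(3)
      by simp
    have N2: "N p = N2 p \<or> N p = - N2 p"
      by (rule conormal_unique[OF cN(1) c2 cp area_continuous[OF N(2) cN(1) c(1)] nz[OF cp]])
    \<comment> \<open>Both sides are the cross product of the partial derivatives of \<psi>. Hence
      \<open>N = \<plusminus> N2\<close> at the single point \<open>p\<close> already determines
      \<open>area\<close> up to sign, with no need to compare derivatives of \<open>N\<close> and
      \<open>N2\<close>.\<close>
    have J: "area c N p *\<^sub>R N p = area c N2 p *\<^sub>R N2 p"
      using jacobian[OF cN(1) cp] jacobian[OF c2 cp] by simp
    have "N p \<noteq> 0" using nz[OF cp] by (auto simp: area_def)
    then have "area c N p = area c N2 p \<or> area c N p = - area c N2 p"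
    proof -
      from N2 show ?thesis
      proof
        assume eq: "N p = N2 p"
        then have "(area c N p - area c N2 p) *\<^sub>R N p = 0" using J by (simp add: scaleR_left_diff_distrib)
        then show ?thesis using \<open>N p \<noteq> 0\<close> by simp
      next
        assume eq: "N p = - N2 p"
        then have "(area c N p + area c N2 p) *\<^sub>R N p = 0" using J by (simp add: scaleR_left_distrib)
        then show ?thesis using \<open>N p \<noteq> 0\<close> by simp
      qed
    qed
    then show "g c p v v = \<bar>area c N p\<bar> * (v \<bullet> v)" using g by auto
  qed
qed

lemma (in surface) constant_normal_imp_planar:
  assumes N: "conormal A \<psi> N" "conformal_minimal_immersion A N"
    and \<nu>: "\<And>c p. c \<in> A \<Longrightarrow> p \<in> fst c \<Longrightarrow> unit_normal (N \<circ> chart_inv c) (snd c p) = \<nu>0"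
  shows "\<nu>0 \<noteq> 0 \<and> (\<exists>b. \<forall>p\<in>S. \<nu>0 \<bullet> N p = b)"
proof -
  have un: "dx c N p \<times> dy c N p = norm (dx c N p \<times> dy c N p) *\<^sub>R \<nu>0" "\<nu>0 \<noteq> 0"
    if c: "c \<in> A" "p \<in> fst c" for c p
  proof -
    have nz: "dx c N p \<times> dy c N p \<noteq> 0" by (rule conformal_immersionD(4)[OF N(2) c])
    have u: "\<nu>0 = (dx c N p \<times> dy c N p) /\<^sub>R norm (dx c N p \<times> dy c N p)"
      using \<nu>[OF c] by (simp add: unit_normal_def dx_def dy_def)
    show "dx c N p \<times> dy c N p = norm (dx c N p \<times> dy c N p) *\<^sub>R \<nu>0" using u nz by simp
    show "\<nu>0 \<noteq> 0" using u nz by simp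
  qed
  have orth: "\<nu>0 \<bullet> dx c N p = 0" "\<nu>0 \<bullet> dy c N p = 0" if c: "c \<in> A" "p \<in> fst c" for c p
  proof -
    let ?w = "dx c N p \<times> dy c N p"
    have nz: "norm ?w \<noteq> 0" using conformal_immersionD(4)[OF N(2) c] by simp
    have "norm ?w * (\<nu>0 \<bullet> dx c N p) = ?w \<bullet> dx c N p" "norm ?w * (\<nu>0 \<bullet> dy c N p) = ?w \<bullet> dy c N p"
      using un(1)[OF c] by (metis inner_scaleR_left)+
    then show "\<nu>0 \<bullet> dx c N p = 0" "\<nu>0 \<bullet> dy c N p = 0" using nz by (simp_all add: dot_cross_self)
  qed
  obtain p0 where p0: "p0 \<in> S" using S_nonempty by blast
  have "\<nu>0 \<bullet> N p = \<nu>0 \<bullet> N p0" if "p \<in> S" for p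
  proof (rule derivative_zero_imp_constant[OF _ that p0, of "\<lambda>p. \<nu>0 \<bullet> N p"])
    fix c p assume c: "c \<in> A" "p \<in> fst c"
    have "((\<lambda>z. \<nu>0 \<bullet> (N \<circ> chart_inv c) z) has_derivative
        (\<lambda>v. \<nu>0 \<bullet> (Re v *\<^sub>R dx c N p + Im v *\<^sub>R dy c N p))) (at (snd c p))"
      by (rule has_derivative_inner_right[OF conormalD(1)[OF N(1) c]])
    then show "(((\<lambda>p. \<nu>0 \<bullet> N p) \<circ> chart_inv c) has_derivative (\<lambda>v. 0)) (at (snd c p))"
      using orth[OF c] by (simp add: inner_add_right comp_def)
  qed
  moreover have "\<nu>0 \<noteq> 0" using chart_ex[OF p0] un(2) by blast
  ultimately show ?thesis by blast
qed

section \<open>From the paraboloid back to a planar conormal map\<close>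

lemma inner_transpose:
  fixes B :: "real^3^3"
  shows "(transpose B *v x) \<bullet> y = x \<bullet> (B *v y)"
  by (simp add: inner_vec_def matrix_vector_mult_def transpose_def sum_3 algebra_simps)

text \<open>With \<open>\<psi> = L (x, \<bar>x\<bar>\<^sup>2/2) + \<beta>\<close>, orthogonality of \<open>N\<close> and \<open>d\<psi>\<close> gives
  \<open>L\<^sup>T N = \<lambda> (-x, 1)\<close>, and the Lelieuvre formula becomes \<open>\<plusminus>dx(v) = - \<lambda>\<^sup>2 J dx(i v)\<close> with the
  rotation \<open>J\<close>; applying it twice yields \<open>\<lambda>\<^sup>4 = 1\<close>.\<close>

lemma (in surface) paraboloid_imp_planar:
  assumes N: "conormal A \<psi> N" and ell: "elliptic_paraboloid S A \<psi>"
  shows "\<exists>a b. a \<noteq> 0 \<and> (\<forall>p\<in>S. a \<bullet> N p = b)"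
proof -
  obtain L :: "real^3^3" and \<beta> where L: "\<bar>det L\<bar> = 1"
    and diffeo: "diffeomorphism_onto S A \<psi> (\<lambda>x. L *v paraboloid_graph x + \<beta>)"
    using ell unfolding elliptic_paraboloid_def by blast
  define \<sigma> where "\<sigma> = (\<lambda>x. L *v paraboloid_graph x + \<beta>)"
  define \<delta> where "\<delta> = det L"
  have \<delta>: "\<delta> * \<delta> = 1" "\<delta> \<noteq> 0" using L by (auto simp: \<delta>_def abs_if split: if_splits)
  have "invertible L" using L invertible_det_nz[of L] by auto
  then obtain M where "L ** M = mat 1" "M ** L = mat 1" unfolding invertible_def by blast
  then have LM: "L *v (M *v w) = w" "M *v (L *v w) = w" for w
    by (simp_all add: matrix_vector_mul_assoc)
  \<comment> \<open>\<open>y\<close> is the image point moved to the standard paraboloid and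
    \<open>x\<close> its horizontal part. Conormals are covectors, so \<open>m\<close> is obtained
    with the transpose of \<open>L\<close>.\<close>
  define y where "y p = M *v (\<psi> p - \<beta>)" for p
  define x where "x p = Complex (y p $ 1) (y p $ 2)" for p
  define m where "m p = transpose L *v N p" for p
  have hom: "homeomorphism S (range \<sigma>) \<psi> (inv_into S \<psi>)"
    and sm: "\<And>c. c \<in> A \<Longrightarrow> smooth_on {x. \<sigma> x \<in> \<psi> ` fst c} (snd c \<circ> inv_into S \<psi> \<circ> \<sigma>)"
    using diffeo unfolding diffeomorphism_onto_def \<sigma>_def by blast+
  have x\<sigma>: "\<psi> p = \<sigma> (x p) \<and> y p $ 3 = ((y p $ 1)\<^sup>2 + (y p $ 2)\<^sup>2) / 2" if p: "p \<in> S" for p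
  proof -
    obtain u where u: "\<psi> p = \<sigma> u" using hom p unfolding homeomorphism_def by blast
    then have "y p = paraboloid_graph u" by (simp add: y_def \<sigma>_def LM)
    then have "x p = u" "y p $ 3 = ((y p $ 1)\<^sup>2 + (y p $ 2)\<^sup>2) / 2"
      by (simp_all add: x_def paraboloid_graph_def)
    then show ?thesis using u by simp
  qed
  \<comment> \<open>The derivative of \<open>y\<close>, as supplied by the formula for
    \<open>d\<psi>\<close>; its third component is found by differentiating the equation of the
    paraboloid.\<close>
  define \<eta> where "\<eta> c p v = M *v (N p \<times> (Re v *\<^sub>R dy c N p - Im v *\<^sub>R dx c N p))" for c p v
  have dy': "((\<lambda>z. y (chart_inv c z) $ i) has_derivative (\<lambda>v. \<eta> c p v $ i)) (at (snd c p))"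
    if c: "c \<in> A" "p \<in> fst c" for c p i
  proof -
    have "bounded_linear (\<lambda>w. (M *v w) $ i)"
      by (intro bounded_linear_compose[OF bounded_linear_vec_nth] matrix_vector_mul_bounded_linear)
    from bounded_linear.has_derivative[OF this has_derivative_diff[OF conormalD(2)[OF N c] has_derivative_const[of \<beta>]]]
    show ?thesis by (simp add: y_def \<eta>_def comp_def)
  qed
  have \<eta>3: "\<eta> c p v $ 3 = y p $ 1 * \<eta> c p v $ 1 + y p $ 2 * \<eta> c p v $ 2" if c: "c \<in> A" "p \<in> fst c" for c p v
  proof -
    let ?y = "\<lambda>i z. y (chart_inv c z) $ i"
    have "((\<lambda>z. (?y 1 z * ?y 1 z + ?y 2 z * ?y 2 z) * (1 / 2)) has_derivative
        (\<lambda>v. (?y 1 (snd c p) * \<eta> c p v $ 1 + \<eta> c p v $ 1 * ?y 1 (snd c p) +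
          (?y 2 (snd c p) * \<eta> c p v $ 2 + \<eta> c p v $ 2 * ?y 2 (snd c p))) * (1 / 2))) (at (snd c p))"
      by (intro has_derivative_mult_left has_derivative_add has_derivative_mult dy'[OF c])
    then have "((\<lambda>z. (?y 1 z * ?y 1 z + ?y 2 z * ?y 2 z) * (1 / 2)) has_derivative
        (\<lambda>v. y p $ 1 * \<eta> c p v $ 1 + y p $ 2 * \<eta> c p v $ 2)) (at (snd c p))"
      by (rule has_derivative_eq_rhs) (use c in \<open>simp add: fun_eq_iff\<close>)
    then have "((\<lambda>z. y (chart_inv c z) $ 3) has_derivative
        (\<lambda>v. y p $ 1 * \<eta> c p v $ 1 + y p $ 2 * \<eta> c p v $ 2)) (at (snd c p))"
    proof (rule has_derivative_transform_within_open[OF _ image_open[OF c(1)]])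
      fix z assume "z \<in> snd c ` fst c"
      then have "chart_inv c z \<in> S" using chart_inv_in[OF c(1)] domain_subset[OF c(1)] by blast
      then show "(?y 1 z * ?y 1 z + ?y 2 z * ?y 2 z) * (1 / 2) = ?y 3 z"
        using x\<sigma> by (simp add: power2_eq_square)
    qed (use c in auto)
    from has_derivative_unique[OF dy'[OF c] this] show ?thesis by (rule fun_cong)
  qed
  define X where "X c p v = Complex (\<eta> c p v $ 1) (\<eta> c p v $ 2)" for c p v
  have dX: "((\<lambda>z. x (chart_inv c z)) has_derivative X c p) (at (snd c p))" if c: "c \<in> A" "p \<in> fst c" for c p
  proof -
    have "((\<lambda>z. of_real (y (chart_inv c z) $ 1) + \<i> * of_real (y (chart_inv c z) $ 2)) has_derivative
        (\<lambda>v. of_real (\<eta> c p v $ 1) + \<i> * of_real (\<eta> c p v $ 2))) (at (snd c p))"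
      by (intro has_derivative_add has_derivative_of_real has_derivative_mult_right dy'[OF c])
    then show ?thesis by (simp add: x_def X_def[abs_def] Complex_eq)
  qed
  \<comment> \<open>Smoothness of the inverse diffeomorphism makes the chart coordinate a
    differentiable function of \<open>x\<close>, so the chain rule yields a left inverse of
    \<open>X c p\<close>. The derivative of \<open>?\<kappa>\<close> is taken within
    \<open>?E\<close>, which contains the image of the chart under \<open>?\<xi>\<close>.\<close>
  have X_inj: "v = 0" if c: "c \<in> A" "p \<in> fst c" and X0: "X c p v = 0" for c p v
  proof -
    let ?V = "snd c ` fst c" and ?E = "{x. \<sigma> x \<in> \<psi> ` fst c}"
    let ?\<kappa> = "snd c \<circ> inv_into S \<psi> \<circ> \<sigma>" and ?\<xi> = "\<lambda>z. x (chart_inv c z)"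
    have V: "chart_inv c z \<in> fst c" "chart_inv c z \<in> S" if "z \<in> ?V" for z
      using that chart_inv_in[OF c(1)] domain_subset[OF c(1)] by blast+
    have im: "?\<xi> ` ?V \<subseteq> ?E"
    proof
      fix u assume "u \<in> ?\<xi> ` ?V"
      then obtain z where z: "z \<in> ?V" "u = ?\<xi> z" by blast
      then have "\<sigma> u = \<psi> (chart_inv c z)" using x\<sigma>[OF V(2)] by simp
      then show "u \<in> ?E" using V(1)[OF z(1)] by simp
    qed
    have "foldr (\<lambda>d. d) [] ?\<kappa> differentiable_on ?E"
      using spec[OF sm[OF c(1), unfolded smooth_on_def], of "[]"] by simp
    then have dif: "?\<kappa> differentiable_on ?E" by simp
    have z0: "snd c p \<in> ?V" using c by blast
    then have "?\<xi> (snd c p) \<in> ?E" by (rule subsetD[OF im imageI])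
    with dif have "?\<kappa> differentiable (at (?\<xi> (snd c p)) within ?E)"
      unfolding differentiable_on_def by (rule bspec)
    then obtain k where k: "(?\<kappa> has_derivative k) (at (?\<xi> (snd c p)) within ?E)"
      unfolding differentiable_def by (rule exE)
    have "((\<lambda>z. ?\<kappa> (?\<xi> z)) has_derivative (\<lambda>v. k (X c p v))) (at (snd c p) within ?V)"
      by (rule has_derivative_in_compose[OF has_derivative_at_withinI[OF dX[OF c]]
            has_derivative_subset[OF k im]])
    then have "((\<lambda>z. ?\<kappa> (?\<xi> z)) has_derivative (\<lambda>v. k (X c p v))) (at (snd c p))"
      using at_within_open[OF z0 image_open[OF c(1)]] by simp
    moreover have "((\<lambda>z. ?\<kappa> (?\<xi> z)) has_derivative (\<lambda>v. v)) (at (snd c p))"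
    proof (rule has_derivative_transform_within_open[OF has_derivative_ident image_open[OF c(1)] z0])
      fix z assume z: "z \<in> ?V"
      then have "\<sigma> (?\<xi> z) = \<psi> (chart_inv c z)" using x\<sigma>[OF V(2)] by simp
      moreover have "inv_into S \<psi> (\<psi> (chart_inv c z)) = chart_inv c z"
        using hom V(2)[OF z] unfolding homeomorphism_def by blast
      ultimately show "z = ?\<kappa> (?\<xi> z)" using coord_chart_inv[OF c(1) z] by simp
    qed
    ultimately have "(\<lambda>v. k (X c p v)) = (\<lambda>v. v)" by (rule has_derivative_unique)
    then have "k (X c p v) = v" by (rule fun_cong)
    moreover have "k 0 = 0" using linear_0[OF has_derivative_linear[OF k]] .
    ultimately show "v = 0" using X0 by simp
  qed
  \<comment> \<open>\<open>m\<close> annihilates all tangent vectors. As \<open>X c p\<close> is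
    onto, some of them have the horizontal parts \<open>1\<close> and \<open>\<i>\<close>; these two
    express the first components of \<open>m\<close> by the third, which is the factor called
    \<lambda> above.\<close>
  have m_eq: "m p $ 1 = - (m p $ 3) * y p $ 1" "m p $ 2 = - (m p $ 3) * y p $ 2" if p: "p \<in> S" for p
  proof -
    obtain c where c: "c \<in> A" "p \<in> fst c" using chart_ex[OF p] by blast
    have linX: "linear (X c p)" using dX[OF c] by (rule has_derivative_linear)
    have "inj (X c p)" using linear_injective_0[OF linX] X_inj[OF c] by blast
    then have "surj (X c p)" using linear_injective_imp_surjective[OF linX] by simp
    then obtain v1 v2 where v: "X c p v1 = 1" "X c p v2 = \<i>" by (metis surjD)
    have orth: "m p \<bullet> \<eta> c p v = 0" for v
      unfolding m_def \<eta>_def inner_transpose LM by (simp add: dot_cross_self)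
    then have z: "m p $ 1 * \<eta> c p v $ 1 + m p $ 2 * \<eta> c p v $ 2
        + m p $ 3 * (y p $ 1 * \<eta> c p v $ 1 + y p $ 2 * \<eta> c p v $ 2) = 0" for v
    proof -
      have "m p $ 1 * \<eta> c p v $ 1 + m p $ 2 * \<eta> c p v $ 2 + m p $ 3 * \<eta> c p v $ 3 = 0"
        using orth[of v] by (simp add: inner_vec_def sum_3)
      then show ?thesis by (simp only: \<eta>3[OF c])
    qed
    have "\<eta> c p v1 $ 1 = 1" "\<eta> c p v1 $ 2 = 0" "\<eta> c p v2 $ 1 = 0" "\<eta> c p v2 $ 2 = 1"
      using v by (simp_all add: X_def complex_eq_iff)
    then show "m p $ 1 = - (m p $ 3) * y p $ 1" "m p $ 2 = - (m p $ 3) * y p $ 2"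
      using z[of v1] z[of v2] by simp_all
  qed
  have sq: "(m p $ 3)\<^sup>2 = 1" if p: "p \<in> S" for p
  proof -
    obtain c where c: "c \<in> A" "p \<in> fst c" using chart_ex[OF p] by blast
    define \<mu> where "\<mu> v = transpose L *v (Re v *\<^sub>R dx c N p + Im v *\<^sub>R dy c N p)" for v
    define l where "l = m p $ 3"
    have dm: "((\<lambda>z. m (chart_inv c z) $ i) has_derivative (\<lambda>v. \<mu> v $ i)) (at (snd c p))" for i
    proof -
      have "bounded_linear (\<lambda>w. (transpose L *v w) $ i)"
        by (intro bounded_linear_compose[OF bounded_linear_vec_nth] matrix_vector_mul_bounded_linear)
      from bounded_linear.has_derivative[OF this conormalD(1)[OF N c]]
      show ?thesis by (simp add: m_def \<mu>_def comp_def)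
    qed
    have mui: "\<mu> v $ i = - (\<mu> v $ 3 * y p $ i + l * \<eta> c p v $ i)"
      if eq: "\<And>q. q \<in> S \<Longrightarrow> m q $ i = - (m q $ 3) * y q $ i" for i v
    proof -
      have "((\<lambda>z. - (m (chart_inv c z) $ 3 * y (chart_inv c z) $ i)) has_derivative
          (\<lambda>v. - (m (chart_inv c (snd c p)) $ 3 * \<eta> c p v $ i + \<mu> v $ 3 * y (chart_inv c (snd c p)) $ i))) (at (snd c p))"
        by (intro has_derivative_minus has_derivative_mult dm dy'[OF c])
      then have "((\<lambda>z. m (chart_inv c z) $ i) has_derivative
          (\<lambda>v. - (m (chart_inv c (snd c p)) $ 3 * \<eta> c p v $ i + \<mu> v $ 3 * y (chart_inv c (snd c p)) $ i))) (at (snd c p))"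
      proof (rule has_derivative_transform_within_open[OF _ image_open[OF c(1)]])
        fix z assume "z \<in> snd c ` fst c"
        then have "chart_inv c z \<in> S" using chart_inv_in[OF c(1)] domain_subset[OF c(1)] by blast
        then show "- (m (chart_inv c z) $ 3 * y (chart_inv c z) $ i) = m (chart_inv c z) $ i" using eq by simp
      qed (use c in auto)
      from fun_cong[OF has_derivative_unique[OF dm this], of v] show ?thesis
        using c by (simp add: l_def)
    qed
    \<comment> \<open>The cofactor identity
      \<open>L (L^T a \<times> L^T b) = det L (a \<times> b)\<close> carries the formula for
      \<open>d\<psi>\<close> over to the standard frame.\<close>
    have cross: "m p \<times> \<mu> (\<i> * v) = \<delta> *\<^sub>R \<eta> c p v" for v
    proof -
      have "L *v (m p \<times> \<mu> (\<i> * v)) = \<delta> *\<^sub>R (N p \<times> (Re v *\<^sub>R dy c N p - Im v *\<^sub>R dx c N p))"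
        using cross_matrix_mult[of "transpose L" "N p" "Re (\<i> * v) *\<^sub>R dx c N p + Im (\<i> * v) *\<^sub>R dy c N p"]
        by (simp add: m_def \<mu>_def transpose_transpose det_transpose \<delta>_def add.commute)
      then have "M *v (L *v (m p \<times> \<mu> (\<i> * v))) = \<delta> *\<^sub>R \<eta> c p v"
        by (simp add: \<eta>_def matrix_vector_mult_scaleR)
      then show ?thesis by (simp only: LM)
    qed
    \<comment> \<open>The terms with \<open>\<mu> (\<i> * v) $ 3\<close>, the derivative of the
      factor, cancel. In complex notation \<open>e1\<close> and \<open>e2\<close> together say
      \<open>\<delta> X(v) = - i l^2 X(i v)\<close>.\<close>
    have e1: "\<delta> * \<eta> c p v $ 1 = l\<^sup>2 * \<eta> c p (\<i> * v) $ 2" for v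
    proof -
      have "\<delta> * \<eta> c p v $ 1 = m p $ 2 * \<mu> (\<i> * v) $ 3 - m p $ 3 * \<mu> (\<i> * v) $ 2"
        using arg_cong[OF cross[of v], of "\<lambda>w :: real^3. w $ 1"] by (simp add: cross3_def)
      moreover have "\<mu> (\<i> * v) $ 2 = - (\<mu> (\<i> * v) $ 3 * y p $ 2 + l * \<eta> c p (\<i> * v) $ 2)"
        by (rule mui[OF m_eq(2)])
      moreover have "m p $ 2 = - l * y p $ 2" using m_eq(2)[OF p] by (simp only: l_def)
      ultimately show ?thesis
        by (simp only: l_def[symmetric]) (simp add: power2_eq_square algebra_simps)
    qed
    have e2: "\<delta> * \<eta> c p v $ 2 = - l\<^sup>2 * \<eta> c p (\<i> * v) $ 1" for v
    proof -
      have "\<delta> * \<eta> c p v $ 2 = m p $ 3 * \<mu> (\<i> * v) $ 1 - m p $ 1 * \<mu> (\<i> * v) $ 3"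
        using arg_cong[OF cross[of v], of "\<lambda>w :: real^3. w $ 2"] by (simp add: cross3_def)
      moreover have "\<mu> (\<i> * v) $ 1 = - (\<mu> (\<i> * v) $ 3 * y p $ 1 + l * \<eta> c p (\<i> * v) $ 1)"
        by (rule mui[OF m_eq(1)])
      moreover have "m p $ 1 = - l * y p $ 1" using m_eq(1)[OF p] by (simp only: l_def)
      ultimately show ?thesis
        by (simp only: l_def[symmetric]) (simp add: power2_eq_square algebra_simps)
    qed
    have neg: "\<eta> c p (- v) = - \<eta> c p v" for v
    proof -
      have "Re (- v) *\<^sub>R dy c N p - Im (- v) *\<^sub>R dx c N p = - (Re v *\<^sub>R dy c N p - Im v *\<^sub>R dx c N p)"
        by simp
      then show ?thesis
        unfolding \<eta>_def by (simp only: cross_minus_right linear_neg[OF matrix_vector_mul_linear])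
    qed
    \<comment> \<open>The relation is used twice, leading from \<open>1\<close> to
      \<open>\<i>\<close> and on to \<open>- 1\<close>; as \<open>\<delta> * \<delta> = 1\<close>,
      the accumulated factor is \<open>l^4\<close>.\<close>
    have "\<eta> c p 1 $ 1 = (\<delta> * \<delta>) * \<eta> c p 1 $ 1" using \<delta> by simp
    also have "\<dots> = l\<^sup>2 * (\<delta> * \<eta> c p \<i> $ 2)" using e1[of 1] by (simp add: algebra_simps)
    also have "\<dots> = l\<^sup>2 * l\<^sup>2 * \<eta> c p 1 $ 1" using e2[of \<i>] neg[of 1] by (simp add: algebra_simps)
    finally have f1: "(l\<^sup>2 * l\<^sup>2 - 1) * \<eta> c p 1 $ 1 = 0" by (simp add: algebra_simps)
    have "\<eta> c p 1 $ 2 = (\<delta> * \<delta>) * \<eta> c p 1 $ 2" using \<delta> by simp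
    also have "\<dots> = - l\<^sup>2 * (\<delta> * \<eta> c p \<i> $ 1)" using e2[of 1] by (simp add: algebra_simps)
    also have "\<dots> = l\<^sup>2 * l\<^sup>2 * \<eta> c p 1 $ 2" using e1[of \<i>] neg[of 1] by (simp add: algebra_simps)
    finally have f2: "(l\<^sup>2 * l\<^sup>2 - 1) * \<eta> c p 1 $ 2 = 0" by (simp add: algebra_simps)
    have "\<eta> c p 1 $ 1 \<noteq> 0 \<or> \<eta> c p 1 $ 2 \<noteq> 0"
      using X_inj[OF c, of 1] by (auto simp: X_def complex_eq_iff)
    then have "(l\<^sup>2 - 1) * (l\<^sup>2 + 1) = 0" using f1 f2 by (auto simp: algebra_simps)
    moreover have "l\<^sup>2 + 1 > 0" using zero_le_power2[of l] by linarith
    ultimately show ?thesis unfolding l_def[symmetric] by simp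
  qed
  \<comment> \<open>Pairing \<open>N\<close> with the image of the paraboloid's axis under
    \<open>L\<close> extracts the third component of \<open>m\<close>. Its value is 1 or -1 at each
    point, hence constant by connectedness.\<close>
  define a where "a = L *v axis 3 1"
  have am: "a \<bullet> N p = m p $ 3" for p
    using inner_transpose[of L "N p" "axis 3 1"] by (simp add: a_def m_def inner_axis inner_commute)
  have "a \<noteq> 0"
  proof
    assume "a = 0"
    then have "M *v (L *v axis 3 1) = 0" by (simp add: a_def)
    then show False by (simp add: LM axis_eq_0_iff)
  qed
  moreover have "\<exists>b. \<forall>p\<in>S. a \<bullet> N p = b"
  proof -
    have "continuous_on S (\<lambda>p. a \<bullet> N p)"
      by (intro continuous_intros conormal_continuous(1)[OF N])
    then have "connected ((\<lambda>p. a \<bullet> N p) ` S)" using connected_S by (rule connected_continuous_image)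
    moreover have "(\<lambda>p. a \<bullet> N p) ` S \<subseteq> {1, -1}"
      using sq by (auto simp: am power2_eq_1_iff)
    then have "finite ((\<lambda>p. a \<bullet> N p) ` S)" by (rule finite_subset) auto
    ultimately obtain t where "(\<lambda>p. a \<bullet> N p) ` S = {t}"
      using connected_finite_iff_sing S_nonempty by (metis image_is_empty)
    then show ?thesis by blast
  qed
  ultimately show ?thesis by blast
qed

section \<open>Punctured surfaces and the final assembly\<close>

lemma simply_connected_connected:
  fixes T :: "'b::t2_space set"
  assumes "simply_connected T"
  shows "connected T"
  unfolding connected_iff_connected_component
proof (intro ballI)
  fix a b assume ab: "a \<in> T" "b \<in> T"
  \<comment> \<open>Constant loops at \<open>a\<close> and \<open>b\<close> are homotopic, and the
    homotopy maps the unit square onto a connected subset of \<open>T\<close> containing both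
    points.\<close>
  have "homotopic_loops T (\<lambda>_. a) (\<lambda>_. b)"
    by (rule assms[unfolded simply_connected_def, rule_format])
       (use ab in \<open>auto simp: path_def path_image_def pathstart_def pathfinish_def\<close>)
  then obtain h where h: "continuous_on ({0..1::real} \<times> {0..1::real}) h" "h ` ({0..1} \<times> {0..1}) \<subseteq> T"
     "\<forall>x\<in>{0..1}. h (0, x) = a" "\<forall>x\<in>{0..1}. h (1, x) = b"
    unfolding homotopic_loops image_subset_iff_funcset by auto
  have "connected (h ` ({0..1} \<times> {0..1}))"
    by (rule connected_continuous_image[OF h(1)]) (intro convex_connected convex_Times convex_real_interval)
  moreover have "a \<in> h ` ({0..1} \<times> {0..1})"
    by (rule image_eqI[of _ _ "(0, 0)"]) (use h(3) in auto)
  moreover have "b \<in> h ` ({0..1} \<times> {0..1})"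
    by (rule image_eqI[of _ _ "(1, 0)"]) (use h(4) in auto)
  ultimately show "connected_component T a b" using h(2) unfolding connected_component_def by blast
qed

lemma riemann_surface_remove_points:
  assumes X: "riemann_surface X A" and P: "finite P" and conn: "connected (X - P)" "X - P \<noteq> {}"
  shows "riemann_surface (X - P) (remove_points A P)"
proof -
  interpret X: surface X A by unfold_locales (rule X)
  have op: "openin (top_of_set (X - P)) (U - P)" if c: "(U, \<phi>) \<in> A" for U \<phi>
  proof -
    obtain T where "open T" "U = X \<inter> T" using X.domain_openin[OF c] by (auto simp: openin_open)
    then show ?thesis unfolding openin_open by (intro exI[of _ T]) auto
  qed
  have opX: "openin (top_of_set X) (U - P)" if c: "(U, \<phi>) \<in> A" for U \<phi>
  proof -
    obtain T where "open T" "U = X \<inter> T" using X.domain_openin[OF c] by (auto simp: openin_open)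
    then show ?thesis unfolding openin_open
      by (intro exI[of _ "T - P"]) (auto intro: open_Diff finite_imp_closed[OF P])
  qed
  have inj: "inj_on \<phi> U" if "(U, \<phi>) \<in> A" for U \<phi>
    using X.chart_inv_coord[OF that] by (metis fst_conv inj_onI snd_conv)
  \<comment> \<open>\<open>chart_inv\<close> is formed with the domain of the chart, so shrinking
    the domain changes it; the two versions are compared only on the image of the smaller
    domain.\<close>
  have inv: "chart_inv (U - P, \<phi>) z = chart_inv (U, \<phi>) z" if c: "(U, \<phi>) \<in> A" "z \<in> \<phi> ` (U - P)" for U \<phi> z
  proof -
    obtain x where x: "x \<in> U - P" "z = \<phi> x" using c(2) by blast
    have "inj_on \<phi> (U - P)" using inj[OF c(1)] by (rule inj_on_subset) blast
    then show ?thesis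
      using x inj[OF c(1)] by (simp add: chart_inv_def inv_into_f_f)
  qed
  have hom: "homeomorphism (U - P) (\<phi> ` (U - P)) \<phi> (chart_inv (U - P, \<phi>))" if c: "(U, \<phi>) \<in> A" for U \<phi>
  proof -
    have "homeomorphism U (\<phi> ` U) \<phi> (chart_inv (U, \<phi>))" using X.chart_homeomorphism[OF c] by simp
    then have "homeomorphism (U - P) (\<phi> ` (U - P)) \<phi> (chart_inv (U, \<phi>))"
      by (rule homeomorphism_of_subsets) auto
    then show ?thesis by (rule homeomorphism_cong) (use inv[OF c] in auto)
  qed
  have hol: "(\<eta> \<circ> chart_inv (U - P, \<phi>)) holomorphic_on \<phi> ` ((U - P) \<inter> (V - P))"
    if c: "(U, \<phi>) \<in> A" "(V, \<eta>) \<in> A" for U \<phi> V \<eta>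
  proof -
    have "(\<eta> \<circ> chart_inv (U, \<phi>)) holomorphic_on \<phi> ` (U \<inter> V)"
      using X.transition_holomorphic[OF c] by simp
    then have "(\<eta> \<circ> chart_inv (U, \<phi>)) holomorphic_on \<phi> ` ((U - P) \<inter> (V - P))"
      by (rule holomorphic_on_subset) auto
    then show ?thesis
      by (rule holomorphic_transform) (use inv[OF c(1)] in auto)
  qed
  have img: "open (\<phi> ` (U - P))" if c: "(U, \<phi>) \<in> A" for U \<phi>
    using X.coord_image_open[OF c opX[OF c]] by auto
  have un: "(\<Union>c\<in>remove_points A P. fst c) = X - P"
    using X.Union_domains unfolding remove_points_def by (force simp: split_beta)
  show ?thesis
    unfolding riemann_surface_def
  proof (intro conjI)
    show "\<forall>(U, \<phi>)\<in>remove_points A P. openin (top_of_set (X - P)) U \<and> open (\<phi> ` U) \<and>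
        homeomorphism U (\<phi> ` U) \<phi> (chart_inv (U, \<phi>))"
      unfolding remove_points_def using op img hom by auto
    show "\<forall>(U, \<phi>)\<in>remove_points A P. \<forall>(V, \<eta>)\<in>remove_points A P.
        (\<eta> \<circ> chart_inv (U, \<phi>)) holomorphic_on \<phi> ` (U \<inter> V)"
      unfolding remove_points_def using hol by auto
  qed (use conn un in auto)
qed

theorem complete_affine_maxface_improper_iff:
  assumes "riemann_surface S A" "universal_cover St pr S" "complete_affine_maxface S A St pr \<psi>"
  shows "improper_affine_front S A St pr \<psi> \<longleftrightarrow> elliptic_paraboloid S A \<psi>"
proof -
  interpret surface S A by unfold_locales fact
  have cov: "covering_space St pr S" using assms(2) by (simp add: universal_cover_def)
  have compl: "complete_map S A St pr \<psi>" using assms(3) by (simp add: complete_affine_maxface_def)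
  obtain \<Phi> N where N: "affine_maximal_data S A St pr \<psi> \<Phi> N" "conformal_minimal_immersion A N"
    using assms(3) unfolding complete_affine_maxface_def affine_maxface_def by blast
  show ?thesis
  proof
    assume "improper_affine_front S A St pr \<psi>"
    then obtain \<Phi>' M a b where M: "affine_maximal_data S A St pr \<psi> \<Phi>' M" "a \<noteq> 0" "\<forall>p\<in>S. a \<bullet> M p = b"
      unfolding improper_affine_front_def by blast
    show "elliptic_paraboloid S A \<psi>"
      by (rule planar_complete_maxface[OF cov N M(1,2) bspec[OF M(3)] compl])
  next
    assume "elliptic_paraboloid S A \<psi>"
    then have "\<exists>a b. a \<noteq> 0 \<and> (\<forall>p\<in>S. a \<bullet> N p = b)"
      by (rule paraboloid_imp_planar[OF conormal_data(1)[OF cov N(1)]])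
    then show "improper_affine_front S A St pr \<psi>"
      unfolding improper_affine_front_def using N(1) by blast
  qed
qed

theorem constant_gauss_map_imp_paraboloid:
  assumes "riemann_surface S A" "universal_cover St pr S" "complete_affine_maxface S A St pr \<psi>"
    and \<nu>: "is_affine_gauss_map S A St pr \<psi> \<nu>" "\<nu> constant_on S"
  shows "elliptic_paraboloid S A \<psi>"
proof -
  interpret surface S A by unfold_locales fact
  have cov: "covering_space St pr S" using assms(2) by (simp add: universal_cover_def)
  obtain \<Phi> N where N: "affine_maximal_data S A St pr \<psi> \<Phi> N" "conformal_minimal_immersion A N"
    "\<forall>c\<in>A. \<forall>p\<in>fst c. \<nu> p = unit_normal (N \<circ> chart_inv c) (snd c p)"
    using \<nu>(1) unfolding is_affine_gauss_map_def by (elim exE conjE)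
  obtain \<nu>0 where \<nu>0: "\<forall>p\<in>S. \<nu> p = \<nu>0" using \<nu>(2) unfolding constant_on_def by blast
  have "unit_normal (N \<circ> chart_inv c) (snd c p) = \<nu>0" if "c \<in> A" "p \<in> fst c" for c p
  proof -
    have "p \<in> S" using domain_subset that by blast
    then show ?thesis using N(3) \<nu>0 that by metis
  qed
  from constant_normal_imp_planar[OF conormal_data(1)[OF cov N(1)] N(2) this]
  have "improper_affine_front S A St pr \<psi>"
    unfolding improper_affine_front_def using N(1) by blast
  then show ?thesis using complete_affine_maxface_improper_iff[OF assms(1-3)] by blast
qed

theorem theorem5p7:
  shows "(\<forall>(X :: 'a::t2_space set) A \<gamma> P (St :: 'b::t2_space set) pr \<psi>.
            riemann_surface X A \<and> compact X \<and> has_genus X \<gamma> \<and> finite P \<and> P \<subseteq> X \<and>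
            universal_cover St pr (X - P) \<and>
            complete_affine_maxface (X - P) (remove_points A P) St pr \<psi> \<longrightarrow>
            (improper_affine_front (X - P) (remove_points A P) St pr \<psi> \<longleftrightarrow>
             elliptic_paraboloid (X - P) (remove_points A P) \<psi>)) \<and>
         (\<forall>(S :: 'a::t2_space set) A (St :: 'b::t2_space set) pr \<psi> \<nu>.
            riemann_surface S A \<and> universal_cover St pr S \<and>
            complete_affine_maxface S A St pr \<psi> \<and>
            is_affine_gauss_map S A St pr \<psi> \<nu> \<and> \<nu> constant_on S \<longrightarrow>
            elliptic_paraboloid S A \<psi>)"
proof (rule conjI; intro allI impI; elim conjE)
  fix X :: "'a set" and A \<gamma> P and St :: "'b set" and pr \<psi>
  assume X: "riemann_surface X A" "finite P" and cov: "universal_cover St pr (X - P)"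
    and cm: "complete_affine_maxface (X - P) (remove_points A P) St pr \<psi>"
  have cs: "covering_space St pr (X - P)" "connected St"
    using cov simply_connected_connected by (auto simp: universal_cover_def)
  then have im: "pr ` St = X - P" by (simp add: covering_space_imp_surjective)
  \<comment> \<open>The punctured surface inherits connectedness from its simply connected cover, of
    which it is a continuous image.\<close>
  have "connected (X - P)"
    unfolding im[symmetric] by (rule connected_continuous_image[OF covering_space_imp_continuous[OF cs(1)] cs(2)])
  \<comment> \<open>The non-degeneracy clause of the affine maximal data exhibits a point of the
    cover.\<close>
  moreover have "St \<noteq> {}"
  proof -
    obtain \<Phi> N where "affine_maximal_data (X - P) (remove_points A P) St pr \<psi> \<Phi> N"
      using cm unfolding complete_affine_maxface_def affine_maxface_def by blast
    then obtain c q where "c \<in> cover_atlas St pr (remove_points A P)" "q \<in> fst c"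
      unfolding affine_maximal_data_def by blast
    then show ?thesis unfolding cover_atlas_def is_lift_def using openin_imp_subset by fastforce
  qed
  then have "X - P \<noteq> {}" using im by blast
  ultimately have "riemann_surface (X - P) (remove_points A P)"
    by (rule riemann_surface_remove_points[OF X])
  then show "improper_affine_front (X - P) (remove_points A P) St pr \<psi> \<longleftrightarrow>
             elliptic_paraboloid (X - P) (remove_points A P) \<psi>"
    using cov cm by (rule complete_affine_maxface_improper_iff)
qed (rule constant_gauss_map_imp_paraboloid)

end
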